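(* Let $L$ be a real analytic Nijenhuis operator defined in a neighbourhood of a point $\mathsf p$ of a two-dimensional manifold such that $L(\mathsf p)=\begin{pmatrix} 0 & 1 \\ 0 & 0 \end{pmatrix}$. Then in suitable local coordinates $(x,y)$ (with $\mathsf p=(0,0)$) this operator takes one of the following forms. 1. Series $L$, $M$ and $N$ (for $k\ge1$, $\epsilon=\pm1$): $$L_{\mathrm{nil}}=\begin{pmatrix} 0 & 1 \\ 0 & 0 \end{pmatrix},\quad L_{\mathrm{nd}}=\begin{pmatrix} x & 1 \\ y & 0 \end{pmatrix},\quad M_{2k-1}=\begin{pmatrix} 0 & 1 \\ 0 & y^{2k-1} \end{pmatrix},\quad M^{\epsilon}_{2k}=\begin{pmatrix} 0 & 1 \\ 0 & \epsilon y^{2k} \end{pmatrix},$$ $$N_{2k-1}=\begin{pmatrix} y^{2k-1} & 1 \\ 0 & y^{2k-1} \end{pmatrix},\quad N^{\epsilon}_{2k}=\begin{pmatrix} \epsilon y^{2k} & 1 \\ 0 & \epsilon y^{2k} \end{pmatrix}.$$ 2. Series $O^{d,\epsilon}_{k,\mathrm c}$, $k\ge1$, $d\ge2k+1$, $\epsilon=\pm1$, $\mathrm c=(c_0,\dots,c_{k-1})\in\mathbb R^k$, where one sets $\epsilon=1$ if $d$ is odd: $L$ is reconstructed from $v=\operatorname{tr}L$ and $u=-\det L$ given by $$v=\alpha xy^{2k-1}+y^k\bigl(c_{k-1}y^{k-1}+\dots+c_1y+c_0\bigr),\quad u=\epsilon\,y^d,\quad \alpha=kc_0^2\Bigl(1-\frac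 kd\Bigr)\neq0 .$$ 3. Series $P^{k,\epsilon}_{s,\mathrm c}$, $k\ge1$, $s\ge2k$, $\epsilon=\pm1$, $\mathrm c=(c_0,\dots,c_{k-1})\in\mathbb R^k$: $L$ is reconstructed from $$v=\alpha xy^s+y^{s-k+1}\bigl(c_{k-1}y^{k-1}+\dots+c_1y+c_0\bigr)+2\epsilon\,y^k,\quad u=-y^{2k},\quad \alpha=2\epsilon\,kc_0\ne0 .$$ 4. Series $S^{2k,\epsilon}_{\mathrm c}$ and $S^{2k+1}_{\mathrm c}$, $k\ge1$, $\epsilon=\pm1$, $\mathrm c=(c_0,\dots,c_{k-1})\in\mathbb R^k$: $L$ is reconstructed respectively from $$v=\alpha xy^{2k-1}+y^k\bigl(c_{k-1}y^{k-1}+\dots+c_1y+c_0\bigr),\quad u=\epsilon\,y^{2k},\quad \alpha=\frac k2\bigl(c_0^2+4\epsilon\bigr)\ne0,$$ $$v=\alpha xy^{2k}+y^{k+1}\bigl(c_{k-1}y^{k-1}+\dots+c_1y+c_0\bigr),\quad u=y^{2k+1},\quad \alpha=2k+1 .$$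
   Context: A $(1,1)$-tensor field $L$ is a Nijenhuis operator if $\mathcal N_L(\xi,\eta)=L^2[\xi,\eta]-L[L\xi,\eta]-L[\xi,L\eta]+[L\xi,L\eta]$ vanishes for all vector fields $\xi,\eta$. All objects are real analytic; coordinate transformations fix the origin. ``$L$ is reconstructed from $v=\operatorname{tr}L$, $u=-\det L$'' (with $\mathrm dv\wedge\mathrm du\neq0$ on an open dense set) means that the matrix of $L$ in coordinates $(x,y)$ is $$L=\begin{pmatrix} v_x & v_y \\ u_x & u_y \end{pmatrix}^{-1}\begin{pmatrix} v & 1 \\ u & 0 \end{pmatrix}\begin{pmatrix} v_x & v_y \\ u_x & u_y \end{pmatrix}$$ at points where the Jacobi matrix is invertible, and is defined by continuity at the remaining points. *)

theory Defs
  imports "HOL-Analysis.Analysis"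
begin

section \<open>Real analytic maps on the coordinate plane\<close>

text \<open>A point of \<^typ>\<open>real^2\<close> is read as a coordinate pair: \<open>x = z$1\<close>, \<open>y = z$2\<close>.
  Convergence in the sense of \<^const>\<open>has_sum\<close> is unconditional, so the order in which the
  double power series is summed plays no role.\<close>

definition real_analytic_on :: "(real^2 \<Rightarrow> 'b::real_normed_vector) \<Rightarrow> (real^2) set \<Rightarrow> bool" where
  "real_analytic_on f S \<longleftrightarrow>
     (\<forall>a\<in>S. \<exists>(C :: nat \<Rightarrow> nat \<Rightarrow> 'b) r. r > 0 \<and>
        (\<forall>z\<in>ball a r.
           ((\<lambda>(i, j). ((z$1 - a$1) ^ i * (z$2 - a$2) ^ j) *\<^sub>R C i j) has_sum f z) UNIV))"

definition mat2 :: "real \<Rightarrow> real \<Rightarrow> real \<Rightarrow> real \<Rightarrow> real^2^2" where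
  "mat2 a b c d = vector [vector [a, b], vector [c, d]]"

section \<open>Nijenhuis operators in coordinates\<close>

definition lie_bracket :: "(real^2 \<Rightarrow> real^2) \<Rightarrow> (real^2 \<Rightarrow> real^2) \<Rightarrow> real^2 \<Rightarrow> real^2" where
  "lie_bracket \<xi> \<eta> z =
     frechet_derivative \<eta> (at z) (\<xi> z) - frechet_derivative \<xi> (at z) (\<eta> z)"

definition nijenhuis_tensor ::
  "(real^2 \<Rightarrow> real^2^2) \<Rightarrow> (real^2 \<Rightarrow> real^2) \<Rightarrow> (real^2 \<Rightarrow> real^2) \<Rightarrow> real^2 \<Rightarrow> real^2" where
  "nijenhuis_tensor T \<xi> \<eta> z =
     T z *v (T z *v lie_bracket \<xi> \<eta> z)
     - T z *v lie_bracket (\<lambda>w. T w *v \<xi> w) \<eta> z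
     - T z *v lie_bracket \<xi> (\<lambda>w. T w *v \<eta> w) z
     + lie_bracket (\<lambda>w. T w *v \<xi> w) (\<lambda>w. T w *v \<eta> w) z"

definition nijenhuis_on :: "(real^2 \<Rightarrow> real^2^2) \<Rightarrow> (real^2) set \<Rightarrow> bool" where
  "nijenhuis_on T V \<longleftrightarrow>
     (\<forall>\<xi> \<eta>. real_analytic_on \<xi> V \<longrightarrow> real_analytic_on \<eta> V \<longrightarrow>
        (\<forall>z\<in>V. nijenhuis_tensor T \<xi> \<eta> z = 0))"

section \<open>Two-dimensional real analytic manifolds\<close>

text \<open>The manifold is the whole type \<open>'m\<close>. A chart is a domain together with a coordinate map,
  whose values outside the domain are irrelevant.\<close>

type_synonym 'm chart = "'m set \<times> ('m \<Rightarrow> real^2)"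

definition is_chart :: "'m::topological_space chart \<Rightarrow> bool" where
  "is_chart c \<longleftrightarrow> open (fst c) \<and> open (snd c ` fst c) \<and>
     homeomorphism (fst c) (snd c ` fst c) (snd c) (inv_into (fst c) (snd c))"

definition transition :: "'m chart \<Rightarrow> 'm chart \<Rightarrow> real^2 \<Rightarrow> real^2" where
  "transition c d = snd d \<circ> inv_into (fst c) (snd c)"

definition compatible :: "'m chart \<Rightarrow> 'm chart \<Rightarrow> bool" where
  "compatible c d \<longleftrightarrow>
     real_analytic_on (transition c d) (snd c ` (fst c \<inter> fst d)) \<and>
     real_analytic_on (transition d c) (snd d ` (fst c \<inter> fst d))"

definition analytic_atlas :: "'m::topological_space chart set \<Rightarrow> bool" where
  "analytic_atlas A \<longleftrightarrow>
     (\<Union>c\<in>A. fst c) = UNIV \<and> (\<forall>c\<in>A. is_chart c) \<and> (\<forall>c\<in>A. \<forall>d\<in>A. compatible c d)"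

text \<open>Local coordinate systems: the maximal atlas generated by \<open>A\<close>.\<close>

definition charts :: "'m::topological_space chart set \<Rightarrow> 'm chart set" where
  "charts A = {c. is_chart c \<and> (\<forall>a\<in>A. compatible a c)}"

section \<open>Operator fields\<close>

text \<open>An operator field, i.e. a tensor field of type (1,1), on an open set \<open>W\<close> is given by its
  matrix \<open>L c q\<close> at each point \<open>q\<close> with respect to each chart \<open>c\<close> around \<open>q\<close>, subject to the
  transformation law.\<close>

definition operator_field ::
  "'m::topological_space chart set \<Rightarrow> 'm set \<Rightarrow> ('m chart \<Rightarrow> 'm \<Rightarrow> real^2^2) \<Rightarrow> bool" where
  "operator_field A W L \<longleftrightarrow>
     (\<forall>c\<in>charts A. \<forall>d\<in>charts A. \<forall>q \<in> W \<inter> fst c \<inter> fst d.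
        let J = jacobian (transition c d) (at (snd c q))
        in L d q = J ** L c q ** matrix_inv J)"

text \<open>The matrix of \<open>L\<close> as a function of the coordinates of the chart.\<close>

definition in_coords ::
  "('m chart \<Rightarrow> 'm \<Rightarrow> real^2^2) \<Rightarrow> 'm chart \<Rightarrow> real^2 \<Rightarrow> real^2^2" where
  "in_coords L c = (\<lambda>z. L c (inv_into (fst c) (snd c) z))"

definition analytic_nijenhuis_operator ::
  "'m::topological_space chart set \<Rightarrow> 'm set \<Rightarrow> ('m chart \<Rightarrow> 'm \<Rightarrow> real^2^2) \<Rightarrow> bool" where
  "analytic_nijenhuis_operator A W L \<longleftrightarrow>
     operator_field A W L \<and>
     (\<forall>c\<in>charts A.
        real_analytic_on (in_coords L c) (snd c ` (W \<inter> fst c)) \<and>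
        nijenhuis_on (in_coords L c) (snd c ` (W \<inter> fst c)))"

section \<open>Operators reconstructed from trace and determinant\<close>

text \<open>The functions \<open>v\<close> and \<open>u\<close> are the trace and minus the determinant of \<open>T\<close>. The Jacobi matrix
  of \<open>(v, u)\<close> has rows \<open>(v\<^sub>x, v\<^sub>y)\<close> and \<open>(u\<^sub>x, u\<^sub>y)\<close>. Density of the points where it
  is invertible makes the continuous extension \<open>T\<close> of the displayed matrix unique.\<close>

definition reconstructed_from ::
  "(real^2 \<Rightarrow> real^2^2) \<Rightarrow> (real^2 \<Rightarrow> real) \<Rightarrow> (real^2 \<Rightarrow> real) \<Rightarrow> (real^2) set \<Rightarrow> bool" where
  "reconstructed_from T v u V \<longleftrightarrow>
     (let J = (\<lambda>z. jacobian (\<lambda>w. vector [v w, u w] :: real^2) (at z)) in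
        V \<subseteq> closure {z\<in>V. invertible (J z)} \<and>
        continuous_on V T \<and>
        (\<forall>z\<in>V. invertible (J z) \<longrightarrow>
           T z = matrix_inv (J z) ** mat2 (v z) 1 (u z) 0 ** J z))"

section \<open>Normal forms\<close>

definition L_nil :: "real^2 \<Rightarrow> real^2^2" where
  "L_nil z = mat2 0 1 0 0"

definition L_nd :: "real^2 \<Rightarrow> real^2^2" where
  "L_nd z = mat2 (z$1) 1 (z$2) 0"

definition M_odd :: "nat \<Rightarrow> real^2 \<Rightarrow> real^2^2" where
  "M_odd k z = mat2 0 1 0 ((z$2) ^ (2*k-1))"

definition M_even :: "nat \<Rightarrow> real \<Rightarrow> real^2 \<Rightarrow> real^2^2" where
  "M_even k \<epsilon> z = mat2 0 1 0 (\<epsilon> * (z$2) ^ (2*k))"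

definition N_odd :: "nat \<Rightarrow> real^2 \<Rightarrow> real^2^2" where
  "N_odd k z = mat2 ((z$2) ^ (2*k-1)) 1 0 ((z$2) ^ (2*k-1))"

definition N_even :: "nat \<Rightarrow> real \<Rightarrow> real^2 \<Rightarrow> real^2^2" where
  "N_even k \<epsilon> z = mat2 (\<epsilon> * (z$2) ^ (2*k)) 1 0 (\<epsilon> * (z$2) ^ (2*k))"

text \<open>In the remaining series only the values \<open>c 0, \<dots>, c (k-1)\<close> of the parameter
  \<open>c\<close> are used. The definitions give the trace \<open>v\<close>, with its coefficient \<open>\<alpha>\<close>, and \<open>u\<close>.\<close>

definition cpoly :: "nat \<Rightarrow> (nat \<Rightarrow> real) \<Rightarrow> real \<Rightarrow> real" where
  "cpoly k c y = (\<Sum>i<k. c i * y ^ i)"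

definition O_alpha :: "nat \<Rightarrow> nat \<Rightarrow> (nat \<Rightarrow> real) \<Rightarrow> real" where
  "O_alpha k d c = real k * (c 0)\<^sup>2 * (1 - real k / real d)"

definition O_v :: "nat \<Rightarrow> nat \<Rightarrow> (nat \<Rightarrow> real) \<Rightarrow> real^2 \<Rightarrow> real" where
  "O_v k d c z = O_alpha k d c * z$1 * (z$2) ^ (2*k-1) + (z$2) ^ k * cpoly k c (z$2)"

definition O_u :: "nat \<Rightarrow> real \<Rightarrow> real^2 \<Rightarrow> real" where
  "O_u d \<epsilon> z = \<epsilon> * (z$2) ^ d"

definition P_alpha :: "nat \<Rightarrow> real \<Rightarrow> (nat \<Rightarrow> real) \<Rightarrow> real" where
  "P_alpha k \<epsilon> c = 2 * \<epsilon> * real k * c 0"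

definition P_v :: "nat \<Rightarrow> real \<Rightarrow> nat \<Rightarrow> (nat \<Rightarrow> real) \<Rightarrow> real^2 \<Rightarrow> real" where
  "P_v k \<epsilon> s c z = P_alpha k \<epsilon> c * z$1 * (z$2) ^ s
     + (z$2) ^ (s - k + 1) * cpoly k c (z$2) + 2 * \<epsilon> * (z$2) ^ k"

definition P_u :: "nat \<Rightarrow> real^2 \<Rightarrow> real" where
  "P_u k z = - ((z$2) ^ (2*k))"

definition S_even_alpha :: "nat \<Rightarrow> real \<Rightarrow> (nat \<Rightarrow> real) \<Rightarrow> real" where
  "S_even_alpha k \<epsilon> c = real k / 2 * ((c 0)\<^sup>2 + 4 * \<epsilon>)"

definition S_even_v :: "nat \<Rightarrow> real \<Rightarrow> (nat \<Rightarrow> real) \<Rightarrow> real^2 \<Rightarrow> real" where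
  "S_even_v k \<epsilon> c z =
     S_even_alpha k \<epsilon> c * z$1 * (z$2) ^ (2*k-1) + (z$2) ^ k * cpoly k c (z$2)"

definition S_even_u :: "nat \<Rightarrow> real \<Rightarrow> real^2 \<Rightarrow> real" where
  "S_even_u k \<epsilon> z = \<epsilon> * (z$2) ^ (2*k)"

definition S_odd_v :: "nat \<Rightarrow> (nat \<Rightarrow> real) \<Rightarrow> real^2 \<Rightarrow> real" where
  "S_odd_v k c z =
     real (2*k+1) * z$1 * (z$2) ^ (2*k) + (z$2) ^ (k+1) * cpoly k c (z$2)"

definition S_odd_u :: "nat \<Rightarrow> real^2 \<Rightarrow> real" where
  "S_odd_u k z = (z$2) ^ (2*k+1)"

end

theory Submission
  imports Defs "HOL-Complex_Analysis.Complex_Analysis" "HOL-Real_Asymp.Real_Asymp"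
begin

text \<open>
  For \<open>v = tr L\<close> and \<open>u = -det L\<close> the Nijenhuis condition in dimension two is equivalent to
  \<open>L\<^sup>* dv = v dv + du\<close>, and then \<open>L\<^sup>* du = u dv\<close> follows from the Cayley-Hamilton identity. After
  straightening the vector field \<open>L \<partial>\<^sub>y\<close>, which is transversal to \<open>\<partial>\<^sub>y\<close>, the operator has a vanishing
  lower right entry and both \<open>u\<close> and, if \<open>u = 0\<close>, also \<open>v\<close> satisfy a linear homogeneous ordinary
  differential equation along the \<open>x\<close>-lines. Hence such a function is a power of \<open>y\<close> times a unit,
  and a new coordinate \<open>y\<close> makes it \<open>\<plusminus> y\<^sup>d\<close>. If \<open>u = 0\<close>, integrating along the \<open>x\<close>-lines leads to
  the series \<open>M\<close> or to \<open>L\<^sub>n\<^sub>i\<^sub>l\<close>. If \<open>u = \<plusminus> y\<close>, then \<open>(v, u)\<close> are coordinates. If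
  \<open>u = \<plusminus> y\<^sup>d\<close> with \<open>d \<ge> 2\<close>, the remaining equation shows that either \<open>v\<^sub>x = 0\<close>, which gives the
  series \<open>N\<close>, or \<open>v\<^sub>x = y\<^sup>s g\<close> with \<open>g(0) \<noteq> 0\<close>. In the latter case
  \<open>v = \<alpha> x y\<^sup>s + polynomial in y\<close> for a suitable new coordinate \<open>x\<close>, and the order of vanishing of
  \<open>v\<close> decides between the series \<open>O\<close>, \<open>P\<close> and \<open>S\<close>.
\<close>

text \<open>Analyticity is defined by double power series, for which roots, composites, flows and
  inverse maps would each need coefficient estimates. Real functions are therefore replaced by
  holomorphic extensions, and series serve only to pass between the two notions.

  The obstacle is local: dividing by the largest possible power of y leaves a factor that is not
  identically zero on y = 0 but may still vanish at the origin. Whenever a unit is required, the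
  Nijenhuis equations restrict on y = 0 to w_x = k w, and uniqueness excludes w(0) = 0.

  As for the constants \<alpha>: rescaling x can produce any nonzero number. Let m be the upper
  right entry of L and m v_x = y^s G. The choice \<alpha> = G(0) makes the new upper right entry 1
  at the origin. For v = c_0 y^k + ... and u = \<epsilon> y^d the candidates for the lowest term of
  m v_x are d \<epsilon> y^(d-1) and k (1 - k/d) c_0^2 y^(2k-1); comparing exponents gives the
  values in O and S. In P these two cancel, and the next coefficient is 2 \<epsilon> k c_0.\<close>

no_notation fps_nth (infixl "$" 75)

section \<open>Holomorphic functions of two variables\<close>

text \<open>Osgood's form of holomorphy; Frechet differentiability and power series expansions
  are consequences of it.\<close>

definition hol2 :: "(complex \<times> complex \<Rightarrow> complex) \<Rightarrow> (complex \<times> complex) set \<Rightarrow> bool" where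
  "hol2 F S \<longleftrightarrow> continuous_on S F \<and>
     (\<forall>z w. (z, w) \<in> S \<longrightarrow> (\<lambda>t. F (t, w)) field_differentiable (at z) \<and>
                            (\<lambda>t. F (z, t)) field_differentiable (at w))"

text \<open>Bidiscs are preferred to metric balls because their coordinate slices are discs, on
  which the one-variable theorems apply.\<close>

definition bidisc :: "complex \<times> complex \<Rightarrow> real \<Rightarrow> (complex \<times> complex) set" where
  "bidisc p r = ball (fst p) r \<times> ball (snd p) r"

definition cbidisc :: "complex \<times> complex \<Rightarrow> real \<Rightarrow> (complex \<times> complex) set" where
  "cbidisc p r = cball (fst p) r \<times> cball (snd p) r"

definition c1 :: "(complex \<times> complex \<Rightarrow> complex) \<Rightarrow> complex \<times> complex \<Rightarrow> complex" where
  "c1 F p = deriv (\<lambda>t. F (t, snd p)) (fst p)"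

definition c2 :: "(complex \<times> complex \<Rightarrow> complex) \<Rightarrow> complex \<times> complex \<Rightarrow> complex" where
  "c2 F p = deriv (\<lambda>t. F (fst p, t)) (snd p)"

section \<open>Bidiscs and closure properties of separate holomorphy\<close>

lemma open_bidisc [simp]: "open (bidisc p r)"
  by (simp add: bidisc_def open_Times)

lemma compact_cbidisc [simp]: "compact (cbidisc p r)"
  by (simp add: cbidisc_def compact_Times)

lemma centre_in_bidisc [simp]: "p \<in> bidisc p r \<longleftrightarrow> r > 0"
  by (cases p) (simp add: bidisc_def)

lemma bidisc_mono: "r \<le> s \<Longrightarrow> bidisc p r \<subseteq> bidisc p s"
  by (auto simp: bidisc_def)

lemma bidisc_cbidisc: "bidisc p r \<subseteq> cbidisc p r"
  by (auto simp: bidisc_def cbidisc_def)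

lemma open_contains_cbidisc:
  assumes "open S" "p \<in> S"
  obtains r where "r > 0" "cbidisc p r \<subseteq> S"
proof -
  obtain e where e: "e > 0" "cball p e \<subseteq> S"
    using assms open_contains_cball by blast
  have "cbidisc p (e/2) \<subseteq> cball p e"
  proof
    fix q assume "q \<in> cbidisc p (e/2)"
    then have "dist (fst p) (fst q) \<le> e/2" "dist (snd p) (snd q) \<le> e/2"
      by (auto simp: cbidisc_def)
    moreover have "dist p q \<le> dist (fst p) (fst q) + dist (snd p) (snd q)"
      unfolding dist_prod_def by (rule sqrt_sum_squares_le_sum) auto
    ultimately show "q \<in> cball p e" by simp
  qed
  then show ?thesis using e that[of "e/2"] by auto
qed

lemma open_contains_bidisc:
  assumes "open S" "p \<in> S"
  obtains r where "r > 0" "bidisc p r \<subseteq> S"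
  by (metis open_contains_cbidisc[OF assms] bidisc_cbidisc subset_trans)

lemma hol2_subset: "hol2 F S \<Longrightarrow> T \<subseteq> S \<Longrightarrow> hol2 F T"
  unfolding hol2_def using continuous_on_subset by blast

lemma hol2_local:
  assumes "\<And>p. p \<in> S \<Longrightarrow> \<exists>T. open T \<and> p \<in> T \<and> hol2 F T"
  shows "hol2 F S"
proof -
  have "isCont F p" if "p \<in> S" for p
    using assms[OF that] continuous_on_interior interior_open unfolding hol2_def by blast
  then have "continuous_on S F"
    using continuous_at_imp_continuous_on by blast
  then show ?thesis using assms unfolding hol2_def by blast
qed

lemma hol2_fd1: "hol2 F S \<Longrightarrow> (z, w) \<in> S \<Longrightarrow> (\<lambda>t. F (t, w)) field_differentiable (at z)"
  by (auto simp: hol2_def)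

lemma hol2_fd2: "hol2 F S \<Longrightarrow> (z, w) \<in> S \<Longrightarrow> (\<lambda>t. F (z, t)) field_differentiable (at w)"
  by (auto simp: hol2_def)

lemma hol2_cont: "hol2 F S \<Longrightarrow> continuous_on S F"
  by (auto simp: hol2_def)

lemma hol2_holo1: "hol2 F S \<Longrightarrow> (\<And>t. t \<in> T \<Longrightarrow> (t, w) \<in> S) \<Longrightarrow> (\<lambda>t. F (t, w)) holomorphic_on T"
  unfolding holomorphic_on_def using hol2_fd1[of F S _ w] field_differentiable_at_within by blast

lemma hol2_holo2: "hol2 F S \<Longrightarrow> (\<And>t. t \<in> T \<Longrightarrow> (z, t) \<in> S) \<Longrightarrow> (\<lambda>t. F (z, t)) holomorphic_on T"
  unfolding holomorphic_on_def using hol2_fd2[of F S z] field_differentiable_at_within by blast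

lemma hol2I:
  assumes "continuous_on S F" "open S"
    and "\<And>z w. (z, w) \<in> S \<Longrightarrow> (\<lambda>t. F (t, w)) field_differentiable (at z)"
    and "\<And>z w. (z, w) \<in> S \<Longrightarrow> (\<lambda>t. F (z, t)) field_differentiable (at w)"
  shows "hol2 F S"
  using assms by (auto simp: hol2_def)

lemma hol2_swap:
  assumes "hol2 F S"
  shows "hol2 (\<lambda>p. F (snd p, fst p)) {p. (snd p, fst p) \<in> S}"
  unfolding hol2_def
proof (intro conjI allI impI)
  show "continuous_on {p. (snd p, fst p) \<in> S} (\<lambda>p. F (snd p, fst p))"
    by (rule continuous_on_compose2[OF hol2_cont[OF assms]]) (auto intro!: continuous_intros)
qed (use assms in \<open>auto simp: hol2_def\<close>)

lemma hol2_const [simp]: "hol2 (\<lambda>p. c) S"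
  by (simp add: hol2_def)

lemma hol2_fst [simp]: "hol2 fst S"
  by (simp add: hol2_def continuous_on_fst)

lemma hol2_snd [simp]: "hol2 snd S"
  by (simp add: hol2_def continuous_on_snd)

lemma hol2_add: "hol2 F S \<Longrightarrow> hol2 G S \<Longrightarrow> hol2 (\<lambda>p. F p + G p) S"
  by (auto simp: hol2_def intro!: continuous_intros derivative_intros)

lemma hol2_diff: "hol2 F S \<Longrightarrow> hol2 G S \<Longrightarrow> hol2 (\<lambda>p. F p - G p) S"
  by (auto simp: hol2_def intro!: continuous_intros derivative_intros)

lemma hol2_mult: "hol2 F S \<Longrightarrow> hol2 G S \<Longrightarrow> hol2 (\<lambda>p. F p * G p) S"
  by (auto simp: hol2_def intro!: continuous_intros derivative_intros)

lemma hol2_power: "hol2 F S \<Longrightarrow> hol2 (\<lambda>p. F p ^ n) S"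
  by (induction n) (auto intro: hol2_mult)

lemma hol2_sum: "(\<And>i. i \<in> I \<Longrightarrow> hol2 (F i) S) \<Longrightarrow> hol2 (\<lambda>p. \<Sum>i\<in>I. F i p) S"
  by (induction I rule: infinite_finite_induct) (auto intro: hol2_add)

lemma hol2_comp_holo:
  assumes "hol2 F S" "h holomorphic_on T" "open T" "\<And>p. p \<in> S \<Longrightarrow> F p \<in> T"
  shows "hol2 (\<lambda>p. h (F p)) S"
  unfolding hol2_def
proof (intro conjI allI impI)
  show "continuous_on S (\<lambda>p. h (F p))"
    using continuous_on_compose2[OF holomorphic_on_imp_continuous_on[OF assms(2)] hol2_cont[OF assms(1)]] assms(4)
    by blast
next
  fix z w assume p: "(z, w) \<in> S"
  have h: "h field_differentiable at (F (z, w))"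
    using assms p holomorphic_on_imp_differentiable_at by blast
  show "(\<lambda>t. h (F (t, w))) field_differentiable at z"
    using field_differentiable_compose[OF hol2_fd1[OF assms(1) p], of h] h by (simp add: o_def)
  show "(\<lambda>t. h (F (z, t))) field_differentiable at w"
    using field_differentiable_compose[OF hol2_fd2[OF assms(1) p], of h] h by (simp add: o_def)
qed

text \<open>The limit is treated slice by slice with the one-variable theorem. The filter is
  arbitrary because the lemma serves both sequences, such as difference quotients and Picard
  iterates, and unordered sums along \<open>finite_subsets_at_top\<close>.\<close>

lemma hol2_uniform_limit:
  assumes S: "open S" and f: "\<And>n. hol2 (f n) S" and lim: "uniform_limit S f g \<F>"
    and nt: "\<F> \<noteq> bot"
  shows "hol2 g S"
proof (rule hol2I[OF _ S])
  show "continuous_on S g"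
    by (rule uniform_limit_theorem[OF _ lim]) (use f hol2_cont nt in auto)
next
  fix z w assume p: "(z, w) \<in> S"
  obtain r where r: "r > 0" "cbidisc (z, w) r \<subseteq> S"
    using open_contains_cbidisc[OF S p] .
  have 1: "(t, w) \<in> S" if "t \<in> cball z r" for t
    using r that by (auto simp: cbidisc_def)
  have 2: "(z, t) \<in> S" if "t \<in> cball w r" for t
    using r that by (auto simp: cbidisc_def)
  have "(\<lambda>t. g (t, w)) holomorphic_on ball z r"
  proof (rule holomorphic_uniform_limit[where f = "\<lambda>n t. f n (t, w)" and r = r and F = \<F>])
    show "uniform_limit (cball z r) (\<lambda>n t. f n (t, w)) (\<lambda>t. g (t, w)) \<F>"
      using lim 1 unfolding uniform_limit_iff by (force elim: eventually_mono)
    show "\<forall>\<^sub>F n in \<F>. continuous_on (cball z r) (\<lambda>t. f n (t, w)) \<and>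
            (\<lambda>t. f n (t, w)) holomorphic_on ball z r"
      using 1 by (intro always_eventually allI conjI hol2_holo1[OF f]
          holomorphic_on_imp_continuous_on) auto
  qed (use nt in auto)
  then show "(\<lambda>t. g (t, w)) field_differentiable at z"
    using r(1) holomorphic_on_imp_differentiable_at[of _ "ball z r"] by simp
  have "(\<lambda>t. g (z, t)) holomorphic_on ball w r"
  proof (rule holomorphic_uniform_limit[where f = "\<lambda>n t. f n (z, t)" and r = r and F = \<F>])
    show "uniform_limit (cball w r) (\<lambda>n t. f n (z, t)) (\<lambda>t. g (z, t)) \<F>"
      using lim 2 unfolding uniform_limit_iff by (force elim: eventually_mono)
    show "\<forall>\<^sub>F n in \<F>. continuous_on (cball w r) (\<lambda>t. f n (z, t)) \<and>
            (\<lambda>t. f n (z, t)) holomorphic_on ball w r"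
      using 2 by (intro always_eventually allI conjI hol2_holo2[OF f]
          holomorphic_on_imp_continuous_on) auto
  qed (use nt in auto)
  then show "(\<lambda>t. g (z, t)) field_differentiable at w"
    using r(1) holomorphic_on_imp_differentiable_at[of _ "ball w r"] by simp
qed

text \<open>Taylor's remainder with Cauchy's bound \<open>2 * B / r\<^sup>2\<close> for the second
  derivative. The constant does not depend on z, which makes the difference quotients in
  \<open>hol2_c1\<close> converge uniformly. The radius \<open>4 * r\<close> leaves room: a point
  within r of a point within r of z is less than 3 r away from a.\<close>

lemma second_order_bound:
  assumes f: "f holomorphic_on ball a (4 * r)" and "r > 0"
    and B: "\<And>x. x \<in> ball a (4 * r) \<Longrightarrow> cmod (f x) \<le> B"
    and z: "z \<in> ball a r" and h: "cmod h < r"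
  shows "cmod (f (z + h) - f z - h * deriv f z) \<le> 2 * B / r\<^sup>2 * (cmod h)\<^sup>2"
proof -
  define F where "F = (\<lambda>i::nat. (deriv ^^ i) f)"
  have sub: "ball z r \<subseteq> ball a (4 * r)" "\<And>x. x \<in> ball z r \<Longrightarrow> cball x r \<subseteq> ball a (4 * r)"
  proof -
    have *: "y \<in> ball a (4*r)" if "x \<in> ball z r" "y \<in> cball x r" for x y
      using that z dist_triangle[of a y x] dist_triangle[of a x z] \<open>r > 0\<close> by simp
    show "\<And>x. x \<in> ball z r \<Longrightarrow> cball x r \<subseteq> ball a (4 * r)" using * by blast
    show "ball z r \<subseteq> ball a (4 * r)" using *[of z] \<open>r > 0\<close> by auto
  qed
  have hF: "F i holomorphic_on ball a (4 * r)" for i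
    unfolding F_def by (rule holomorphic_higher_deriv[OF f]) simp
  have "cmod (F 0 (z + h) - (\<Sum>i\<le>1. F i z * ((z + h) - z) ^ i / (fact i))) \<le>
        (2 * B / r\<^sup>2) * cmod ((z + h) - z) ^ (Suc 1) / fact 1"
  proof (rule complex_Taylor[where S = "ball z r"])
    show "(F i has_field_derivative F (Suc i) x) (at x within ball z r)" if "x \<in> ball z r" for i x
    proof -
      have "(F i has_field_derivative deriv (F i) x) (at x)"
        by (rule holomorphic_derivI[OF hF open_ball]) (use that sub(1) in blast)
      then show ?thesis by (simp add: F_def has_field_derivative_at_within)
    qed
    show "cmod (F (Suc 1) x) \<le> 2 * B / r\<^sup>2" if x: "x \<in> ball z r" for x
    proof -
      have "cmod ((deriv ^^ 2) f x) \<le> fact 2 * B / r ^ 2"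
      proof (rule Cauchy_inequality)
        have "f holomorphic_on cball x r"
          using f sub(2)[OF x] by (rule holomorphic_on_subset)
        then show "f holomorphic_on ball x r" "continuous_on (cball x r) f"
          using ball_subset_cball holomorphic_on_subset holomorphic_on_imp_continuous_on by blast+
        show "cmod (f y) \<le> B" if "cmod (x - y) = r" for y
          using sub(2)[OF x] that by (intro B) (auto simp: dist_norm)
      qed (rule \<open>r > 0\<close>)
      then show ?thesis by (simp add: F_def numeral_2_eq_2)
    qed
  qed (use z h \<open>r > 0\<close> in \<open>auto simp: dist_norm\<close>)
  then show ?thesis by (simp add: F_def power2_eq_square algebra_simps)
qed

lemma hol2_bounded:
  assumes "hol2 F S" "cbidisc p r \<subseteq> S"
  obtains B where "B > 0" "\<And>q. q \<in> cbidisc p r \<Longrightarrow> cmod (F q) \<le> B"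
proof -
  have "compact (F ` cbidisc p r)"
    using assms hol2_cont by (intro compact_continuous_image) (auto intro: continuous_on_subset)
  then show ?thesis
    using that compact_imp_bounded bounded_pos by (metis imageI)
qed

text \<open>On a smaller bidisc the partial derivative is a uniform limit of the difference
  quotients \<open>G n\<close>, which are again in \<open>hol2\<close>. The error is of the order of
  \<open>h n\<close> by \<open>second_order_bound\<close>, with one bound B for all slices, so joint
  continuity of the derivative comes from the limit.\<close>

lemma hol2_c1:
  assumes S: "open S" and F: "hol2 F S"
  shows "hol2 (c1 F) S"
proof (rule hol2_local)
  fix p assume p: "p \<in> S"
  obtain R where R: "R > 0" "cbidisc p R \<subseteq> S" using open_contains_cbidisc[OF S p] .
  define r where "r = R / 4"
  have r: "r > 0" "R = 4 * r" using R by (auto simp: r_def)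
  obtain B where B: "B > 0" "\<And>q. q \<in> cbidisc p R \<Longrightarrow> cmod (F q) \<le> B"
    using hol2_bounded[OF F R(2)] by blast
  \<comment> \<open>The \<open>+ 2\<close> keeps every increment strictly below r, so that each
    quotient is defined on all of \<open>bidisc p r\<close>.\<close>
  define h where "h = (\<lambda>n::nat. complex_of_real (r / (real n + 2)))"
  have hr: "cmod (h n) < r" "h n \<noteq> 0" for n
  proof -
    have "0 < r / (real n + 2)" "r / (real n + 2) < r"
      using r by (simp_all add: divide_simps)
    then show "cmod (h n) < r" "h n \<noteq> 0" unfolding h_def norm_of_real of_real_eq_0_iff by linarith+
  qed
  define G where "G = (\<lambda>n q. (F (fst q + h n, snd q) - F q) / h n)"
  have inS: "(fst q + h n, snd q) \<in> S" if "q \<in> bidisc p r" for q n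
  proof -
    have "dist (fst p) (fst q + h n) \<le> R"
      using that hr[of n] dist_triangle[of "fst p" "fst q + h n" "fst q"] r
      by (auto simp: bidisc_def dist_norm)
    then show ?thesis using that R r by (auto simp: bidisc_def cbidisc_def)
  qed
  have sub: "bidisc p r \<subseteq> S" using R r by (auto simp: bidisc_def cbidisc_def)
  have hG: "hol2 (G n) (bidisc p r)" for n
  proof -
    have "hol2 (\<lambda>q. F (fst q + h n, snd q)) (bidisc p r)"
      unfolding hol2_def
    proof (intro conjI allI impI)
      show "continuous_on (bidisc p r) (\<lambda>q. F (fst q + h n, snd q))"
        by (rule continuous_on_compose2[OF hol2_cont[OF F]]) (auto intro!: continuous_intros inS)
    next
      fix z w assume q: "(z, w) \<in> bidisc p r"
      have "(\<lambda>t. F (t, w)) field_differentiable at (z + h n)"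
        using hol2_fd1[OF F] inS[OF q] by simp
      then show "(\<lambda>t. F (fst (t, w) + h n, snd (t, w))) field_differentiable at z"
        using field_differentiable_compose[of "\<lambda>t. t + h n" z "\<lambda>t. F (t, w)"]
        by (simp add: o_def field_differentiable_add)
      show "(\<lambda>t. F (fst (z, t) + h n, snd (z, t))) field_differentiable at w"
        using hol2_fd2[OF F] inS[OF q] by simp
    qed
    then have "hol2 (\<lambda>q. (F (fst q + h n, snd q) - F q) * inverse (h n)) (bidisc p r)"
      by (intro hol2_mult hol2_diff hol2_const hol2_subset[OF F sub])
    then show ?thesis by (simp add: G_def divide_inverse)
  qed
  have bd: "cmod (G n q - c1 F q) \<le> 2 * B / r\<^sup>2 * cmod (h n)" if q: "q \<in> bidisc p r" for n q
  proof -
    have "cmod (F (fst q + h n, snd q) - F (fst q, snd q) - h n * deriv (\<lambda>t. F (t, snd q)) (fst q))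
       \<le> 2 * B / r\<^sup>2 * (cmod (h n))\<^sup>2"
    proof (rule second_order_bound[where a = "fst p" and f = "\<lambda>t. F (t, snd q)"])
      show "(\<lambda>t. F (t, snd q)) holomorphic_on ball (fst p) (4 * r)"
        using q R r by (intro hol2_holo1[OF F]) (auto simp: bidisc_def cbidisc_def)
      show "cmod (F (x, snd q)) \<le> B" if "x \<in> ball (fst p) (4 * r)" for x
        using q R r that by (intro B) (auto simp: bidisc_def cbidisc_def)
    qed (use r hr q in \<open>auto simp: bidisc_def\<close>)
    also have "F (fst q + h n, snd q) - F (fst q, snd q) - h n * deriv (\<lambda>t. F (t, snd q)) (fst q)
        = h n * (G n q - c1 F q)"
      using hr(2)[of n] by (simp add: G_def c1_def field_simps)
    finally have "cmod (h n * (G n q - c1 F q)) \<le> 2 * B / r\<^sup>2 * (cmod (h n))\<^sup>2" .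
    then have "cmod (h n) * cmod (G n q - c1 F q) \<le> cmod (h n) * (2 * B / r\<^sup>2 * cmod (h n))"
      by (simp add: norm_mult power2_eq_square mult_ac)
    then show ?thesis by (rule mult_left_le_imp_le) (use hr(2)[of n] in simp)
  qed
  have "(\<lambda>n::nat. r / (real n + 2)) \<longlonglongrightarrow> 0"
    by real_asymp
  then have "h \<longlonglongrightarrow> 0"
    unfolding h_def using tendsto_of_real_iff[of _ 0 sequentially] by force
  then have lim: "(\<lambda>n. 2 * B / r\<^sup>2 * cmod (h n)) \<longlonglongrightarrow> 0"
    using tendsto_norm_zero tendsto_mult_right_zero by blast
  have "uniform_limit (bidisc p r) G (c1 F) sequentially"
    unfolding uniform_limit_iff
  proof (intro allI impI)
    fix e :: real assume "e > 0"
    with lim have "\<forall>\<^sub>F n in sequentially. 2 * B / r\<^sup>2 * cmod (h n) < e"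
      by (rule order_tendstoD)
    then show "\<forall>\<^sub>F n in sequentially. \<forall>x\<in>bidisc p r. dist (G n x) (c1 F x) < e"
      by eventually_elim (auto simp: dist_norm intro: le_less_trans[OF bd])
  qed
  then have "hol2 (c1 F) (bidisc p r)"
    by (rule hol2_uniform_limit[OF open_bidisc hG]) simp
  then show "\<exists>T. open T \<and> p \<in> T \<and> hol2 (c1 F) T"
    using r by (intro exI[of _ "bidisc p r"]) auto
qed

lemma hol2_c2:
  assumes S: "open S" and F: "hol2 F S"
  shows "hol2 (c2 F) S"
proof -
  let ?s = "\<lambda>p::complex\<times>complex. (snd p, fst p)"
  have o: "open {p. ?s p \<in> S}"
    by (rule open_vimage[OF S, of ?s, unfolded vimage_def]) (auto intro!: continuous_intros)
  have "hol2 (c1 (\<lambda>p. F (?s p))) {p. ?s p \<in> S}"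
    by (rule hol2_c1[OF o hol2_swap[OF F]])
  from hol2_swap[OF this] have "hol2 (\<lambda>p. c1 (\<lambda>p. F (?s p)) (?s p)) S" by simp
  then show ?thesis by (simp add: c1_def c2_def[abs_def])
qed

lemma hol2_DERIV1:
  "hol2 F S \<Longrightarrow> (z, w) \<in> S \<Longrightarrow> ((\<lambda>t. F (t, w)) has_field_derivative c1 F (z, w)) (at z)"
  using hol2_fd1 by (simp add: c1_def DERIV_deriv_iff_field_differentiable)

lemma hol2_DERIV2:
  "hol2 F S \<Longrightarrow> (z, w) \<in> S \<Longrightarrow> ((\<lambda>t. F (z, t)) has_field_derivative c2 F (z, w)) (at w)"
  using hol2_fd2 by (simp add: c2_def DERIV_deriv_iff_field_differentiable)

text \<open>One partial derivative at the point, together with existence nearby and continuity of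
  the other, gives total differentiability; the continuity is \<open>hol2_c2\<close>.\<close>

lemma hol2_has_derivative:
  assumes S: "open S" and F: "hol2 F S" and p: "p \<in> S"
  shows "(F has_derivative (\<lambda>h. c1 F p * fst h + c2 F p * snd h)) (at p)"
proof -
  obtain z w where zw: "p = (z, w)" by (cases p)
  obtain r where r: "r > 0" "bidisc p r \<subseteq> S" using open_contains_bidisc[OF S p] .
  let ?X = "ball z r" and ?Y = "ball w r"
  have sub: "?X \<times> ?Y \<subseteq> S" using r by (simp add: bidisc_def zw)
  have "((\<lambda>(x, y). F (x, y)) has_derivative
      (\<lambda>(tx, ty). c1 F p * tx + blinfun_apply (blinfun_mult_right (c2 F (z, w))) ty)) (at (z, w) within ?X \<times> ?Y)"
  proof (rule has_derivative_partialsI[where fy = "\<lambda>x y. blinfun_mult_right (c2 F (x, y))"])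
    show "((\<lambda>x. F (x, w)) has_derivative (*) (c1 F p)) (at z within ?X)"
      using hol2_DERIV1[OF F, of z w] p zw has_derivative_at_withinI
      by (auto simp: has_field_derivative_def)
    show "((\<lambda>y. F (x, y)) has_derivative blinfun_apply (blinfun_mult_right (c2 F (x, y)))) (at y within ?Y)"
      if "x \<in> ?X" "y \<in> ?Y" for x y
    proof -
      have "(x, y) \<in> S" using that sub by blast
      from hol2_DERIV2[OF F this] show ?thesis
        by (simp add: has_field_derivative_def has_derivative_at_withinI)
    qed
    have "continuous_on S (\<lambda>q. blinfun_mult_right (c2 F q))"
      by (intro bounded_linear.continuous_on[OF bounded_linear_blinfun_mult_right] hol2_cont hol2_c2 S F)
    then have "continuous (at p) (\<lambda>q. blinfun_mult_right (c2 F q))"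
      using S p continuous_on_eq_continuous_at by blast
    then show "continuous (at (z, w) within ?X \<times> ?Y) (\<lambda>(x, y). blinfun_mult_right (c2 F (x, y)))"
      by (simp add: zw case_prod_unfold continuous_at_imp_continuous_within)
  qed (use r in auto)
  then have "(F has_derivative (\<lambda>h. c1 F p * fst h + c2 F p * snd h)) (at p within ?X \<times> ?Y)"
    by (simp add: zw case_prod_unfold)
  moreover have "at p within ?X \<times> ?Y = at p"
    by (rule at_within_open) (use r zw in \<open>auto simp: open_Times\<close>)
  ultimately show ?thesis by simp
qed

text \<open>Even when the argument moves along one coordinate, the curve traced by (G, H) is
  oblique. Separate differentiability of F says nothing about it; the total derivative does.\<close>

lemma hol2_compose:
  assumes S: "open S" and F: "hol2 F S" and T: "open T" and G: "hol2 G T" "hol2 H T"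
    and sub: "\<And>p. p \<in> T \<Longrightarrow> (G p, H p) \<in> S"
  shows "hol2 (\<lambda>p. F (G p, H p)) T"
proof (rule hol2I[OF _ T])
  show "continuous_on T (\<lambda>p. F (G p, H p))"
    by (rule continuous_on_compose2[OF hol2_cont[OF F]])
       (auto intro!: continuous_intros hol2_cont[OF G(1)] hol2_cont[OF G(2)] sub)
  have *: "(\<lambda>t. F (g t, h t)) field_differentiable at z"
    if gh0: "g field_differentiable at z" "h field_differentiable at z" and gS: "(g z, h z) \<in> S" for g h z
  proof -
    obtain g' h' where gh: "(g has_field_derivative g') (at z)" "(h has_field_derivative h') (at z)"
      using gh0 unfolding field_differentiable_def by blast
    have "((\<lambda>t. (g t, h t)) has_derivative (\<lambda>t. (g' * t, h' * t))) (at z)"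
      using gh by (intro has_derivative_Pair) (auto simp: has_field_derivative_def)
    from diff_chain_at[OF this hol2_has_derivative[OF S F gS]]
    have "((\<lambda>t. F (g t, h t)) has_derivative
       (\<lambda>t. c1 F (g z, h z) * (g' * t) + c2 F (g z, h z) * (h' * t))) (at z)"
      by (simp add: o_def)
    also have "(\<lambda>t. c1 F (g z, h z) * (g' * t) + c2 F (g z, h z) * (h' * t)) =
       (*) (c1 F (g z, h z) * g' + c2 F (g z, h z) * h')"
      by (auto simp: algebra_simps)
    finally show ?thesis by (auto simp: field_differentiable_def has_field_derivative_def)
  qed
  fix z w assume p: "(z, w) \<in> T"
  show "(\<lambda>t. F (G (t, w), H (t, w))) field_differentiable at z"
    by (rule *) (use p sub hol2_fd1[OF G(1)] hol2_fd1[OF G(2)] in auto)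
  show "(\<lambda>t. F (G (z, t), H (z, t))) field_differentiable at w"
    by (rule *) (use p sub hol2_fd2[OF G(1)] hol2_fd2[OF G(2)] in auto)
qed

lemma c1_eq: "((\<lambda>t. F (t, snd p)) has_field_derivative d) (at (fst p)) \<Longrightarrow> c1 F p = d"
  by (simp add: c1_def DERIV_imp_deriv)

text \<open>Radial averages give both primitives, via \<open>fst p * avg1 F p\<close>, and division by the first
  coordinate, via \<open>F p - F (0, snd p) = fst p * avg1 (c1 F) p\<close>.\<close>

definition avg1 :: "(complex \<times> complex \<Rightarrow> complex) \<Rightarrow> complex \<times> complex \<Rightarrow> complex" where
  "avg1 F p = integral (cbox 0 1) (\<lambda>t::real. F (of_real t * fst p, snd p))"

lemma bidisc_0_iff: "p \<in> bidisc 0 r \<longleftrightarrow> cmod (fst p) < r \<and> cmod (snd p) < r"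
  by (cases p) (simp add: bidisc_def)

lemma bidisc_scale:
  assumes "p \<in> bidisc 0 r" "t \<in> cbox 0 (1::real)"
  shows "(of_real t * fst p, snd p) \<in> bidisc 0 r"
proof -
  have "cmod (of_real t * fst p) \<le> 1 * cmod (fst p)"
    unfolding norm_mult by (rule mult_right_mono) (use assms in auto)
  then show ?thesis using assms by (simp add: bidisc_0_iff)
qed

lemma avg1_integrand_cont:
  assumes "continuous_on (bidisc 0 r) F"
  shows "continuous_on (bidisc 0 r \<times> cbox 0 (1::real)) (\<lambda>(p, t). F (of_real t * fst p, snd p))"
  unfolding case_prod_unfold
  by (rule continuous_on_compose2[OF assms]) (auto intro!: continuous_intros bidisc_scale[simplified])

lemma hol2_avg1:
  assumes F: "hol2 F (bidisc 0 r)"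
  shows "hol2 (avg1 F) (bidisc 0 r)"
proof (rule hol2I[OF _ open_bidisc])
  show "continuous_on (bidisc 0 r) (avg1 F)"
    unfolding avg1_def
    by (rule integral_continuous_on_param) (rule avg1_integrand_cont[OF hol2_cont[OF F]])
  have intg: "(\<lambda>t::real. F (of_real t * fst p, snd p)) integrable_on cbox 0 1" if "p \<in> bidisc 0 r" for p
  proof (rule integrable_continuous)
    show "continuous_on (cbox 0 1) (\<lambda>t::real. F (of_real t * fst p, snd p))"
      by (rule continuous_on_compose2[OF hol2_cont[OF F]])
         (use that in \<open>auto intro!: continuous_intros bidisc_scale[simplified]\<close>)
  qed
  fix z w assume p: "(z, w) \<in> bidisc 0 r"
  have zw: "cmod z < r" "cmod w < r" using p by (auto simp: bidisc_0_iff)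
  have "(\<lambda>z. integral (cbox 0 1) (\<lambda>t::real. F (of_real t * z, w))) holomorphic_on ball 0 r"
  proof (rule leibniz_rule_holomorphic[where fx = "\<lambda>z t. c1 F (of_real t * z, w) * of_real t"])
    fix x t assume x: "x \<in> ball (0::complex) r" and t: "t \<in> cbox 0 (1::real)"
    have "(of_real t * x, w) \<in> bidisc 0 r"
      using bidisc_scale[of "(x, w)" r t] x t zw by (simp add: bidisc_0_iff)
    from hol2_DERIV1[OF F this]
    have "((\<lambda>x. F (of_real t * x, w)) has_field_derivative c1 F (of_real t * x, w) * of_real t) (at x)"
      by (rule DERIV_chain2) (auto intro!: derivative_eq_intros)
    then show "((\<lambda>x. F (of_real t * x, w)) has_field_derivative c1 F (of_real t * x, w) * of_real t) (at x within ball 0 r)"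
      by (rule has_field_derivative_at_within)
  next
    fix x assume "x \<in> ball (0::complex) r"
    then show "(\<lambda>t::real. F (of_real t * x, w)) integrable_on cbox 0 1"
      using intg[of "(x, w)"] zw by (simp add: bidisc_0_iff)
  next
    have c: "continuous_on (bidisc 0 r) (c1 F)"
      by (intro hol2_cont hol2_c1 F open_bidisc)
    show "continuous_on (ball 0 r \<times> cbox 0 1) (\<lambda>(x, t::real). c1 F (of_real t * x, w) * of_real t)"
      unfolding case_prod_unfold
      by (intro continuous_intros continuous_on_compose2[OF c])
         (use zw in \<open>auto intro!: bidisc_scale[of "(a, w)" for a, simplified] simp: bidisc_0_iff\<close>)
  qed simp
  then show "(\<lambda>z. avg1 F (z, w)) field_differentiable at z"
    using zw holomorphic_on_imp_differentiable_at[of _ "ball 0 r"] by (simp add: avg1_def)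
  have "(\<lambda>w. integral (cbox 0 1) (\<lambda>t::real. F (of_real t * z, w))) holomorphic_on ball 0 r"
  proof (rule leibniz_rule_holomorphic[where fx = "\<lambda>w t. c2 F (of_real t * z, w)"])
    fix x t assume x: "x \<in> ball (0::complex) r" and t: "t \<in> cbox 0 (1::real)"
    have "(of_real t * z, x) \<in> bidisc 0 r"
      using bidisc_scale[of "(z, x)" r t] x t zw by (simp add: bidisc_0_iff)
    from hol2_DERIV2[OF F this]
    show "((\<lambda>x. F (of_real t * z, x)) has_field_derivative c2 F (of_real t * z, x)) (at x within ball 0 r)"
      by (rule has_field_derivative_at_within)
  next
    fix x assume "x \<in> ball (0::complex) r"
    then show "(\<lambda>t::real. F (of_real t * z, x)) integrable_on cbox 0 1"
      using intg[of "(z, x)"] zw by (simp add: bidisc_0_iff)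
  next
    have c: "continuous_on (bidisc 0 r) (c2 F)"
      by (intro hol2_cont hol2_c2 F open_bidisc)
    show "continuous_on (ball 0 r \<times> cbox 0 1) (\<lambda>(x, t::real). c2 F (of_real t * z, x))"
      unfolding case_prod_unfold
      by (intro continuous_intros continuous_on_compose2[OF c])
         (use zw in \<open>auto intro!: bidisc_scale[of "(z, a)" for a, simplified] simp: bidisc_0_iff\<close>)
  qed simp
  then show "(\<lambda>w. avg1 F (z, w)) field_differentiable at w"
    using zw holomorphic_on_imp_differentiable_at[of _ "ball 0 r"] by (simp add: avg1_def)
qed

lemma ftc_radial:
  assumes K: "\<And>u. cmod u < r \<Longrightarrow> (K has_field_derivative k u) (at u)" and z: "cmod z < r"
  shows "K z - K 0 = z * integral (cbox 0 1) (\<lambda>t::real. k (of_real t * z))"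
proof -
  have "((\<lambda>t::real. k (of_real t * z) * z) has_integral (K (of_real 1 * z) - K (of_real 0 * z))) {0..1}"
  proof (rule fundamental_theorem_of_calculus)
    fix t :: real assume t: "t \<in> {0..1}"
    have "cmod (of_real t * z) \<le> 1 * cmod z"
      unfolding norm_mult by (rule mult_right_mono) (use t in auto)
    then have d: "(K has_field_derivative k (of_real t * z)) (at (of_real t * z))"
      using z by (intro K) simp
    have "((\<lambda>u. K (u * z)) has_field_derivative k (of_real t * z) * z) (at (of_real t))"
    proof -
      have "((\<lambda>u. u * z) has_field_derivative z) (at (of_real t))"
        by (auto intro!: derivative_eq_intros)
      from DERIV_chain2[where f = K and g = "\<lambda>u. u * z" and x = "of_real t" and s = UNIV, OF d this]
      show ?thesis .
    qed
    then show "((\<lambda>t. K (of_real t * z)) has_vector_derivative k (of_real t * z) * z) (at t within {0..1})"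
      using has_vector_derivative_real_field has_vector_derivative_at_within by blast
  qed simp
  then have "((\<lambda>t::real. k (of_real t * z) * z) has_integral (K z - K 0)) (cbox 0 1)" by simp
  then have "integral (cbox 0 1) (\<lambda>t::real. k (of_real t * z) * z) = K z - K 0"
    by (rule integral_unique)
  then show ?thesis by (simp add: mult.commute)
qed

lemma hadamard1:
  assumes F: "hol2 F (bidisc 0 r)" and p: "p \<in> bidisc 0 r"
  shows "F p = F (0, snd p) + fst p * avg1 (c1 F) p"
proof -
  have "F (fst p, snd p) - F (0, snd p) = fst p * integral (cbox 0 1) (\<lambda>t::real. c1 F (of_real t * fst p, snd p))"
    by (rule ftc_radial[where K = "\<lambda>u. F (u, snd p)" and r = r])
       (use p in \<open>auto intro!: hol2_DERIV1[OF F] simp: bidisc_0_iff\<close>)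
  then show ?thesis by (simp add: avg1_def algebra_simps)
qed

definition prim1 :: "(complex \<times> complex \<Rightarrow> complex) \<Rightarrow> complex \<times> complex \<Rightarrow> complex" where
  "prim1 F p = fst p * avg1 F p"

lemma hol2_prim1: "hol2 F (bidisc 0 r) \<Longrightarrow> hol2 (prim1 F) (bidisc 0 r)"
  unfolding prim1_def by (intro hol2_mult hol2_fst hol2_avg1)

lemma prim1_0 [simp]: "prim1 F (0, w) = 0"
  by (simp add: prim1_def)

text \<open>Each slice is a disc, hence convex, and has a primitive K there. By
  \<open>ftc_radial\<close> the radial integral is K minus its value at 0.\<close>

lemma c1_prim1:
  assumes F: "hol2 F (bidisc 0 r)" and p: "p \<in> bidisc 0 r"
  shows "c1 (prim1 F) p = F p"
proof -
  have w: "cmod (snd p) < r" "cmod (fst p) < r" using p by (auto simp: bidisc_0_iff)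
  have "(\<lambda>z. F (z, snd p)) holomorphic_on ball 0 r"
    by (rule hol2_holo1[OF F]) (use w in \<open>simp add: bidisc_0_iff\<close>)
  then obtain K where K0: "\<And>x. x \<in> ball 0 r \<Longrightarrow> (K has_field_derivative F (x, snd p)) (at x within ball 0 r)"
    using holomorphic_convex_primitive'[of "ball 0 r" "\<lambda>z. F (z, snd p)"] by auto
  have K: "(K has_field_derivative F (x, snd p)) (at x)" if "cmod x < r" for x
    using K0[of x] that by (simp add: at_within_open[of x "ball 0 r"])
  have eq: "prim1 F (z, snd p) = K z - K 0" if "cmod z < r" for z
    using ftc_radial[OF K that] by (simp add: prim1_def avg1_def)
  have "((\<lambda>z. prim1 F (z, snd p)) has_field_derivative F (fst p, snd p)) (at (fst p))"
  proof (rule has_field_derivative_transform_within_open[of "\<lambda>z. K z - K 0" _ _ "ball 0 r"])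
    show "((\<lambda>z. K z - K 0) has_field_derivative F (fst p, snd p)) (at (fst p))"
      using K[OF w(2)] by (auto intro!: derivative_eq_intros)
  qed (use w eq in auto)
  then show ?thesis using c1_eq by fastforce
qed

lemma avg1_bound:
  assumes F: "continuous_on (bidisc 0 r) F" and p: "p \<in> bidisc 0 r"
    and B: "\<And>q. q \<in> bidisc 0 r \<Longrightarrow> cmod (F q) \<le> B"
  shows "cmod (avg1 F p) \<le> B"
proof -
  have i: "(\<lambda>t::real. F (of_real t * fst p, snd p)) integrable_on cbox 0 1"
  proof (rule integrable_continuous)
    show "continuous_on (cbox 0 1) (\<lambda>t::real. F (of_real t * fst p, snd p))"
      by (rule continuous_on_compose2[OF F])
         (use p in \<open>auto intro!: continuous_intros bidisc_scale[simplified]\<close>)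
  qed
  have "cmod (avg1 F p) \<le> B * measure lborel (cbox 0 (1::real))"
    unfolding avg1_def
    by (rule integrable_bound) (use i B[OF bidisc_scale[OF p]] order_trans[OF norm_ge_zero B[OF p]] in auto)
  then show ?thesis by simp
qed

text \<open>Keeps track of the reality of extensions: with this property, F is an extension of the
  real function \<open>Re (F (cx z))\<close>, so constructions made on the complex side can be
  brought back.\<close>

definition real_at_reals :: "(complex \<times> complex \<Rightarrow> complex) \<Rightarrow> (complex \<times> complex) set \<Rightarrow> bool" where
  "real_at_reals F S \<longleftrightarrow> (\<forall>x y. (of_real x, of_real y) \<in> S \<longrightarrow> F (of_real x, of_real y) \<in> \<real>)"

lemma integral_in_Reals:
  fixes f :: "'a::euclidean_space \<Rightarrow> complex"
  assumes "f integrable_on S" "\<And>t. t \<in> S \<Longrightarrow> f t \<in> \<real>"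
  shows "integral S f \<in> \<real>"
proof -
  have "Im (integral S f) = integral S (\<lambda>t. Im (f t))"
    using integral_linear[OF assms(1) bounded_linear_Im] by (simp add: o_def)
  also have "\<dots> = integral S (\<lambda>t. 0)"
    by (rule integral_cong) (use assms(2) complex_is_Real_iff in auto)
  finally show ?thesis by (simp add: complex_is_Real_iff)
qed

lemma real_at_reals_avg1:
  assumes F: "hol2 F (bidisc 0 r)" and "real_at_reals F (bidisc 0 r)"
  shows "real_at_reals (avg1 F) (bidisc 0 r)"
  unfolding real_at_reals_def avg1_def
proof (intro allI impI integral_in_Reals)
  fix x y assume p: "(complex_of_real x, complex_of_real y) \<in> bidisc 0 r"
  show "(\<lambda>t::real. F (of_real t * fst (complex_of_real x, complex_of_real y), snd (complex_of_real x, complex_of_real y))) integrable_on cbox 0 1"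
  proof (rule integrable_continuous)
    show "continuous_on (cbox 0 1) (\<lambda>t::real. F (of_real t * fst (complex_of_real x, complex_of_real y), snd (complex_of_real x, complex_of_real y)))"
      by (rule continuous_on_compose2[OF hol2_cont[OF F]])
         (use bidisc_scale[OF p] in \<open>auto intro!: continuous_intros\<close>)
  qed
  show "F (of_real t * fst (complex_of_real x, complex_of_real y), snd (complex_of_real x, complex_of_real y)) \<in> \<real>"
    if "t \<in> cbox 0 1" for t :: real
    using assms(2) bidisc_scale[OF p that] unfolding real_at_reals_def
    by (metis fst_conv snd_conv of_real_mult)
qed

lemma real_at_reals_prim1:
  "hol2 F (bidisc 0 r) \<Longrightarrow> real_at_reals F (bidisc 0 r) \<Longrightarrow> real_at_reals (prim1 F) (bidisc 0 r)"
  using real_at_reals_avg1[of F r] by (auto simp: real_at_reals_def prim1_def)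

section \<open>Double power series\<close>

lemma iterate_c1: "(c1 ^^ n) F (z, w) = (deriv ^^ n) (\<lambda>t. F (t, w)) z"
  by (induction n arbitrary: z w) (simp_all add: c1_def)

lemma hol2_c1_iterate: "open S \<Longrightarrow> hol2 F S \<Longrightarrow> hol2 ((c1 ^^ n) F) S"
  by (induction n) (auto intro: hol2_c1)

text \<open>Expanding in the first variable gives coefficients \<open>A i\<close> that are iterated
  partial derivatives on the slice through the centre, hence holomorphic in the second variable;
  these are expanded in turn. Two uses of Cauchy's inequality bound \<open>C i j\<close> by B /
  \<rho>^(i+j), so a geometric double series dominates and the two summations combine into one
  unordered sum.\<close>

lemma hol2_power_series:
  assumes F: "hol2 F (bidisc p r)" and "r > 0"
  obtains C :: "nat \<Rightarrow> nat \<Rightarrow> complex" where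
    "\<And>z w. (z, w) \<in> bidisc p (r/2) \<Longrightarrow>
      ((\<lambda>(i, j). (z - fst p) ^ i * (w - snd p) ^ j * C i j) has_sum F (z, w)) UNIV"
proof -
  obtain a b where ab: "p = (a, b)" by (cases p)
  define \<rho> where "\<rho> = r / 2"
  have \<rho>: "\<rho> > 0" "\<rho> < r" using \<open>r > 0\<close> by (auto simp: \<rho>_def)
  have sub: "cbidisc p \<rho> \<subseteq> bidisc p r" using \<rho> by (auto simp: bidisc_def cbidisc_def)
  obtain B where B: "B > 0" "\<And>q. q \<in> cbidisc p \<rho> \<Longrightarrow> cmod (F q) \<le> B"
    using hol2_bounded[OF F sub] by blast
  define A where "A = (\<lambda>i w. (deriv ^^ i) (\<lambda>t. F (t, w)) a)"
  define C where "C = (\<lambda>i j. (deriv ^^ j) (A i) b / (fact i * fact j))"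
  have hA: "A i holomorphic_on ball b r" for i
  proof -
    have "(\<lambda>w. (c1 ^^ i) F (a, w)) holomorphic_on ball b r"
      by (rule hol2_holo2[OF hol2_c1_iterate[OF open_bidisc F]])
         (use \<open>r > 0\<close> in \<open>auto simp: bidisc_def ab\<close>)
    then show ?thesis by (simp add: iterate_c1 A_def)
  qed
  have hF: "(\<lambda>t. F (t, w)) holomorphic_on ball a r" if "w \<in> ball b r" for w
    by (rule hol2_holo1[OF F]) (use that in \<open>auto simp: bidisc_def ab\<close>)
  have bA: "cmod (A i w) \<le> fact i * B / \<rho> ^ i" if "w \<in> cball b \<rho>" for i w
    unfolding A_def
  proof (rule Cauchy_inequality)
    have h: "(\<lambda>t. F (t, w)) holomorphic_on ball a r" using that \<rho> by (intro hF) auto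
    have s: "cball a \<rho> \<subseteq> ball a r" "ball a \<rho> \<subseteq> ball a r" using \<rho> by auto
    show "(\<lambda>t. F (t, w)) holomorphic_on ball a \<rho>" using h s(2) by (rule holomorphic_on_subset)
    show "continuous_on (cball a \<rho>) (\<lambda>t. F (t, w))"
      using holomorphic_on_subset[OF h s(1)] by (rule holomorphic_on_imp_continuous_on)
    show "cmod (F (x, w)) \<le> B" if "cmod (a - x) = \<rho>" for x
      using that \<open>w \<in> cball b \<rho>\<close> by (intro B) (auto simp: cbidisc_def ab dist_norm)
  qed (rule \<rho>)
  have bC: "cmod (C i j) \<le> B / \<rho> ^ i / \<rho> ^ j" for i j
  proof -
    have s: "cball b \<rho> \<subseteq> ball b r" "ball b \<rho> \<subseteq> ball b r" using \<rho> by auto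
    have "cmod ((deriv ^^ j) (A i) b) \<le> fact j * (fact i * B / \<rho> ^ i) / \<rho> ^ j"
    proof (rule Cauchy_inequality)
      show "A i holomorphic_on ball b \<rho>" using hA s(2) by (rule holomorphic_on_subset)
      show "continuous_on (cball b \<rho>) (A i)"
        using holomorphic_on_subset[OF hA s(1)] by (rule holomorphic_on_imp_continuous_on)
      show "cmod (A i x) \<le> fact i * B / \<rho> ^ i" if "cmod (b - x) = \<rho>" for x
        using that by (intro bA) (auto simp: dist_norm)
    qed (rule \<rho>)
    then have "cmod (C i j) \<le> fact j * (fact i * B / \<rho> ^ i) / \<rho> ^ j / (fact i * fact j)"
      unfolding C_def norm_divide norm_mult norm_fact by (rule divide_right_mono) simp
    also have "\<dots> = B / \<rho> ^ i / \<rho> ^ j" by simp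
    finally show ?thesis .
  qed
  have "((\<lambda>(i, j). (z - a) ^ i * (w - b) ^ j * C i j) has_sum F (z, w)) UNIV"
    if zw: "(z, w) \<in> bidisc p \<rho>" for z w
  proof -
    have z: "cmod (z - a) < \<rho>" and w: "cmod (w - b) < \<rho>"
      using zw by (auto simp: bidisc_def ab dist_norm norm_minus_commute)
    define s where "s = cmod (z - a) / \<rho>"
    define t where "t = cmod (w - b) / \<rho>"
    have st: "0 \<le> s" "s < 1" "0 \<le> t" "t < 1" using z w \<rho> by (auto simp: s_def t_def)
    let ?f = "\<lambda>(i, j). (z - a) ^ i * (w - b) ^ j * C i j"
    have bf: "cmod (?f (i, j)) \<le> B * s ^ i * t ^ j" for i j
    proof -
      have "cmod (?f (i, j)) \<le> cmod (z - a) ^ i * cmod (w - b) ^ j * (B / \<rho> ^ i / \<rho> ^ j)"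
        unfolding prod.case norm_mult norm_power by (intro mult_left_mono bC) auto
      also have "\<dots> = B * s ^ i * t ^ j" by (simp add: s_def t_def power_divide)
      finally show ?thesis .
    qed
    have gs: "((\<lambda>j. B * s ^ i * t ^ j) has_sum (B * s ^ i * (1 / (1 - t)))) UNIV" for i
      using st B by (intro has_sum_cmult_right norm_summable_imp_has_sum geometric_sums)
         (auto intro!: summable_geometric)
    have "((\<lambda>i. s ^ i) has_sum (1 / (1 - s))) UNIV"
      using st by (intro norm_summable_imp_has_sum geometric_sums) (auto intro!: summable_geometric)
    then have "((\<lambda>i. B * s ^ i * (1 / (1 - t))) has_sum (B * (1 / (1 - s)) * (1 / (1 - t)))) UNIV"
      by (intro has_sum_cmult_right has_sum_cmult_left)
    then have "(\<lambda>i. B * s ^ i * (1 / (1 - t))) summable_on UNIV"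
      by (rule has_sum_imp_summable)
    then have "(\<lambda>(i, j). B * s ^ i * t ^ j) summable_on (SIGMA i:UNIV. UNIV)"
      by (intro summable_on_SigmaI) (use gs st B in auto)
    then have "(\<lambda>(i, j). B * s ^ i * t ^ j) summable_on UNIV" by simp
    from Infinite_Sum.abs_summable_on_comparison_test'[OF this, of ?f]
    have "(\<lambda>x. cmod (?f x)) summable_on UNIV" using bf by auto
    then have sm: "?f summable_on (SIGMA i:UNIV. UNIV)"
      using abs_summable_summable by force
    have in1: "((\<lambda>j. ?f (i, j)) has_sum ((z - a) ^ i * (A i w / fact i))) UNIV" for i
    proof -
      have "((\<lambda>n. (deriv ^^ n) (A i) b / fact n * (w - b) ^ n) sums A i w)"
        by (rule holomorphic_power_series[OF hA]) (use w \<rho> in \<open>auto simp: dist_norm norm_minus_commute\<close>)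
      then have "((\<lambda>n. (z - a) ^ i * ((deriv ^^ n) (A i) b / fact n * (w - b) ^ n / fact i)) sums
          ((z - a) ^ i * (A i w / fact i)))"
        by (intro sums_mult sums_divide)
      also have "(\<lambda>n. (z - a) ^ i * ((deriv ^^ n) (A i) b / fact n * (w - b) ^ n / fact i)) = (\<lambda>j. ?f (i, j))"
        by (simp add: C_def fun_eq_iff mult_ac)
      finally have su: "(\<lambda>j. ?f (i, j)) sums ((z - a) ^ i * (A i w / fact i))" .
      have "summable (\<lambda>j. B * s ^ i * t ^ j)" using st by (intro summable_mult summable_geometric) auto
      then have "summable (\<lambda>j. cmod (?f (i, j)))"
        by (rule summable_comparison_test'[where N = 0]) (use bf in auto)
      then show ?thesis using su by (rule norm_summable_imp_has_sum)
    qed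
    have out1: "((\<lambda>i. (z - a) ^ i * (A i w / fact i)) has_sum F (z, w)) UNIV"
    proof (rule norm_summable_imp_has_sum)
      have wb: "w \<in> cball b \<rho>" "w \<in> ball b r" using w \<rho> by (auto simp: dist_norm norm_minus_commute)
      have bnd: "cmod ((z - a) ^ i * (A i w / fact i)) \<le> B * s ^ i" for i
      proof -
        have "cmod ((z - a) ^ i * (A i w / fact i)) = cmod (z - a) ^ i * (cmod (A i w) / fact i)"
          by (simp add: norm_mult norm_power norm_divide)
        also have "\<dots> \<le> cmod (z - a) ^ i * ((fact i * B / \<rho> ^ i) / fact i)"
          by (intro mult_left_mono divide_right_mono bA wb) auto
        also have "\<dots> = B * s ^ i" by (simp add: s_def power_divide)
        finally show ?thesis .
      qed
      have "summable (\<lambda>i. B * s ^ i)" using st by (intro summable_mult summable_geometric) auto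
      then show "summable (\<lambda>i. cmod ((z - a) ^ i * (A i w / fact i)))"
        by (rule summable_comparison_test'[where N = 0]) (use bnd in auto)
      have "((\<lambda>n. (deriv ^^ n) (\<lambda>t. F (t, w)) a / fact n * (z - a) ^ n) sums F (z, w))"
        by (rule holomorphic_power_series[OF hF[OF wb(2)]]) (use z \<rho> in \<open>auto simp: dist_norm norm_minus_commute\<close>)
      then show "(\<lambda>i. (z - a) ^ i * (A i w / fact i)) sums F (z, w)"
        by (simp add: A_def mult_ac)
    qed
    have "(?f has_sum F (z, w)) (SIGMA i:UNIV. UNIV)"
      by (rule has_sum_SigmaI[OF in1 out1 sm])
    then show ?thesis by simp
  qed
  then show ?thesis by (intro that[of C]) (simp add: ab \<rho>_def)
qed

text \<open>Absolute summability at offset (t, t) dominates the terms on the whole bidisc, so the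
  M-test along finite index sets exhibits the sum as a uniform limit of polynomials.\<close>

lemma hol2_of_power_series:
  fixes C :: "nat \<Rightarrow> nat \<Rightarrow> complex"
  assumes sm: "(\<lambda>(i, j). t ^ i * t ^ j * cmod (C i j)) summable_on UNIV"
  shows "hol2 (\<lambda>q. \<Sum>\<^sub>\<infinity>(i, j). (fst q - fst p) ^ i * (snd q - snd p) ^ j * C i j) (bidisc p t)"
    and "q \<in> bidisc p t \<Longrightarrow>
      (\<lambda>(i, j). (fst q - fst p) ^ i * (snd q - snd p) ^ j * C i j) summable_on UNIV"
proof -
  let ?f = "\<lambda>x q. case x of (i, j) \<Rightarrow> (fst q - fst p) ^ i * (snd q - snd p) ^ j * C i j"
  let ?M = "\<lambda>x. case x of (i, j) \<Rightarrow> t ^ i * t ^ j * cmod (C i j)"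
  have b: "cmod (?f x q) \<le> ?M x" if "q \<in> bidisc p t" for q x
  proof -
    obtain i j where x: "x = (i, j)" by (cases x)
    have "cmod (fst q - fst p) < t" "cmod (snd q - snd p) < t"
      using that by (auto simp: bidisc_def dist_norm norm_minus_commute)
    moreover from this(1) have "0 \<le> t" using norm_ge_zero[of "fst q - fst p"] by linarith
    ultimately show ?thesis unfolding x prod.case norm_mult norm_power
      by (intro mult_right_mono mult_mono power_mono) auto
  qed
  have "uniform_limit (bidisc p t) (\<lambda>X q. \<Sum>x\<in>X. ?f x q) (\<lambda>q. \<Sum>\<^sub>\<infinity>x. ?f x q) (finite_subsets_at_top UNIV)"
    by (rule Weierstrass_m_test_general[where M = ?M]) (use b sm in auto)
  then show "hol2 (\<lambda>q. \<Sum>\<^sub>\<infinity>(i, j). (fst q - fst p) ^ i * (snd q - snd p) ^ j * C i j) (bidisc p t)"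
  proof (rule hol2_uniform_limit[OF open_bidisc, rotated])
    show "hol2 (\<lambda>q. \<Sum>x\<in>X. ?f x q) (bidisc p t)" for X
      by (rule hol2_sum) (auto intro!: hol2_mult hol2_power hol2_diff)
  qed simp
  assume q: "q \<in> bidisc p t"
  show "(\<lambda>(i, j). (fst q - fst p) ^ i * (snd q - snd p) ^ j * C i j) summable_on UNIV"
    by (rule abs_summable_summable, rule Infinite_Sum.abs_summable_on_comparison_test'[OF sm b[OF q]])
qed

lemma avg1_diff:
  assumes "continuous_on (bidisc 0 r) F" "continuous_on (bidisc 0 r) G" and p: "p \<in> bidisc 0 r"
  shows "avg1 (\<lambda>q. F q - G q) p = avg1 F p - avg1 G p"
  unfolding avg1_def
proof (rule integral_diff)
  have "continuous_on (cbox 0 1) (\<lambda>t::real. F (of_real t * fst p, snd p))"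
       "continuous_on (cbox 0 1) (\<lambda>t::real. G (of_real t * fst p, snd p))"
    by (rule continuous_on_compose2[OF assms(1)] continuous_on_compose2[OF assms(2)];
        use p in \<open>auto intro!: continuous_intros bidisc_scale[simplified]\<close>)+
  then show "(\<lambda>t::real. F (of_real t * fst p, snd p)) integrable_on cbox 0 1"
       "(\<lambda>t::real. G (of_real t * fst p, snd p)) integrable_on cbox 0 1"
    using integrable_continuous by blast+
qed

text \<open>Picard iteration; the iterates are holomorphic, hence so is their uniform limit.\<close>

lemma hol2_cauchy_problem:
  assumes f: "hol2 f (bidisc 0 R)" and "R > 0"
  obtains \<phi> \<rho> where "\<rho> > 0" "\<rho> \<le> R" "hol2 \<phi> (bidisc 0 \<rho>)"
    "\<And>p. p \<in> bidisc 0 \<rho> \<Longrightarrow> cmod (\<phi> p) < R"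
    "\<And>p. p \<in> bidisc 0 \<rho> \<Longrightarrow> c1 \<phi> p = f (fst p, \<phi> p)"
    "\<And>w. \<phi> (0, w) = w"
    "real_at_reals f (bidisc 0 R) \<Longrightarrow> real_at_reals \<phi> (bidisc 0 \<rho>)"
proof -
  define R' where "R' = R / 2"
  have R': "0 < R'" "R' < R" using \<open>R > 0\<close> by (auto simp: R'_def)
  have subR: "cbidisc 0 R' \<subseteq> bidisc 0 R" using R' by (auto simp: bidisc_def cbidisc_def)
  obtain B1 where B1: "B1 > 0" "\<And>q. q \<in> cbidisc 0 R' \<Longrightarrow> cmod (f q) \<le> B1"
    using hol2_bounded[OF f subR] by blast
  obtain B2 where B2: "B2 > 0" "\<And>q. q \<in> cbidisc 0 R' \<Longrightarrow> cmod (c2 f q) \<le> B2"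
    using hol2_bounded[OF hol2_c2[OF open_bidisc f] subR] by blast
  \<comment> \<open>The second bound keeps the iterates within R'/2 of \<open>snd p\<close>, which
    the first keeps below R'/2; so f is only evaluated in the bidisc of radius R'. The third bound
    makes P a contraction with factor 1/2.\<close>
  define \<rho> where "\<rho> = Min {R' / 2, R' / 2 / B1, 1 / (2 * B2)}"
  have \<rho>: "\<rho> > 0" "\<rho> \<le> R' / 2" "\<rho> \<le> R' / 2 / B1" "\<rho> \<le> 1 / (2 * B2)"
    using R' B1 B2 by (auto simp: \<rho>_def)
  then have \<rho>B: "\<rho> * B1 \<le> R' / 2" "\<rho> * B2 \<le> 1 / 2"
    using B1 B2 by (simp_all add: field_simps)
  let ?D = "bidisc 0 \<rho>"
  define P where "P = (\<lambda>\<phi> p. snd p + prim1 (\<lambda>q. f (fst q, \<phi> q)) p)"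
  define good where "good = (\<lambda>\<phi>. hol2 \<phi> ?D \<and> (\<forall>p\<in>?D. cmod (\<phi> p - snd p) \<le> R' / 2))"
  have in_R': "(fst p, \<phi> p) \<in> bidisc 0 R'" if "good \<phi>" "p \<in> ?D" for \<phi> p
  proof -
    have "cmod (\<phi> p) \<le> cmod (\<phi> p - snd p) + cmod (snd p)"
      using norm_triangle_ineq[of "\<phi> p - snd p" "snd p"] by simp
    moreover have "cmod (\<phi> p - snd p) \<le> R' / 2" using that by (auto simp: good_def)
    ultimately show ?thesis using that \<rho> by (auto simp: bidisc_0_iff)
  qed
  have hf: "hol2 (\<lambda>q. f (fst q, \<phi> q)) ?D" if "good \<phi>" for \<phi>
  proof (rule hol2_compose[OF open_bidisc f open_bidisc hol2_fst])
    show "hol2 \<phi> ?D" using that by (simp add: good_def)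
    show "(fst p, \<phi> p) \<in> bidisc 0 R" if "p \<in> ?D" for p
      using in_R'[OF \<open>good \<phi>\<close> that] bidisc_mono[of R' R 0] R' by auto
  qed
  have bf: "cmod (f (fst q, \<phi> q)) \<le> B1" if "good \<phi>" "q \<in> ?D" for \<phi> q
    using in_R'[OF that] bidisc_cbidisc by (intro B1) blast
  have goodP: "good (P \<phi>)" if g: "good \<phi>" for \<phi>
    unfolding good_def
  proof (intro conjI ballI)
    show "hol2 (P \<phi>) ?D"
      unfolding P_def by (intro hol2_add hol2_snd hol2_prim1 hf g)
    fix p assume p: "p \<in> ?D"
    have "cmod (P \<phi> p - snd p) = cmod (fst p) * cmod (avg1 (\<lambda>q. f (fst q, \<phi> q)) p)"
      by (simp add: P_def prim1_def norm_mult)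
    also have "\<dots> \<le> \<rho> * B1"
      by (intro mult_mono avg1_bound[OF hol2_cont[OF hf[OF g]] p] bf g)
         (use p \<rho> in \<open>auto simp: bidisc_0_iff\<close>)
    finally show "cmod (P \<phi> p - snd p) \<le> R' / 2" using \<rho>B by simp
  qed
  have lip: "cmod (f (x, y) - f (x, y')) \<le> B2 * cmod (y - y')"
    if "(x, y) \<in> bidisc 0 R'" "(x, y') \<in> bidisc 0 R'" for x y y'
  proof (rule field_differentiable_bound[of "cball 0 R'" "\<lambda>t. f (x, t)" "\<lambda>t. c2 f (x, t)"])
    fix t assume t: "t \<in> cball (0::complex) R'"
    have xt: "(x, t) \<in> cbidisc 0 R'" using that t by (auto simp: bidisc_def cbidisc_def)
    show "cmod (c2 f (x, t)) \<le> B2" by (rule B2(2)[OF xt])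
    have "((\<lambda>t. f (x, t)) has_field_derivative c2 f (x, t)) (at t)"
      by (rule hol2_DERIV2[OF f]) (use xt subR in blast)
    then show "((\<lambda>t. f (x, t)) has_field_derivative c2 f (x, t)) (at t within cball 0 R')"
      by (rule has_field_derivative_at_within)
  qed (use that in \<open>auto simp: bidisc_0_iff\<close>)
  have contr: "cmod (P \<phi> p - P \<psi> p) \<le> e / 2"
    if g: "good \<phi>" "good \<psi>" and e: "\<And>q. q \<in> ?D \<Longrightarrow> cmod (\<phi> q - \<psi> q) \<le> e" and p: "p \<in> ?D" for \<phi> \<psi> e p
  proof -
    have e0: "0 \<le> e" using e[OF p] norm_ge_zero order_trans by blast
    have c: "continuous_on ?D (\<lambda>q. f (fst q, \<phi> q))" "continuous_on ?D (\<lambda>q. f (fst q, \<psi> q))"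
      using hol2_cont[OF hf] g by auto
    have "P \<phi> p - P \<psi> p = fst p * avg1 (\<lambda>q. f (fst q, \<phi> q) - f (fst q, \<psi> q)) p"
      by (simp add: P_def prim1_def avg1_diff[OF c p] algebra_simps)
    then have "cmod (P \<phi> p - P \<psi> p) = cmod (fst p) * cmod (avg1 (\<lambda>q. f (fst q, \<phi> q) - f (fst q, \<psi> q)) p)"
      by (simp add: norm_mult)
    also have "\<dots> \<le> \<rho> * (B2 * e)"
    proof (intro mult_mono avg1_bound[OF continuous_on_diff[OF c] p])
      fix q assume q: "q \<in> ?D"
      have "cmod (f (fst q, \<phi> q) - f (fst q, \<psi> q)) \<le> B2 * cmod (\<phi> q - \<psi> q)"
        by (rule lip) (use in_R' g q in auto)
      also have "\<dots> \<le> B2 * e" using e[OF q] B2 by simp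
      finally show "cmod (f (fst q, \<phi> q) - f (fst q, \<psi> q)) \<le> B2 * e" .
    qed (use p \<rho> in \<open>auto simp: bidisc_0_iff\<close>)
    also have "\<dots> = (\<rho> * B2) * e" by simp
    also have "\<dots> \<le> (1 / 2) * e" using \<rho>B e0 by (intro mult_right_mono)
    finally show ?thesis by simp
  qed
  define it where "it = (\<lambda>n. (P ^^ n) snd)"
  have it_Suc: "it (Suc n) = P (it n)" for n by (simp add: it_def)
  have good_it: "good (it n)" for n
    by (induction n) (use R' goodP in \<open>auto simp: it_def good_def\<close>)
  have step: "cmod (it (Suc n) p - it n p) \<le> R' * (1 / 2) ^ n" if "p \<in> ?D" for n p
    using that
  proof (induction n arbitrary: p)
    case 0
    have "cmod (it (Suc 0) p - snd p) \<le> R' / 2" using good_it[of "Suc 0"] 0 unfolding good_def by blast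
    then show ?case using R' by (simp add: it_def)
  next
    case (Suc n)
    have "cmod (it (Suc (Suc n)) p - it (Suc n) p) \<le> (R' * (1 / 2) ^ n) / 2"
      unfolding it_Suc[of "Suc n"] by (subst it_Suc[of n], rule contr[OF good_it good_it])
         (use Suc it_Suc in auto)
    then show ?case by simp
  qed
  define \<phi> where "\<phi> = (\<lambda>p. snd p + (\<Sum>n. it (Suc n) p - it n p))"
  have ul0: "uniform_limit ?D (\<lambda>n p. \<Sum>i<n. it (Suc i) p - it i p) (\<lambda>p. \<Sum>n. it (Suc n) p - it n p) sequentially"
    by (rule Weierstrass_m_test[where M = "\<lambda>n. R' * (1/2) ^ n"]) (use step in \<open>auto intro!: summable_mult summable_geometric\<close>)
  have tele: "(\<Sum>i<n. it (Suc i) p - it i p) = it n p - snd p" for n p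
    by (subst sum_lessThan_telescope) (simp add: it_def)
  have ul: "uniform_limit ?D it \<phi> sequentially"
    unfolding uniform_limit_iff
  proof (intro allI impI)
    fix e :: real assume "e > 0"
    with ul0 have "\<forall>\<^sub>F n in sequentially. \<forall>p\<in>?D. dist (it n p - snd p) (\<Sum>n. it (Suc n) p - it n p) < e"
      unfolding uniform_limit_iff tele by blast
    then show "\<forall>\<^sub>F n in sequentially. \<forall>p\<in>?D. dist (it n p) (\<phi> p) < e"
      by (simp add: \<phi>_def dist_norm algebra_simps)
  qed
  have pw: "(\<lambda>n. it n p) \<longlonglongrightarrow> \<phi> p" if "p \<in> ?D" for p
    by (rule tendsto_uniform_limitI[OF ul that])
  have h\<phi>: "hol2 \<phi> ?D"
    by (rule hol2_uniform_limit[OF open_bidisc _ ul]) (use good_it in \<open>auto simp: good_def\<close>)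
  have good\<phi>: "good \<phi>"
    unfolding good_def
  proof (intro conjI ballI h\<phi>)
    fix p assume p: "p \<in> ?D"
    show "cmod (\<phi> p - snd p) \<le> R' / 2"
    proof (rule Lim_norm_ubound[of sequentially "\<lambda>n. it n p - snd p"])
      show "(\<lambda>n. it n p - snd p) \<longlonglongrightarrow> \<phi> p - snd p" by (intro tendsto_intros pw p)
    qed (use good_it p in \<open>auto simp: good_def\<close>)
  qed
  have fix\<phi>: "P \<phi> p = \<phi> p" if p: "p \<in> ?D" for p
  proof (rule LIMSEQ_unique)
    show "(\<lambda>n. it (Suc n) p) \<longlonglongrightarrow> \<phi> p" using pw[OF p] by (rule LIMSEQ_Suc)
    show "(\<lambda>n. it (Suc n) p) \<longlonglongrightarrow> P \<phi> p"
    proof (rule tendstoI)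
      fix e :: real assume "e > 0"
      with ul have "\<forall>\<^sub>F n in sequentially. \<forall>q\<in>?D. dist (it n q) (\<phi> q) < e"
        unfolding uniform_limit_iff by blast
      then show "\<forall>\<^sub>F n in sequentially. dist (it (Suc n) p) (P \<phi> p) < e"
      proof eventually_elim
        case (elim n)
        have "cmod (P (it n) p - P \<phi> p) \<le> e / 2"
          by (rule contr[OF good_it good\<phi> _ p]) (use elim in \<open>force simp: dist_norm\<close>)
        then show ?case using \<open>e > 0\<close> by (simp add: it_Suc dist_norm)
      qed
    qed
  qed
  show ?thesis
  \<comment> \<open>On the bidisc \<open>P \<phi>\<close> agrees with \<open>\<phi>\<close> by
    \<open>fix\<phi>\<close>; it is the more convenient witness because its value at (0, w) is w for
    every w by the form of P.\<close>
  proof (rule that[of \<rho> "P \<phi>"])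
    show "\<rho> \<le> R" using \<rho> R' by simp
    show hP: "hol2 (P \<phi>) ?D" using goodP[OF good\<phi>] by (simp add: good_def)
    fix p assume p: "p \<in> ?D"
    show "cmod (P \<phi> p) < R"
      using in_R'[OF goodP[OF good\<phi>] p] R' by (auto simp: bidisc_0_iff)
    have "((\<lambda>t. P \<phi> (t, snd p)) has_field_derivative 0 + c1 (prim1 (\<lambda>q. f (fst q, \<phi> q))) (fst p, snd p)) (at (fst p))"
      unfolding P_def
      by (intro derivative_intros)
         (use hol2_DERIV1[OF hol2_prim1[OF hf[OF good\<phi>]], of "fst p" "snd p"] p in auto)
    then have "c1 (P \<phi>) p = 0 + c1 (prim1 (\<lambda>q. f (fst q, \<phi> q))) (fst p, snd p)"
      by (rule c1_eq)
    then show "c1 (P \<phi>) p = f (fst p, P \<phi> p)"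
      using c1_prim1[OF hf[OF good\<phi>] p] fix\<phi>[OF p] by simp
  next
    show "P \<phi> (0, w) = w" for w by (simp add: P_def)
  next
    assume rf: "real_at_reals f (bidisc 0 R)"
    have "real_at_reals (it n) ?D" for n
    proof (induction n)
      case 0
      then show ?case by (simp add: real_at_reals_def it_def)
    next
      case (Suc n)
      have "real_at_reals (\<lambda>q. f (fst q, it n q)) ?D"
        unfolding real_at_reals_def
      proof (intro allI impI)
        fix x y assume p: "(complex_of_real x, complex_of_real y) \<in> ?D"
        then have "it n (of_real x, of_real y) \<in> \<real>" using Suc by (auto simp: real_at_reals_def)
        then obtain z where z: "it n (of_real x, of_real y) = of_real z" by (auto elim: Reals_cases)
        have "(of_real x, of_real z) \<in> bidisc 0 R"
          using in_R'[OF good_it p, of n] bidisc_mono[of R' R 0] R' by (auto simp: z)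
        then show "f (fst (complex_of_real x, complex_of_real y), it n (of_real x, of_real y)) \<in> \<real>"
          using rf by (simp add: real_at_reals_def z)
      qed
      from real_at_reals_prim1[OF hf[OF good_it] this] show ?case
        by (auto simp: it_Suc P_def real_at_reals_def)
    qed
    then have "\<phi> (of_real x, of_real y) \<in> \<real>" if "(of_real x, of_real y) \<in> ?D" for x y
      using closed_sequentially[OF closed_complex_Reals _ pw[OF that]] that by (auto simp: real_at_reals_def)
    then show "real_at_reals (P \<phi>) ?D"
      unfolding real_at_reals_def using fix\<phi> by metis
  qed (use \<rho> in auto)
qed

text \<open>The inverse function theorem gives an inverse that is merely real differentiable. Its
  derivative is the inverse of a complex linear bijection and therefore complex linear, which is
  \<open>scale\<close>; on the two slices this is holomorphy of both components.\<close>

lemma hol2_inverse_function: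
  assumes S: "open S" and F: "hol2 F S" and G: "hol2 G S" and p: "p \<in> S"
    and det: "c1 F p * c2 G p - c2 F p * c1 G p \<noteq> 0"
  obtains U V H K where "open U" "U \<subseteq> S" "p \<in> U" "open V"
    "homeomorphism U V (\<lambda>q. (F q, G q)) (\<lambda>q. (H q, K q))" "hol2 H V" "hol2 K V"
proof -
  define lin where "lin = (\<lambda>a b c d (h :: complex \<times> complex). (a * fst h + b * snd h, c * fst h + d * snd h))"
  have bl: "bounded_linear (lin a b c d)" for a b c d
    unfolding lin_def by (intro bounded_linear_intros)
  define f' where "f' = (\<lambda>q. Blinfun (lin (c1 F q) (c2 F q) (c1 G q) (c2 G q)))"
  have f': "blinfun_apply (f' q) = lin (c1 F q) (c2 F q) (c1 G q) (c2 G q)" for q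
    by (simp add: f'_def bounded_linear_Blinfun_apply bl)
  define D where "D = c1 F p * c2 G p - c2 F p * c1 G p"
  have D: "D \<noteq> 0" using det by (simp add: D_def)
  define iv where "iv = Blinfun (lin (c2 G p / D) (- c2 F p / D) (- c1 G p / D) (c1 F p / D))"
  have iv: "iv o\<^sub>L f' p = id_blinfun"
  proof (rule blinfun_eqI)
    fix h :: "complex \<times> complex"
    have "lin (c2 G p / D) (- c2 F p / D) (- c1 G p / D) (c1 F p / D) (lin (c1 F p) (c2 F p) (c1 G p) (c2 G p) h) = h"
      using D unfolding lin_def by (auto simp: field_simps prod_eq_iff) (auto simp: D_def algebra_simps)
    then show "blinfun_apply (iv o\<^sub>L f' p) h = blinfun_apply id_blinfun h"
      by (simp add: iv_def f' bounded_linear_Blinfun_apply bl)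
  qed
  have der: "((\<lambda>q. (F q, G q)) has_derivative blinfun_apply (f' q)) (at q)" if "q \<in> S" for q
    unfolding f' lin_def by (intro has_derivative_Pair hol2_has_derivative[OF S] F G that)
  have cont: "continuous_on S f'"
    by (rule continuous_on_blinfun_componentwise)
       (auto simp: f' lin_def intro!: continuous_intros hol2_cont[OF hol2_c1] hol2_cont[OF hol2_c2] S F G)
  have "\<exists>U V g g'. open U \<and> U \<subseteq> S \<and> p \<in> U \<and> open V \<and> homeomorphism U V (\<lambda>q. (F q, G q)) g \<and>
      (\<forall>y\<in>V. (g has_derivative (g' y)) (at y) \<and> g' y = inv (blinfun_apply (f' (g y))) \<and>
              bij (blinfun_apply (f' (g y))))"
    by (rule inverse_function_theorem[OF S der cont p iv]) (assumption, blast)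
  then obtain U V g g' where U: "open U" "U \<subseteq> S" "p \<in> U" "open V"
     and hom: "homeomorphism U V (\<lambda>q. (F q, G q)) g"
     and g: "\<And>y. y \<in> V \<Longrightarrow> (g has_derivative (g' y)) (at y)"
     and g': "\<And>y. y \<in> V \<Longrightarrow> g' y = inv (blinfun_apply (f' (g y)))"
     and bij: "\<And>y. y \<in> V \<Longrightarrow> bij (blinfun_apply (f' (g y)))"
    by blast
  have scale: "g' y (c * h, c * k) = (c * fst (g' y (h, k)), c * snd (g' y (h, k)))" if y: "y \<in> V" for y c h k
  proof -
    let ?L = "blinfun_apply (f' (g y))"
    have L: "?L (c * a, c * b) = (c * fst (?L (a, b)), c * snd (?L (a, b)))" for a b
      by (simp add: f' lin_def algebra_simps)
    obtain a b where ab: "g' y (h, k) = (a, b)" by (cases "g' y (h, k)")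
    have "?L (a, b) = (h, k)" using ab g'[OF y] bij[OF y] by (metis bij_inv_eq_iff)
    then have "?L (c * a, c * b) = (c * h, c * k)" using L by simp
    then show ?thesis using ab g'[OF y] bij[OF y] by (metis bij_inv_eq_iff fst_conv snd_conv)
  qed
  have cg: "continuous_on V g" using hom by (simp add: homeomorphism_def)
  have d1: "((\<lambda>t. g (t, w)) has_derivative (\<lambda>h. g' (z, w) (h, 0))) (at z)"
       and d2: "((\<lambda>t. g (z, t)) has_derivative (\<lambda>h. g' (z, w) (0, h))) (at w)" if "(z, w) \<in> V" for z w
  proof -
    have "((\<lambda>t. (t, w)) has_derivative (\<lambda>h. (h, 0))) (at z)" "((\<lambda>t. (z, t)) has_derivative (\<lambda>h. (0, h))) (at w)"
      by (auto intro!: derivative_eq_intros)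
    from this(1)[THEN diff_chain_at, OF g[OF that]] this(2)[THEN diff_chain_at, OF g[OF that]]
    show "((\<lambda>t. g (t, w)) has_derivative (\<lambda>h. g' (z, w) (h, 0))) (at z)"
      "((\<lambda>t. g (z, t)) has_derivative (\<lambda>h. g' (z, w) (0, h))) (at w)" by (simp_all add: o_def)
  qed
  define A1 A2 B1 B2 where "A1 = (\<lambda>y. fst (g' y (1, 0)))" and "A2 = (\<lambda>y. snd (g' y (1, 0)))"
    and "B1 = (\<lambda>y. fst (g' y (0, 1)))" and "B2 = (\<lambda>y. snd (g' y (0, 1)))"
  have h1: "g' y (h, 0) = (A1 y * h, A2 y * h)" and h2: "g' y (0, h) = (B1 y * h, B2 y * h)"
    if "y \<in> V" for y h
    using scale[OF that, of h 1 0] scale[OF that, of h 0 1]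
    by (simp_all add: A1_def A2_def B1_def B2_def mult.commute)
  have "hol2 (\<lambda>q. fst (g q)) V"
  proof (rule hol2I)
    show "continuous_on V (\<lambda>q. fst (g q))" by (intro continuous_intros cg)
    fix z w assume y: "(z, w) \<in> V"
    have "((\<lambda>t. fst (g (t, w))) has_derivative (\<lambda>h. A1 (z, w) * h)) (at z)"
      using has_derivative_fst[OF d1[OF y]] h1[OF y] by simp
    then show "(\<lambda>t. fst (g (t, w))) field_differentiable at z"
      by (auto simp: field_differentiable_def has_field_derivative_def)
    have "((\<lambda>t. fst (g (z, t))) has_derivative (\<lambda>h. B1 (z, w) * h)) (at w)"
      using has_derivative_fst[OF d2[OF y]] h2[OF y] by simp
    then show "(\<lambda>t. fst (g (z, t))) field_differentiable at w"
      by (auto simp: field_differentiable_def has_field_derivative_def)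
  qed (rule U)
  moreover have "hol2 (\<lambda>q. snd (g q)) V"
  proof (rule hol2I)
    show "continuous_on V (\<lambda>q. snd (g q))" by (intro continuous_intros cg)
    fix z w assume y: "(z, w) \<in> V"
    have "((\<lambda>t. snd (g (t, w))) has_derivative (\<lambda>h. A2 (z, w) * h)) (at z)"
      using has_derivative_snd[OF d1[OF y]] h1[OF y] by simp
    then show "(\<lambda>t. snd (g (t, w))) field_differentiable at z"
      by (auto simp: field_differentiable_def has_field_derivative_def)
    have "((\<lambda>t. snd (g (z, t))) has_derivative (\<lambda>h. B2 (z, w) * h)) (at w)"
      using has_derivative_snd[OF d2[OF y]] h2[OF y] by simp
    then show "(\<lambda>t. snd (g (z, t))) field_differentiable at w"
      by (auto simp: field_differentiable_def has_field_derivative_def)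
  qed (rule U)
  ultimately show ?thesis
    using U hom by (intro that[of U V "\<lambda>q. fst (g q)" "\<lambda>q. snd (g q)"]) auto
qed

section \<open>Real analytic functions of two variables\<close>

definition vec2 :: "real \<Rightarrow> real \<Rightarrow> real^2" where
  "vec2 x y = vector [x, y]"

lemma vec2_nth [simp]: "vec2 x y $ 1 = x" "vec2 x y $ 2 = y"
  by (simp_all add: vec2_def)

lemma vec2_eta [simp]: "vec2 (z $ 1) (z $ 2) = z"
  by (simp add: vec_eq_iff forall_2)

lemma vec2_0 [simp]: "vec2 0 0 = 0"
  by (simp add: vec_eq_iff forall_2)

lemma vec2_eq_iff: "z = w \<longleftrightarrow> z $ 1 = w $ 1 \<and> z $ 2 = w $ (2::2)"
  by (simp add: vec_eq_iff forall_2)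

definition cx :: "real^2 \<Rightarrow> complex \<times> complex" where
  "cx z = (of_real (z $ 1), of_real (z $ 2))"

lemma cx_vec2: "cx (vec2 x y) = (of_real x, of_real y)"
  by (simp add: cx_def)

lemma fst_cx [simp]: "fst (cx z) = of_real (z $ 1)" and snd_cx [simp]: "snd (cx z) = of_real (z $ 2)"
  by (simp_all add: cx_def)

lemma cx_0 [simp]: "cx 0 = 0"
  by (simp add: cx_def zero_prod_def)

lemma cx_inj: "cx z = cx w \<longleftrightarrow> z = w"
  by (simp add: cx_def vec2_eq_iff)

lemma cx_has_derivative: "(cx has_derivative cx) (at z)"
  unfolding cx_def
  by (intro has_derivative_Pair has_derivative_of_real bounded_linear_imp_has_derivative bounded_linear_vec_nth)

lemma continuous_on_cx: "continuous_on S cx"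
  using cx_has_derivative has_derivative_continuous continuous_at_imp_continuous_on by blast

definition box2 :: "real^2 \<Rightarrow> real \<Rightarrow> (real^2) set" where
  "box2 a e = {z. cx z \<in> bidisc (cx a) e}"

lemma box2_iff: "z \<in> box2 a e \<longleftrightarrow> \<bar>z $ 1 - a $ 1\<bar> < e \<and> \<bar>z $ 2 - a $ 2\<bar> < e"
  by (simp add: box2_def bidisc_def cx_def dist_of_real dist_real_def abs_minus_commute)

lemma open_box2 [simp]: "open (box2 a e)"
proof -
  have "open (cx -` bidisc (cx a) e)" by (intro open_vimage open_bidisc continuous_on_cx)
  then show ?thesis by (simp add: box2_def vimage_def)
qed

lemma box2_subset_ball: "box2 a (e/2) \<subseteq> ball a e"
proof
  fix z assume z: "z \<in> box2 a (e/2)"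
  have "norm (z - a) \<le> \<bar>(z - a) $ 1\<bar> + \<bar>(z - a) $ 2\<bar>"
    using norm_le_l1_cart[of "z - a"] by (simp add: sum_2)
  then show "z \<in> ball a e" using z by (simp add: box2_iff dist_norm norm_minus_commute)
qed

lemma ball_subset_box2: "ball a e \<subseteq> box2 a e"
proof
  fix z assume "z \<in> ball a e"
  then show "z \<in> box2 a e"
    using component_le_norm_cart[of "z - a" 1] component_le_norm_cart[of "z - a" 2]
    by (simp add: box2_iff dist_norm norm_minus_commute)
qed

lemma eventually_box2: "eventually P (nhds a) \<longleftrightarrow> (\<exists>e>0. \<forall>z\<in>box2 a e. P z)"
proof
  assume "eventually P (nhds a)"
  then obtain e where "e > 0" "\<And>z. dist z a < e \<Longrightarrow> P z"
    by (auto simp: eventually_nhds_metric)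
  then show "\<exists>e>0. \<forall>z\<in>box2 a e. P z"
    using box2_subset_ball[of a e] by (intro exI[of _ "e/2"]) (auto simp: dist_commute)
next
  assume "\<exists>e>0. \<forall>z\<in>box2 a e. P z"
  then show "eventually P (nhds a)"
    using ball_subset_box2 unfolding eventually_nhds_metric by (metis dist_commute mem_ball subsetD)
qed

lemma eventually_box2_in: "e > 0 \<Longrightarrow> \<forall>\<^sub>F z in nhds a. z \<in> box2 a e"
  unfolding eventually_box2 by blast

text \<open>Analyticity at a point is expressed by a holomorphic extension: composites, roots, inverse maps
  and flows then inherit it from the complex side.\<close>

definition real_analytic_at :: "(real^2 \<Rightarrow> real) \<Rightarrow> real^2 \<Rightarrow> bool" where
  "real_analytic_at f a \<longleftrightarrow> (\<exists>F e. e > 0 \<and> hol2 F (bidisc (cx a) e) \<and> (\<forall>z\<in>box2 a e. F (cx z) = of_real (f z)))"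

definition D1 :: "(real^2 \<Rightarrow> real) \<Rightarrow> real^2 \<Rightarrow> real" where
  "D1 f z = frechet_derivative f (at z) (axis 1 1)"

definition D2 :: "(real^2 \<Rightarrow> real) \<Rightarrow> real^2 \<Rightarrow> real" where
  "D2 f z = frechet_derivative f (at z) (axis 2 1)"

lemma D_eqI:
  assumes "(f has_derivative (\<lambda>h. p * h $ 1 + q * h $ 2)) (at z)"
  shows "D1 f z = p" "D2 f z = q"
  using frechet_derivative_at[OF assms, symmetric] by (simp_all add: D1_def D2_def axis_def)

text \<open>The extension is real valued on real points, so the imaginary part of its derivative
  along \<open>cx\<close> is zero. Hence both complex partial derivatives are real there and equal
  those of f.\<close>

lemma extension_derivative:
  assumes F: "hol2 F (bidisc (cx a) e)" and eq: "\<And>z. z \<in> box2 a e \<Longrightarrow> F (cx z) = of_real (f z)"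
    and z: "z \<in> box2 a e"
  shows "(f has_derivative (\<lambda>h. D1 f z * h $ 1 + D2 f z * h $ 2)) (at z)"
    and "c1 F (cx z) = of_real (D1 f z)" "c2 F (cx z) = of_real (D2 f z)"
proof -
  have cz: "cx z \<in> bidisc (cx a) e" using z by (simp add: box2_def)
  let ?L = "\<lambda>h::real^2. c1 F (cx z) * of_real (h $ 1) + c2 F (cx z) * of_real (h $ 2)"
  have "((\<lambda>z. F (cx z)) has_derivative ?L) (at z)"
    using diff_chain_at[OF cx_has_derivative hol2_has_derivative[OF open_bidisc F cz]]
    by (simp add: o_def)
  then have d: "((\<lambda>z. complex_of_real (f z)) has_derivative ?L) (at z)"
    by (rule has_derivative_transform_within_open[OF _ open_box2[of a e] z]) (rule eq)
  have "((\<lambda>z. Im (complex_of_real (f z))) has_derivative (\<lambda>h. Im (?L h))) (at z)"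
    by (rule has_derivative_Im[OF d])
  moreover have "((\<lambda>z. Im (complex_of_real (f z))) has_derivative (\<lambda>h. 0)) (at z)"
    by simp
  ultimately have im: "(\<lambda>h. Im (?L h)) = (\<lambda>h. 0)"
    by (rule has_derivative_unique)
  have "((\<lambda>z. Re (complex_of_real (f z))) has_derivative (\<lambda>h. Re (?L h))) (at z)"
    by (rule has_derivative_Re[OF d])
  then have r: "(f has_derivative (\<lambda>h. Re (c1 F (cx z)) * h $ 1 + Re (c2 F (cx z)) * h $ 2)) (at z)"
    by simp
  from D_eqI[OF this] r show "(f has_derivative (\<lambda>h. D1 f z * h $ 1 + D2 f z * h $ 2)) (at z)" by simp
  show "c1 F (cx z) = of_real (D1 f z)" "c2 F (cx z) = of_real (D2 f z)"
    using D_eqI[OF r] fun_cong[OF im, of "axis 1 1"] fun_cong[OF im, of "axis 2 1"]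
    by (auto simp: complex_eq_iff axis_def)
qed

lemma real_analytic_atE:
  assumes "real_analytic_at f a"
  obtains F e where "e > 0" "hol2 F (bidisc (cx a) e)" "\<And>z. z \<in> box2 a e \<Longrightarrow> F (cx z) = of_real (f z)"
    "\<And>z. z \<in> box2 a e \<Longrightarrow> c1 F (cx z) = of_real (D1 f z)"
    "\<And>z. z \<in> box2 a e \<Longrightarrow> c2 F (cx z) = of_real (D2 f z)"
proof -
  obtain F e where F: "e > 0" "hol2 F (bidisc (cx a) e)" "\<forall>z\<in>box2 a e. F (cx z) = of_real (f z)"
    using assms unfolding real_analytic_at_def by blast
  show ?thesis
    using that[OF F(1,2)] F(3) extension_derivative(2,3)[OF F(2), of f] by blast
qed

lemma real_analytic_atI:
  assumes "open S" "cx a \<in> S" "hol2 F S" "open N" "a \<in> N"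
    and eq: "\<And>z. z \<in> N \<Longrightarrow> cx z \<in> S \<Longrightarrow> F (cx z) = of_real (f z)"
  shows "real_analytic_at f a"
proof -
  obtain r where r: "r > 0" "bidisc (cx a) r \<subseteq> S" using open_contains_bidisc assms by metis
  have "\<forall>\<^sub>F z in nhds a. z \<in> N" using assms eventually_nhds by blast
  then obtain e where e: "e > 0" "\<And>z. z \<in> box2 a e \<Longrightarrow> z \<in> N"
    unfolding eventually_box2 by blast
  have "hol2 F (bidisc (cx a) (min e r))"
    using hol2_subset[OF assms(3)] r bidisc_mono[of "min e r" r "cx a"] by auto
  moreover have "F (cx z) = of_real (f z)" if "z \<in> box2 a (min e r)" for z
  proof (rule eq)
    have "z \<in> box2 a e" using that by (simp add: box2_iff)
    then show "z \<in> N" by (rule e)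
    have "cx z \<in> bidisc (cx a) (min e r)" using that by (simp add: box2_def)
    then show "cx z \<in> S" using r bidisc_mono[of "min e r" r "cx a"] by auto
  qed
  ultimately show ?thesis unfolding real_analytic_at_def using e r by (intro exI[of _ F] exI[of _ "min e r"]) auto
qed

section \<open>Algebra and calculus of functions analytic at a point\<close>

lemma analytic_cong:
  assumes "real_analytic_at f a" "\<forall>\<^sub>F z in nhds a. g z = f z"
  shows "real_analytic_at g a"
proof -
  obtain F e where F: "e > 0" "hol2 F (bidisc (cx a) e)" "\<And>z. z \<in> box2 a e \<Longrightarrow> F (cx z) = of_real (f z)"
    by (rule real_analytic_atE[OF assms(1)]) blast
  obtain N where N: "open N" "a \<in> N" "\<And>z. z \<in> N \<Longrightarrow> g z = f z"
    using assms(2) unfolding eventually_nhds by blast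
  show ?thesis
    by (rule real_analytic_atI[OF open_bidisc _ F(2) N(1,2)]) (use F N in \<open>auto simp: box2_def\<close>)
qed

lemma analytic_eventually:
  assumes "real_analytic_at f a"
  shows "\<forall>\<^sub>F z in nhds a. real_analytic_at f z"
proof -
  obtain F e where F: "e > 0" "hol2 F (bidisc (cx a) e)" "\<And>z. z \<in> box2 a e \<Longrightarrow> F (cx z) = of_real (f z)"
    by (rule real_analytic_atE[OF assms]) blast
  have "real_analytic_at f z" if "z \<in> box2 a e" for z
    by (rule real_analytic_atI[OF open_bidisc _ F(2) open_box2[of a e] that]) (use that F in \<open>auto simp: box2_def\<close>)
  then show ?thesis unfolding eventually_box2 using F(1) by blast
qed

lemma analytic_has_derivative: "real_analytic_at f a \<Longrightarrow> (f has_derivative (\<lambda>h. D1 f a * h $ 1 + D2 f a * h $ 2)) (at a)"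
  unfolding real_analytic_at_def by (elim exE conjE, rule extension_derivative(1)) (auto simp: box2_def)

lemma analytic_isCont: "real_analytic_at f a \<Longrightarrow> isCont f a"
  using analytic_has_derivative has_derivative_continuous by blast

lemma analytic_D1: "real_analytic_at f a \<Longrightarrow> real_analytic_at (D1 f) a"
  by (erule real_analytic_atE) (unfold real_analytic_at_def, intro exI conjI ballI, assumption, rule hol2_c1[OF open_bidisc], assumption, blast)

lemma analytic_D2: "real_analytic_at f a \<Longrightarrow> real_analytic_at (D2 f) a"
  by (erule real_analytic_atE) (unfold real_analytic_at_def, intro exI conjI ballI, assumption, rule hol2_c2[OF open_bidisc], assumption, blast)

lemma real_analytic_at2E:
  assumes "real_analytic_at f a" "real_analytic_at g a"
  obtains F G e where "e > 0" "hol2 F (bidisc (cx a) e)" "hol2 G (bidisc (cx a) e)"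
    "\<And>z. z \<in> box2 a e \<Longrightarrow> F (cx z) = of_real (f z)" "\<And>z. z \<in> box2 a e \<Longrightarrow> G (cx z) = of_real (g z)"
proof -
  obtain F e where F: "e > 0" "hol2 F (bidisc (cx a) e)" "\<And>z. z \<in> box2 a e \<Longrightarrow> F (cx z) = of_real (f z)"
    by (rule real_analytic_atE[OF assms(1)]) blast
  obtain G d where G: "d > 0" "hol2 G (bidisc (cx a) d)" "\<And>z. z \<in> box2 a d \<Longrightarrow> G (cx z) = of_real (g z)"
    by (rule real_analytic_atE[OF assms(2)]) blast
  show ?thesis
    by (rule that[of "min e d" F G])
       (use F G hol2_subset bidisc_mono[of "min e d" e "cx a"] bidisc_mono[of "min e d" d "cx a"] in \<open>auto simp: box2_iff\<close>)
qed

lemma analytic_const [simp]: "real_analytic_at (\<lambda>z. c) a"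
  unfolding real_analytic_at_def by (intro exI[of _ "\<lambda>z. of_real c"] exI[of _ 1]) auto

lemma analytic_x [simp]: "real_analytic_at (\<lambda>z. z $ 1) a" and analytic_y [simp]: "real_analytic_at (\<lambda>z. z $ 2) a"
  unfolding real_analytic_at_def
  by (rule exI[of _ fst], rule exI[of _ 1], simp) (rule exI[of _ snd], rule exI[of _ 1], simp)

lemma analytic_add:
  assumes "real_analytic_at f a" "real_analytic_at g a"
  shows "real_analytic_at (\<lambda>z. f z + g z) a"
proof -
  obtain F G e where *: "e > 0" "hol2 F (bidisc (cx a) e)" "hol2 G (bidisc (cx a) e)"
    "\<And>z. z \<in> box2 a e \<Longrightarrow> F (cx z) = of_real (f z)" "\<And>z. z \<in> box2 a e \<Longrightarrow> G (cx z) = of_real (g z)"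
    by (rule real_analytic_at2E[OF assms]) blast
  show ?thesis
    unfolding real_analytic_at_def
    by (rule exI[of _ "\<lambda>p. F p + G p"], rule exI[of _ e]) (use * hol2_add in auto)
qed

lemma analytic_diff:
  assumes "real_analytic_at f a" "real_analytic_at g a"
  shows "real_analytic_at (\<lambda>z. f z - g z) a"
proof -
  obtain F G e where *: "e > 0" "hol2 F (bidisc (cx a) e)" "hol2 G (bidisc (cx a) e)"
    "\<And>z. z \<in> box2 a e \<Longrightarrow> F (cx z) = of_real (f z)" "\<And>z. z \<in> box2 a e \<Longrightarrow> G (cx z) = of_real (g z)"
    by (rule real_analytic_at2E[OF assms]) blast
  show ?thesis
    unfolding real_analytic_at_def
    by (rule exI[of _ "\<lambda>p. F p - G p"], rule exI[of _ e]) (use * hol2_diff in auto)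
qed

lemma analytic_mult:
  assumes "real_analytic_at f a" "real_analytic_at g a"
  shows "real_analytic_at (\<lambda>z. f z * g z) a"
proof -
  obtain F G e where *: "e > 0" "hol2 F (bidisc (cx a) e)" "hol2 G (bidisc (cx a) e)"
    "\<And>z. z \<in> box2 a e \<Longrightarrow> F (cx z) = of_real (f z)" "\<And>z. z \<in> box2 a e \<Longrightarrow> G (cx z) = of_real (g z)"
    by (rule real_analytic_at2E[OF assms]) blast
  show ?thesis
    unfolding real_analytic_at_def
    by (rule exI[of _ "\<lambda>p. F p * G p"], rule exI[of _ e]) (use * hol2_mult in auto)
qed

lemma analytic_power: "real_analytic_at f a \<Longrightarrow> real_analytic_at (\<lambda>z. f z ^ n) a"
  by (induction n) (auto intro: analytic_mult)

lemma analytic_sum: "(\<And>i. i \<in> I \<Longrightarrow> real_analytic_at (f i) a) \<Longrightarrow> real_analytic_at (\<lambda>z. \<Sum>i\<in>I. f i z) a"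
  by (induction I rule: infinite_finite_induct) (auto intro: analytic_add)

lemma analytic_comp_holo:
  assumes "real_analytic_at f a" "h holomorphic_on T" "open T" "of_real (f a) \<in> T"
    and "\<And>x. of_real x \<in> T \<Longrightarrow> h (of_real x) = of_real (g x)"
  shows "real_analytic_at (\<lambda>z. g (f z)) a"
proof -
  obtain F e where F: "e > 0" "hol2 F (bidisc (cx a) e)" "\<And>z. z \<in> box2 a e \<Longrightarrow> F (cx z) = of_real (f z)"
    by (rule real_analytic_atE[OF assms(1)]) blast
  let ?S = "bidisc (cx a) e \<inter> F -` T"
  have o: "open ?S"
    using continuous_open_preimage[OF hol2_cont[OF F(2)] open_bidisc assms(3)] .
  have h: "hol2 (\<lambda>p. h (F p)) ?S"
    by (rule hol2_comp_holo[OF hol2_subset[OF F(2)] assms(2,3)]) auto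
  have aa: "a \<in> box2 a e" using F(1) by (simp add: box2_def)
  show ?thesis
  proof (rule real_analytic_atI[OF o _ h open_box2[of a e] aa])
    show "cx a \<in> ?S" using F(1) F(3)[OF aa] assms(4) by simp
    show "h (F (cx z)) = of_real (g (f z))" if "z \<in> box2 a e" "cx z \<in> ?S" for z
      using that F(3)[OF that(1)] assms(5)[of "f z"] by auto
  qed
qed

lemma analytic_inverse:
  assumes "real_analytic_at f a" "f a \<noteq> 0"
  shows "real_analytic_at (\<lambda>z. inverse (f z)) a"
  by (rule analytic_comp_holo[OF assms(1), of inverse "- {0}"])
     (use assms(2) in \<open>auto intro!: holomorphic_intros\<close>)

lemma analytic_divide: "real_analytic_at f a \<Longrightarrow> real_analytic_at g a \<Longrightarrow> g a \<noteq> 0 \<Longrightarrow> real_analytic_at (\<lambda>z. f z / g z) a"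
  unfolding divide_inverse by (intro analytic_mult analytic_inverse)

lemma analytic_powr:
  assumes "real_analytic_at f a" "f a > 0"
  shows "real_analytic_at (\<lambda>z. f z powr c) a"
proof (rule analytic_comp_holo[OF assms(1), of "\<lambda>u. exp (of_real c * Ln u)" "{u. Re u > 0}" "\<lambda>x. x powr c"])
  show "(\<lambda>u. exp (of_real c * Ln u)) holomorphic_on {u. Re u > 0}"
    by (intro holomorphic_intros) (auto simp: complex_nonpos_Reals_iff)
  show "exp (of_real c * Ln (of_real x)) = of_real (x powr c)" if "of_real x \<in> {u. Re u > 0}" for x
    using that by (simp add: Ln_of_real powr_def flip: exp_of_real)
qed (use assms in \<open>auto simp: open_halfspace_Re_gt\<close>)

lemma analytic_compose:
  assumes f: "real_analytic_at f (vec2 (g a) (h a))" and g: "real_analytic_at g a" and h: "real_analytic_at h a"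
  shows "real_analytic_at (\<lambda>z. f (vec2 (g z) (h z))) a"
proof -
  obtain F e where F: "e > 0" "hol2 F (bidisc (cx (vec2 (g a) (h a))) e)"
      "\<And>z. z \<in> box2 (vec2 (g a) (h a)) e \<Longrightarrow> F (cx z) = of_real (f z)"
    by (rule real_analytic_atE[OF f]) blast
  obtain G H d where G: "d > 0" "hol2 G (bidisc (cx a) d)" "hol2 H (bidisc (cx a) d)"
    "\<And>z. z \<in> box2 a d \<Longrightarrow> G (cx z) = of_real (g z)" "\<And>z. z \<in> box2 a d \<Longrightarrow> H (cx z) = of_real (h z)"
    by (rule real_analytic_at2E[OF g h]) blast
  let ?T = "bidisc (cx (vec2 (g a) (h a))) e"
  let ?S = "bidisc (cx a) d \<inter> (\<lambda>p. (G p, H p)) -` ?T"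
  have o: "open ?S"
    by (intro continuous_open_preimage continuous_on_Pair hol2_cont[OF G(2)] hol2_cont[OF G(3)]) auto
  have s: "?S \<subseteq> bidisc (cx a) d" by auto
  have hh: "hol2 (\<lambda>p. F (G p, H p)) ?S"
    by (rule hol2_compose[OF open_bidisc F(2) o hol2_subset[OF G(2) s] hol2_subset[OF G(3) s]]) auto
  have aa: "a \<in> box2 a d" using G(1) by (simp add: box2_def)
  have gh: "(G (cx z), H (cx z)) = cx (vec2 (g z) (h z))" if "z \<in> box2 a d" for z
    using G that by (simp add: cx_vec2)
  show ?thesis
  proof (rule real_analytic_atI[OF o _ hh open_box2[of a d] aa])
    show "cx a \<in> ?S" using aa F(1) G(1) gh[OF aa] by simp
    show "F (G (cx z), H (cx z)) = of_real (f (vec2 (g z) (h z)))" if "z \<in> box2 a d" "cx z \<in> ?S" for z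
      unfolding gh[OF that(1)] by (rule F(3)) (use that gh[OF that(1)] in \<open>simp add: box2_def\<close>)
  qed
qed

lemma D_const [simp]: "D1 (\<lambda>z. c) a = 0" "D2 (\<lambda>z. c) a = 0"
  by (rule D_eqI[where p = 0 and q = 0]; simp)+

lemma D_x [simp]: "D1 (\<lambda>z. z $ 1) a = 1" "D2 (\<lambda>z. z $ 1) a = 0"
  by (rule D_eqI[where p = 1 and q = 0]; simp add: bounded_linear_imp_has_derivative bounded_linear_vec_nth)+

lemma D_y [simp]: "D1 (\<lambda>z. z $ 2) a = 0" "D2 (\<lambda>z. z $ 2) a = 1"
  by (rule D_eqI[where p = 0 and q = 1]; simp add: bounded_linear_imp_has_derivative bounded_linear_vec_nth)+

lemma D_add:
  assumes "real_analytic_at f a" "real_analytic_at g a"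
  shows "D1 (\<lambda>z. f z + g z) a = D1 f a + D1 g a" "D2 (\<lambda>z. f z + g z) a = D2 f a + D2 g a"
proof -
  have "((\<lambda>z. f z + g z) has_derivative (\<lambda>h. (D1 f a + D1 g a) * h $ 1 + (D2 f a + D2 g a) * h $ 2)) (at a)"
    by (rule has_derivative_eq_rhs[OF has_derivative_add[OF analytic_has_derivative[OF assms(1)] analytic_has_derivative[OF assms(2)]]])
       (simp add: fun_eq_iff algebra_simps)
  from D_eqI[OF this] show "D1 (\<lambda>z. f z + g z) a = D1 f a + D1 g a" "D2 (\<lambda>z. f z + g z) a = D2 f a + D2 g a" by auto
qed

lemma D_diff:
  assumes "real_analytic_at f a" "real_analytic_at g a"
  shows "D1 (\<lambda>z. f z - g z) a = D1 f a - D1 g a" "D2 (\<lambda>z. f z - g z) a = D2 f a - D2 g a"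
proof -
  have "((\<lambda>z. f z - g z) has_derivative (\<lambda>h. (D1 f a - D1 g a) * h $ 1 + (D2 f a - D2 g a) * h $ 2)) (at a)"
    by (rule has_derivative_eq_rhs[OF has_derivative_diff[OF analytic_has_derivative[OF assms(1)] analytic_has_derivative[OF assms(2)]]])
       (simp add: fun_eq_iff algebra_simps)
  from D_eqI[OF this] show "D1 (\<lambda>z. f z - g z) a = D1 f a - D1 g a" "D2 (\<lambda>z. f z - g z) a = D2 f a - D2 g a" by auto
qed

lemma D_mult:
  assumes "real_analytic_at f a" "real_analytic_at g a"
  shows "D1 (\<lambda>z. f z * g z) a = f a * D1 g a + D1 f a * g a" "D2 (\<lambda>z. f z * g z) a = f a * D2 g a + D2 f a * g a"
proof -
  have "((\<lambda>z. f z * g z) has_derivative (\<lambda>h. (f a * D1 g a + D1 f a * g a) * h $ 1 + (f a * D2 g a + D2 f a * g a) * h $ 2)) (at a)"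
    by (rule has_derivative_eq_rhs[OF has_derivative_mult[OF analytic_has_derivative[OF assms(1)] analytic_has_derivative[OF assms(2)]]])
       (simp add: fun_eq_iff algebra_simps)
  from D_eqI[OF this] show "D1 (\<lambda>z. f z * g z) a = f a * D1 g a + D1 f a * g a" "D2 (\<lambda>z. f z * g z) a = f a * D2 g a + D2 f a * g a" by auto
qed

lemma D_power:
  assumes "real_analytic_at f a"
  shows "D1 (\<lambda>z. f z ^ n) a = of_nat n * f a ^ (n - 1) * D1 f a" "D2 (\<lambda>z. f z ^ n) a = of_nat n * f a ^ (n - 1) * D2 f a"
proof -
  have "((\<lambda>z. f z ^ n) has_derivative (\<lambda>h. (of_nat n * f a ^ (n - 1) * D1 f a) * h $ 1 + (of_nat n * f a ^ (n - 1) * D2 f a) * h $ 2)) (at a)"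
    by (rule has_derivative_eq_rhs[OF has_derivative_power[OF analytic_has_derivative[OF assms]]])
       (simp add: fun_eq_iff algebra_simps)
  from D_eqI[OF this] show "D1 (\<lambda>z. f z ^ n) a = of_nat n * f a ^ (n - 1) * D1 f a" "D2 (\<lambda>z. f z ^ n) a = of_nat n * f a ^ (n - 1) * D2 f a" by auto
qed

lemma has_derivative_vec2:
  assumes "(g has_derivative g') (at a)" "(h has_derivative h') (at a)"
  shows "((\<lambda>z. vec2 (g z) (h z)) has_derivative (\<lambda>k. vec2 (g' k) (h' k))) (at a)"
proof -
  have eq: "vec2 x y = x *\<^sub>R axis 1 1 + y *\<^sub>R axis 2 1" for x y
    by (simp add: vec2_eq_iff axis_def)
  show ?thesis unfolding eq by (intro derivative_intros assms)
qed

lemma D_compose: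
  assumes f: "real_analytic_at f (vec2 (g a) (h a))" and g: "real_analytic_at g a" and h: "real_analytic_at h a"
  shows "D1 (\<lambda>z. f (vec2 (g z) (h z))) a = D1 f (vec2 (g a) (h a)) * D1 g a + D2 f (vec2 (g a) (h a)) * D1 h a"
    "D2 (\<lambda>z. f (vec2 (g z) (h z))) a = D1 f (vec2 (g a) (h a)) * D2 g a + D2 f (vec2 (g a) (h a)) * D2 h a"
proof -
  let ?p = "D1 f (vec2 (g a) (h a))" and ?q = "D2 f (vec2 (g a) (h a))"
  have "((\<lambda>z. f (vec2 (g z) (h z))) has_derivative (\<lambda>k. (?p * D1 g a + ?q * D1 h a) * k $ 1 + (?p * D2 g a + ?q * D2 h a) * k $ 2)) (at a)"
    using diff_chain_at[OF has_derivative_vec2[OF analytic_has_derivative[OF g] analytic_has_derivative[OF h]] analytic_has_derivative[OF f]]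
    by (simp add: o_def algebra_simps)
  from D_eqI[OF this] show
    "D1 (\<lambda>z. f (vec2 (g z) (h z))) a = ?p * D1 g a + ?q * D1 h a"
    "D2 (\<lambda>z. f (vec2 (g z) (h z))) a = ?p * D2 g a + ?q * D2 h a" by auto
qed

lemma D_cong:
  assumes "\<forall>\<^sub>F z in nhds a. f z = g z"
  shows "D1 f a = D1 g a" "D2 f a = D2 g a"
proof -
  obtain N where N: "open N" "a \<in> N" "\<forall>z\<in>N. f z = g z"
    using assms unfolding eventually_nhds by blast
  have "(f has_derivative L) (at a) \<longleftrightarrow> (g has_derivative L) (at a)" for L
    using has_derivative_transform_within_open[of f L a UNIV N g]
      has_derivative_transform_within_open[of g L a UNIV N f] N by auto
  then show "D1 f a = D1 g a" "D2 f a = D2 g a"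
    by (simp_all add: D1_def D2_def frechet_derivative_def)
qed

lemma DERIV_D1:
  assumes "real_analytic_at f z"
  shows "((\<lambda>t. f (vec2 t (z $ 2))) has_field_derivative D1 f z) (at (z $ 1))"
proof -
  have "((\<lambda>t. vec2 t (z $ 2)) has_derivative (\<lambda>h. vec2 h 0)) (at (z $ 1))"
    by (rule has_derivative_vec2[OF has_derivative_ident has_derivative_const])
  from diff_chain_at[OF this, of f "\<lambda>h. D1 f z * h $ 1 + D2 f z * h $ 2"] analytic_has_derivative[OF assms]
  show ?thesis by (simp add: o_def has_field_derivative_def)
qed

lemma DERIV_D2:
  assumes "real_analytic_at f z"
  shows "((\<lambda>t. f (vec2 (z $ 1) t)) has_field_derivative D2 f z) (at (z $ 2))"
proof -
  have "((\<lambda>t. vec2 (z $ 1) t) has_derivative (\<lambda>h. vec2 0 h)) (at (z $ 2))"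
    by (rule has_derivative_vec2[OF has_derivative_const has_derivative_ident])
  from diff_chain_at[OF this, of f "\<lambda>h. D1 f z * h $ 1 + D2 f z * h $ 2"] analytic_has_derivative[OF assms]
  show ?thesis by (simp add: o_def has_field_derivative_def)
qed

lemma eventually_nhds_compose:
  assumes "isCont g a" "eventually P (nhds (g a))"
  shows "eventually (\<lambda>z. P (g z)) (nhds a)"
proof -
  have "(g \<longlongrightarrow> g a) (nhds a)"
    using assms(1) unfolding isCont_def tendsto_at_iff_tendsto_nhds .
  then show ?thesis using assms(2) unfolding filterlim_iff by blast
qed

lemma isCont_vec2: "isCont g a \<Longrightarrow> isCont h a \<Longrightarrow> isCont (\<lambda>z. vec2 (g z) (h z)) a"
proof -
  assume "isCont g a" "isCont h a"
  moreover have "vec2 x y = x *\<^sub>R axis 1 1 + y *\<^sub>R axis 2 1" for x y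
    by (simp add: vec2_eq_iff axis_def)
  ultimately show ?thesis by (simp add: continuous_intros)
qed

lemma eventually_vec2_compose:
  assumes "real_analytic_at g a" "real_analytic_at h a" "eventually P (nhds (vec2 (g a) (h a)))"
  shows "eventually (\<lambda>z. P (vec2 (g z) (h z))) (nhds a)"
  using eventually_nhds_compose[OF isCont_vec2[OF analytic_isCont[OF assms(1)] analytic_isCont[OF assms(2)]] assms(3)] .

text \<open>From series to extension: unconditional summability of reals is absolute, so convergence
  at one point with both offsets nonzero controls a complex bidisc. Conversely, the real parts of
  the coefficients of the extension represent f, because the monomials are real at real
  points.\<close>

lemma real_analytic_on_iff_at:
  fixes f :: "real^2 \<Rightarrow> real"
  shows "real_analytic_on f S \<longleftrightarrow> (\<forall>a\<in>S. real_analytic_at f a)"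
proof (intro iffI ballI)
  fix a assume "real_analytic_on f S" "a \<in> S"
  then obtain C r where r: "r > 0" and C: "\<And>z. z \<in> ball a r \<Longrightarrow>
      ((\<lambda>(i, j). ((z$1 - a$1) ^ i * (z$2 - a$2) ^ j) *\<^sub>R C i j) has_sum f z) UNIV"
    unfolding real_analytic_on_def by blast
  \<comment> \<open>Small enough for (t, t) to be an admissible offset: the box of half side r/2
    lies in the ball of radius r.\<close>
  define t where "t = r / 4"
  have t: "t > 0" "t < r / 2" using r by (auto simp: t_def)
  have "vec2 (a $ 1 + t) (a $ 2 + t) \<in> box2 a (r / 2)" using t by (simp add: box2_iff)
  then have "vec2 (a $ 1 + t) (a $ 2 + t) \<in> ball a r" using box2_subset_ball by blast
  from C[OF this] have "(\<lambda>(i, j). t ^ i * t ^ j * C i j) summable_on UNIV"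
    by (auto intro: has_sum_imp_summable)
  then have "(\<lambda>x. norm (case x of (i, j) \<Rightarrow> t ^ i * t ^ j * C i j)) summable_on UNIV"
    by (rule iffD1[OF summable_on_iff_abs_summable_on_real])
  also have "(\<lambda>x. norm (case x of (i, j) \<Rightarrow> t ^ i * t ^ j * C i j)) =
      (\<lambda>(i, j). t ^ i * t ^ j * cmod (of_real (C i j)))"
    using t by (auto simp: abs_mult fun_eq_iff)
  finally have sm: "(\<lambda>(i, j). t ^ i * t ^ j * cmod (of_real (C i j))) summable_on UNIV" .
  let ?F = "\<lambda>q. \<Sum>\<^sub>\<infinity>(i, j). (fst q - fst (cx a)) ^ i * (snd q - snd (cx a)) ^ j * complex_of_real (C i j)"
  have "?F (cx z) = of_real (f z)" if z: "z \<in> box2 a t" for z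
  proof -
    have "z \<in> box2 a (r / 2)" using z t by (simp add: box2_iff)
    then have "z \<in> ball a r" using box2_subset_ball by blast
    from has_sum_of_real[OF C[OF this], where 'a = complex]
    have "((\<lambda>(i, j). (fst (cx z) - fst (cx a)) ^ i * (snd (cx z) - snd (cx a)) ^ j * complex_of_real (C i j))
        has_sum of_real (f z)) UNIV"
      by (simp add: case_prod_unfold)
    then show ?thesis by (rule infsumI)
  qed
  then show "real_analytic_at f a"
    unfolding real_analytic_at_def using hol2_of_power_series(1)[OF sm, of "cx a"] t(1) by (intro exI[of _ ?F] exI[of _ t]) auto
next
  assume real_analytic_at: "\<forall>a\<in>S. real_analytic_at f a"
  show "real_analytic_on f S"
    unfolding real_analytic_on_def
  proof
    fix a assume "a \<in> S"
    then obtain F e where F: "e > 0" "hol2 F (bidisc (cx a) e)" "\<And>z. z \<in> box2 a e \<Longrightarrow> F (cx z) = of_real (f z)"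
      using real_analytic_at real_analytic_atE by metis
    obtain C where C: "\<And>z w. (z, w) \<in> bidisc (cx a) (e/2) \<Longrightarrow>
      ((\<lambda>(i, j). (z - fst (cx a)) ^ i * (w - snd (cx a)) ^ j * C i j) has_sum F (z, w)) UNIV"
      using hol2_power_series[OF F(2,1)] by blast
    have "((\<lambda>(i, j). ((z$1 - a$1) ^ i * (z$2 - a$2) ^ j) *\<^sub>R Re (C i j)) has_sum f z) UNIV"
      if z: "z \<in> ball a (e/2)" for z
    proof -
      have zb: "z \<in> box2 a (e/2)" using z ball_subset_box2 by blast
      then have cz: "(fst (cx z), snd (cx z)) \<in> bidisc (cx a) (e/2)" by (simp only: box2_def prod.collapse mem_Collect_eq)
      have "((\<lambda>x. Re (case x of (i, j) \<Rightarrow> (fst (cx z) - fst (cx a)) ^ i * (snd (cx z) - snd (cx a)) ^ j * C i j))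
          has_sum Re (F (cx z))) UNIV"
        using has_sum_Re[OF C[OF cz]] unfolding prod.collapse .
      moreover have "Re ((of_real x - of_real x') ^ i * (of_real y - of_real y') ^ j * c) =
          (x - x') ^ i * (y - y') ^ j * Re c" for x x' y y' i j c
        by (simp flip: of_real_diff of_real_power of_real_mult)
      moreover have "F (cx z) = of_real (f z)"
        by (rule F(3)) (use zb F(1) in \<open>auto simp: box2_iff\<close>)
      ultimately show ?thesis by (simp add: case_prod_unfold)
    qed
    then show "\<exists>C r. 0 < r \<and> (\<forall>z\<in>ball a r.
         ((\<lambda>(i, j). ((z $ 1 - a $ 1) ^ i * (z $ 2 - a $ 2) ^ j) *\<^sub>R C i j) has_sum f z) UNIV)"
      using F(1) by (intro exI[of _ "\<lambda>i j. Re (C i j)"] exI[of _ "e/2"]) auto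
  qed
qed

lemma real_analytic_on_const: "real_analytic_on (\<lambda>z. c) S"
  unfolding real_analytic_on_def
proof
  fix a :: "real^2"
  have "((\<lambda>(i, j). ((z $ 1 - a $ 1) ^ i * (z $ 2 - a $ 2) ^ j) *\<^sub>R (if i = 0 \<and> j = 0 then c else 0)) has_sum c) UNIV"
    for z :: "real^2"
  proof -
    have "((\<lambda>(i, j). ((z $ 1 - a $ 1) ^ i * (z $ 2 - a $ 2) ^ j) *\<^sub>R (if i = 0 \<and> j = 0 then c else 0)) has_sum c) {(0, 0)}"
      by (rule has_sum_finiteI) auto
    then show ?thesis by (rule has_sum_cong_neutral[THEN iffD1, rotated -1]) (auto split: if_splits)
  qed
  then show "\<exists>C r. 0 < r \<and> (\<forall>z\<in>ball a r.
         ((\<lambda>(i, j). ((z $ 1 - a $ 1) ^ i * (z $ 2 - a $ 2) ^ j) *\<^sub>R C i j) has_sum c) UNIV)"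
    by (intro exI[of _ "\<lambda>i j. if i = 0 \<and> j = 0 then c else 0"] exI[of _ 1]) auto
qed

lemma real_analytic_on_bounded_linear:
  assumes "bounded_linear h" "real_analytic_on f S"
  shows "real_analytic_on (\<lambda>z. h (f z)) S"
  unfolding real_analytic_on_def
proof
  fix a assume "a \<in> S"
  then obtain C r where r: "r > 0" and C: "\<And>z. z \<in> ball a r \<Longrightarrow>
      ((\<lambda>(i, j). ((z$1 - a$1) ^ i * (z$2 - a$2) ^ j) *\<^sub>R C i j) has_sum f z) UNIV"
    using assms(2) unfolding real_analytic_on_def by blast
  have "((\<lambda>(i, j). ((z$1 - a$1) ^ i * (z$2 - a$2) ^ j) *\<^sub>R h (C i j)) has_sum h (f z)) UNIV"
    if "z \<in> ball a r" for z
    using has_sum_bounded_linear[OF assms(1) C[OF that]]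
    by (simp add: case_prod_unfold linear_simps(5)[OF assms(1)])
  then show "\<exists>C r. 0 < r \<and> (\<forall>z\<in>ball a r.
         ((\<lambda>(i, j). ((z $ 1 - a $ 1) ^ i * (z $ 2 - a $ 2) ^ j) *\<^sub>R C i j) has_sum h (f z)) UNIV)"
    using r by (intro exI[of _ "\<lambda>i j. h (C i j)"] exI[of _ r]) auto
qed

lemma real_analytic_on_vec2:
  fixes f :: "real^2 \<Rightarrow> real^2"
  shows "real_analytic_on f S \<longleftrightarrow> (\<forall>a\<in>S. real_analytic_at (\<lambda>z. f z $ 1) a \<and> real_analytic_at (\<lambda>z. f z $ 2) a)"
proof
  assume "real_analytic_on f S"
  from real_analytic_on_bounded_linear[OF bounded_linear_vec_nth this]
  show "\<forall>a\<in>S. real_analytic_at (\<lambda>z. f z $ 1) a \<and> real_analytic_at (\<lambda>z. f z $ 2) a"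
    unfolding real_analytic_on_iff_at by blast
next
  assume "\<forall>a\<in>S. real_analytic_at (\<lambda>z. f z $ 1) a \<and> real_analytic_at (\<lambda>z. f z $ 2) a"
  then have f: "real_analytic_on (\<lambda>z. f z $ 1) S" "real_analytic_on (\<lambda>z. f z $ 2) S"
    by (auto simp: real_analytic_on_iff_at)
  show "real_analytic_on f S"
    unfolding real_analytic_on_def
  proof
    fix a assume a: "a \<in> S"
    obtain C r where r: "r > 0" and C: "\<And>z. z \<in> ball a r \<Longrightarrow>
        ((\<lambda>(i, j). ((z$1 - a$1) ^ i * (z$2 - a$2) ^ j) *\<^sub>R C i j) has_sum f z $ 1) UNIV"
      using f(1) a unfolding real_analytic_on_def by blast
    obtain C' r' where r': "r' > 0" and C': "\<And>z. z \<in> ball a r' \<Longrightarrow>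
        ((\<lambda>(i, j). ((z$1 - a$1) ^ i * (z$2 - a$2) ^ j) *\<^sub>R C' i j) has_sum f z $ 2) UNIV"
      using f(2) a unfolding real_analytic_on_def by blast
    have "((\<lambda>(i, j). ((z$1 - a$1) ^ i * (z$2 - a$2) ^ j) *\<^sub>R vec2 (C i j) (C' i j)) has_sum f z) UNIV"
      if z: "z \<in> ball a (min r r')" for z
      unfolding has_sum_def
    proof (rule vec_tendstoI)
      fix k :: 2
      have "((\<lambda>x. (case x of (i, j) \<Rightarrow> ((z$1 - a$1) ^ i * (z$2 - a$2) ^ j) *\<^sub>R vec2 (C i j) (C' i j)) $ k) has_sum f z $ k) UNIV"
        using C[of z] C'[of z] z exhaust_2[of k] by (auto simp: case_prod_unfold)
      then show "((\<lambda>X. (\<Sum>x\<in>X. case x of (i, j) \<Rightarrow> ((z$1 - a$1) ^ i * (z$2 - a$2) ^ j) *\<^sub>R vec2 (C i j) (C' i j)) $ k)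
          \<longlongrightarrow> f z $ k) (finite_subsets_at_top UNIV)"
        by (simp add: has_sum_def sum_component)
    qed
    then show "\<exists>C r. 0 < r \<and> (\<forall>z\<in>ball a r.
         ((\<lambda>(i, j). ((z $ 1 - a $ 1) ^ i * (z $ 2 - a $ 2) ^ j) *\<^sub>R C i j) has_sum f z) UNIV)"
      using r r' by (intro exI[of _ "\<lambda>i j. vec2 (C i j) (C' i j)"] exI[of _ "min r r'"]) auto
  qed
qed

section \<open>Primitives, division and equations along the x-lines\<close>

lemma real_at_reals_extension:
  assumes "\<And>z. z \<in> box2 0 e \<Longrightarrow> F (cx z) = of_real (f z)"
  shows "real_at_reals F (bidisc 0 e)"
  unfolding real_at_reals_def using assms[of "vec2 x y" for x y] by (auto simp: box2_def cx_vec2)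

lemma extension_real_at_reals:
  assumes "real_at_reals F (bidisc 0 e)" "z \<in> box2 0 e"
  shows "F (cx z) = of_real (Re (F (cx z)))"
proof -
  have "F (cx z) \<in> \<real>"
    using assms unfolding real_at_reals_def box2_def cx_0 mem_Collect_eq unfolding cx_def by blast
  then show ?thesis by simp
qed

lemma real_at_reals_c1:
  assumes F: "hol2 F (bidisc 0 e)" and r: "real_at_reals F (bidisc 0 e)"
  shows "real_at_reals (c1 F) (bidisc 0 e)"
proof (rule real_at_reals_extension)
  show "c1 F (cx z) = of_real (D1 (\<lambda>z. Re (F (cx z))) z)" if "z \<in> box2 0 e" for z
    by (rule extension_derivative(2)[of F 0 e]) (use F extension_real_at_reals[OF r] that in auto)
qed

lemma analytic_at_0E:
  assumes "real_analytic_at f 0"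
  obtains F e where "e > 0" "hol2 F (bidisc 0 e)" "real_at_reals F (bidisc 0 e)"
    "\<And>z. z \<in> box2 0 e \<Longrightarrow> F (cx z) = of_real (f z)"
proof -
  obtain F e where F: "e > 0" "hol2 F (bidisc (cx 0) e)" "\<And>z. z \<in> box2 0 e \<Longrightarrow> F (cx z) = of_real (f z)"
    by (rule real_analytic_atE[OF assms]) blast
  show ?thesis using that[of e F] F real_at_reals_extension[of e F f, OF F(3)] by simp
qed

lemma analytic_at_0I:
  assumes "e > 0" "hol2 F (bidisc 0 e)" "real_at_reals F (bidisc 0 e)"
  shows "real_analytic_at (\<lambda>z. Re (F (cx z))) 0"
  unfolding real_analytic_at_def using assms extension_real_at_reals[OF assms(3)]
  by (intro exI[of _ F] exI[of _ e]) auto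

lemma analytic_primitive:
  assumes "real_analytic_at g 0"
  obtains H where "real_analytic_at H 0" "\<forall>\<^sub>F z in nhds 0. D1 H z = g z" "\<And>y. H (vec2 0 y) = 0"
proof -
  obtain F e where F: "e > 0" "hol2 F (bidisc 0 e)" "real_at_reals F (bidisc 0 e)"
    "\<And>z. z \<in> box2 0 e \<Longrightarrow> F (cx z) = of_real (g z)" using analytic_at_0E[OF assms] by blast
  note P = hol2_prim1[OF F(2)] real_at_reals_prim1[OF F(2,3)]
  let ?H = "\<lambda>z. Re (prim1 F (cx z))"
  have "D1 ?H z = g z" if z: "z \<in> box2 0 e" for z
  proof -
    have "c1 (prim1 F) (cx z) = of_real (D1 ?H z)"
      by (rule extension_derivative(2)[of _ 0 e]) (use P z extension_real_at_reals[OF P(2)] in auto)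
    moreover have "c1 (prim1 F) (cx z) = F (cx z)"
      by (rule c1_prim1[OF F(2)]) (use z in \<open>simp add: box2_def\<close>)
    ultimately show ?thesis using F(4)[OF z] by simp
  qed
  then have "\<forall>\<^sub>F z in nhds 0. D1 ?H z = g z" unfolding eventually_box2 using F(1) by blast
  moreover have "?H (vec2 0 y) = 0" for y by (simp add: cx_vec2)
  ultimately show ?thesis using that[of ?H] analytic_at_0I[OF F(1) P] by blast
qed

lemma D1_zero_const:
  assumes "real_analytic_at f 0" "\<forall>\<^sub>F z in nhds 0. D1 f z = 0"
  shows "\<forall>\<^sub>F z in nhds 0. f z = f (vec2 0 (z $ 2))"
proof -
  have "\<forall>\<^sub>F z in nhds 0. real_analytic_at f z \<and> D1 f z = 0"
    using analytic_eventually[OF assms(1)] assms(2) by eventually_elim simp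
  then obtain e where e: "e > 0" "\<And>z. z \<in> box2 0 e \<Longrightarrow> real_analytic_at f z \<and> D1 f z = 0"
    unfolding eventually_box2 by blast
  have "f z = f (vec2 0 (z $ 2))" if z: "z \<in> box2 0 e" for z
  proof -
    have "((\<lambda>t. f (vec2 t (z $ 2))) has_field_derivative 0) (at t within {-e<..<e})" if "t \<in> {-e<..<e}" for t
    proof -
      have "vec2 t (z $ 2) \<in> box2 0 e" using that z by (auto simp: box2_iff)
      with e(2) DERIV_D1[of f "vec2 t (z $ 2)"] show ?thesis
        by (auto intro: has_field_derivative_at_within)
    qed
    then obtain c where "\<And>t. t \<in> {-e<..<e} \<Longrightarrow> f (vec2 t (z $ 2)) = c"
      using has_field_derivative_zero_constant[of "{-e<..<e}" "\<lambda>t. f (vec2 t (z $ 2))"] by auto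
    from this[of "z $ 1"] this[of 0] show ?thesis using z e(1) by (simp add: box2_iff abs_less_iff)
  qed
  then show ?thesis unfolding eventually_box2 using e(1) by blast
qed

text \<open>With a primitive K of k, the product w exp(-K) is constant on y = 0. This is the tool
  that turns "not identically zero on the axis" into "nonzero at the origin". Although only the
  first coordinate of z enters, z ranges over the plane, so that statements about the axis share one
  filter with all others.\<close>

lemma linear_ode_zero:
  assumes w: "real_analytic_at w 0" and k: "real_analytic_at k 0" and "w 0 = 0"
    and ode: "\<forall>\<^sub>F z::real^2 in nhds 0. D1 w (vec2 (z $ 1) 0) = k (vec2 (z $ 1) 0) * w (vec2 (z $ 1) 0)"
  shows "\<forall>\<^sub>F z::real^2 in nhds 0. w (vec2 (z $ 1) 0) = 0"
proof -
  obtain K where K: "real_analytic_at K 0" "\<forall>\<^sub>F z in nhds 0. D1 K z = k z"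
    using analytic_primitive[OF k] by blast
  have "\<forall>\<^sub>F z in nhds 0. real_analytic_at w z \<and> real_analytic_at K z \<and> D1 K z = k z \<and>
      D1 w (vec2 (z $ 1) 0) = k (vec2 (z $ 1) 0) * w (vec2 (z $ 1) 0)"
    using analytic_eventually[OF w] analytic_eventually[OF K(1)] K(2) ode by eventually_elim simp
  then obtain e where e: "e > 0" "\<And>z. z \<in> box2 0 e \<Longrightarrow> real_analytic_at w z \<and> real_analytic_at K z \<and> D1 K z = k z \<and>
      D1 w (vec2 (z $ 1) 0) = k (vec2 (z $ 1) 0) * w (vec2 (z $ 1) 0)"
    unfolding eventually_box2 by blast
  have "((\<lambda>t. w (vec2 t 0) * exp (- K (vec2 t 0))) has_field_derivative 0) (at t within {-e<..<e})"
    if "t \<in> {-e<..<e}" for t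
  proof -
    have "vec2 t 0 \<in> box2 0 e" using that e(1) by (auto simp: box2_iff)
    from e(2)[OF this] DERIV_D1[of w "vec2 t 0"] DERIV_D1[of K "vec2 t 0"]
    have "((\<lambda>t. w (vec2 t 0)) has_field_derivative k (vec2 t 0) * w (vec2 t 0)) (at t)"
      "((\<lambda>t. K (vec2 t 0)) has_field_derivative k (vec2 t 0)) (at t)" by auto
    then have "((\<lambda>t. w (vec2 t 0) * exp (- K (vec2 t 0))) has_field_derivative 0) (at t)"
      by (auto intro!: derivative_eq_intros)
    then show ?thesis by (rule has_field_derivative_at_within)
  qed
  then obtain c where c: "\<And>t. t \<in> {-e<..<e} \<Longrightarrow> w (vec2 t 0) * exp (- K (vec2 t 0)) = c"
    using has_field_derivative_zero_constant[of "{-e<..<e}" "\<lambda>t. w (vec2 t 0) * exp (- K (vec2 t 0))"] by auto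
  have "c = 0" using c[of 0] e(1) \<open>w 0 = 0\<close> by simp
  then have "w (vec2 (z $ 1) 0) = 0" if "z \<in> box2 0 e" for z
    using c[of "z $ 1"] that by (simp add: box2_iff abs_less_iff)
  then show ?thesis unfolding eventually_box2 using e(1) by blast
qed

text \<open>Off y = 0 the power cancels; on y = 0 both functions are limits along the vertical
  line.\<close>

lemma cancel_power_y:
  assumes f: "real_analytic_at f 0" and g: "real_analytic_at g 0" and eq: "\<forall>\<^sub>F z in nhds 0. (z $ 2) ^ n * f z = (z $ 2) ^ n * g z"
  shows "\<forall>\<^sub>F z in nhds 0. f z = g z"
proof -
  have "\<forall>\<^sub>F z in nhds 0. real_analytic_at f z \<and> real_analytic_at g z \<and> (z $ 2) ^ n * f z = (z $ 2) ^ n * g z"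
    using analytic_eventually[OF f] analytic_eventually[OF g] eq by eventually_elim simp
  then obtain e where e: "e > 0" "\<And>z. z \<in> box2 0 e \<Longrightarrow> real_analytic_at f z \<and> real_analytic_at g z \<and> (z $ 2) ^ n * f z = (z $ 2) ^ n * g z"
    unfolding eventually_box2 by blast
  have "f z = g z" if z: "z \<in> box2 0 e" for z
  proof (cases "z $ 2 = 0")
    case False
    then show ?thesis using e(2)[OF z] by simp
  next
    case True
    have "isCont (\<lambda>t. f (vec2 (z $ 1) t)) 0" "isCont (\<lambda>t. g (vec2 (z $ 1) t)) 0"
      using DERIV_isCont[OF DERIV_D2] e(2)[OF z] True by metis+
    then have "((\<lambda>t. f (vec2 (z $ 1) t) - g (vec2 (z $ 1) t)) \<longlongrightarrow> f (vec2 (z $ 1) 0) - g (vec2 (z $ 1) 0)) (at 0)"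
      by (intro tendsto_diff) (auto simp: isCont_def)
    moreover have "\<forall>\<^sub>F t in at 0. f (vec2 (z $ 1) t) - g (vec2 (z $ 1) t) = 0"
      unfolding eventually_at
    proof (intro exI[of _ e] conjI ballI impI)
      fix t :: real assume t: "t \<noteq> 0 \<and> dist t 0 < e"
      then have "vec2 (z $ 1) t \<in> box2 0 e" using z by (auto simp: box2_iff)
      from e(2)[OF this] t show "f (vec2 (z $ 1) t) - g (vec2 (z $ 1) t) = 0" by simp
    qed (rule e)
    ultimately have "f (vec2 (z $ 1) 0) - g (vec2 (z $ 1) 0) = 0"
      using tendsto_unique[OF at_neq_bot _ tendsto_eventually] by blast
    then show ?thesis using True vec2_eta[of z] by simp
  qed
  then show ?thesis unfolding eventually_box2 using e(1) by blast
qed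

lemma analytic_hadamard1:
  assumes "real_analytic_at f 0"
  obtains g where "real_analytic_at g 0" "\<forall>\<^sub>F z in nhds 0. f z = f (vec2 0 (z $ 2)) + z $ 1 * g z"
proof -
  obtain F e where F: "e > 0" "hol2 F (bidisc 0 e)" "real_at_reals F (bidisc 0 e)"
    "\<And>z. z \<in> box2 0 e \<Longrightarrow> F (cx z) = of_real (f z)" using analytic_at_0E[OF assms] by blast
  note A = hol2_avg1[OF hol2_c1[OF open_bidisc F(2)]]
    real_at_reals_avg1[OF hol2_c1[OF open_bidisc F(2)] real_at_reals_c1[OF F(2,3)]]
  let ?g = "\<lambda>z. Re (avg1 (c1 F) (cx z))"
  have "f z = f (vec2 0 (z $ 2)) + z $ 1 * ?g z" if z: "z \<in> box2 0 e" for z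
  proof -
    have z0: "vec2 0 (z $ 2) \<in> box2 0 e" using z F(1) by (auto simp: box2_iff)
    have "F (cx z) = F (0, snd (cx z)) + fst (cx z) * avg1 (c1 F) (cx z)"
      by (rule hadamard1[OF F(2)]) (use z in \<open>simp add: box2_def\<close>)
    also have "F (0, snd (cx z)) = of_real (f (vec2 0 (z $ 2)))"
      using F(4)[OF z0] by (simp add: cx_vec2)
    finally have "complex_of_real (f z) = of_real (f (vec2 0 (z $ 2))) + of_real (z $ 1) * avg1 (c1 F) (cx z)"
      using F(4)[OF z] by simp
    then show ?thesis by (simp add: complex_eq_iff)
  qed
  then have "\<forall>\<^sub>F z in nhds 0. f z = f (vec2 0 (z $ 2)) + z $ 1 * ?g z"
    unfolding eventually_box2 using F(1) by blast
  then show ?thesis using that[of ?g] analytic_at_0I[OF F(1) A] by blast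
qed

section \<open>Order of vanishing and Taylor expansion\<close>

lemma holomorphic_zero_from_reals:
  assumes "k holomorphic_on ball 0 r" "e > 0" "r > 0" "\<And>y::real. \<bar>y\<bar> < e \<Longrightarrow> k (of_real y) = 0" "cmod w < r"
  shows "k w = 0"
proof -
  define d where "d = min e r"
  have d: "d > 0" using assms by (simp add: d_def)
  let ?U = "complex_of_real ` {-d<..<d}"
  show ?thesis
  proof (rule analytic_continuation[OF assms(1), of ?U 0])
    show "0 islimpt ?U"
      unfolding islimpt_sequential
    proof (intro exI[of _ "\<lambda>n::nat. complex_of_real (d / (real n + 2))"] conjI allI)
      fix n
      have "0 < d / (real n + 2)" "d / (real n + 2) < d" using d by (simp_all add: divide_simps)
      then have "complex_of_real (d / (real n + 2)) \<noteq> 0" "d / (real n + 2) \<in> {-d<..<d}"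
        unfolding of_real_eq_0_iff greaterThanLessThan_iff using d by linarith+
      then show "complex_of_real (d / (real n + 2)) \<in> ?U - {0}" by blast
    next
      have "(\<lambda>n::nat. d / (real n + 2)) \<longlonglongrightarrow> 0" by real_asymp
      then show "(\<lambda>n::nat. complex_of_real (d / (real n + 2))) \<longlonglongrightarrow> 0"
        using tendsto_of_real_iff[of _ 0 sequentially] by force
    qed
  qed (use assms d in \<open>auto simp: d_def\<close>)
qed

text \<open>As long as a quotient vanishes for first coordinate z = 0, it can be divided by z once
  more. If this never ended, F would be divisible by every power of z. But on the slice through
  \<open>p0\<close> it is a nonzero holomorphic function with a zero of finite order n, which
  contradicts divisibility by z^(n+1).\<close>

lemma hol2_order:
  assumes F: "hol2 F (bidisc 0 r)" and p0: "p0 \<in> bidisc 0 r" "F p0 \<noteq> 0"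
  shows "\<exists>n w. cmod w < r \<and> ((\<lambda>G. avg1 (c1 G)) ^^ n) F (0, w) \<noteq> 0"
proof (rule ccontr)
  define G where "G = (\<lambda>n. ((\<lambda>G. avg1 (c1 G)) ^^ n) F)"
  assume "\<not> (\<exists>n w. cmod w < r \<and> ((\<lambda>G. avg1 (c1 G)) ^^ n) F (0, w) \<noteq> 0)"
  then have G0: "G n (0, w) = 0" if "cmod w < r" for n w using that by (auto simp: G_def)
  have G_Suc: "G (Suc n) = avg1 (c1 (G n))" for n by (simp add: G_def)
  have hG: "hol2 (G n) (bidisc 0 r)" for n
  proof (induction n)
    case 0
    then show ?case using F by (simp add: G_def)
  next
    case (Suc n)
    then show ?case unfolding G_Suc by (intro hol2_avg1 hol2_c1 open_bidisc)
  qed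
  have FG: "F p = fst p ^ n * G n p" if p: "p \<in> bidisc 0 r" for p n
  proof (induction n)
    case 0
    then show ?case by (simp add: G_def)
  next
    case (Suc n)
    have "G n p = fst p * G (Suc n) p"
      using hadamard1[OF hG p, of n] G0[of "snd p" n] p by (simp add: bidisc_0_iff G_Suc)
    then show ?case using Suc by simp
  qed
  obtain z0 w0 where zw: "p0 = (z0, w0)" by (cases p0)
  have zr: "cmod z0 < r" "cmod w0 < r" using p0 zw by (auto simp: bidisc_0_iff)
  have "0 < r" using le_less_trans[OF norm_ge_zero zr(1)] .
  define g where "g = (\<lambda>z. F (z, w0))"
  have g: "g holomorphic_on ball 0 r"
    unfolding g_def by (rule hol2_holo1[OF F]) (use zr in \<open>auto simp: bidisc_0_iff\<close>)
  have g0: "g 0 = 0" using G0[of w0 0] zr by (simp add: G_def g_def)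
  have nc: "\<not> g constant_on ball 0 r"
  proof
    assume "g constant_on ball 0 r"
    then obtain y where y: "\<And>x. x \<in> ball 0 r \<Longrightarrow> g x = y" unfolding constant_on_def by blast
    have "z0 \<in> ball 0 r" "0 \<in> ball (0::complex) r" using zr \<open>0 < r\<close> by auto
    then have "g z0 = g 0" using y by simp
    then show False using g0 p0 zw by (simp add: g_def)
  qed
  have c0: "0 \<in> ball (0::complex) r" using \<open>0 < r\<close> by simp
  have "\<exists>h s n. 0 < (n::nat) \<and> 0 < s \<and> ball (0::complex) s \<subseteq> ball 0 r \<and> h holomorphic_on ball (0::complex) s \<and>
      (\<forall>w\<in>ball 0 s. g w = (w - 0) ^ n * h w \<and> h w \<noteq> 0)"
  proof (rule holomorphic_factor_zero_nonconstant[OF g open_ball connected_ball c0 g0 nc])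
    fix h s n
    assume "0 < (n::nat)" "0 < s" "ball (0::complex) s \<subseteq> ball 0 r" "h holomorphic_on ball (0::complex) s"
      "\<And>w. w \<in> ball 0 s \<Longrightarrow> g w = (w - 0) ^ n * h w" "\<And>w. w \<in> ball 0 s \<Longrightarrow> h w \<noteq> 0"
    then show ?thesis by (intro exI[of _ h] exI[of _ s] exI[of _ n] conjI ballI)
  qed
  then obtain h s n where h: "0 < (n::nat)" "0 < s" "ball (0::complex) s \<subseteq> ball 0 r" "h holomorphic_on ball (0::complex) s"
      "\<And>w. w \<in> ball 0 s \<Longrightarrow> g w = (w - 0) ^ n * h w" "\<And>w. w \<in> ball 0 s \<Longrightarrow> h w \<noteq> 0"
    by blast
  have k: "(\<lambda>z. z * G (Suc n) (z, w0)) holomorphic_on ball 0 r"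
    by (intro holomorphic_intros hol2_holo1[OF hG]) (use zr in \<open>auto simp: bidisc_0_iff\<close>)
  have "isCont h 0"
    using holomorphic_on_imp_continuous_on[OF h(4)] h(2) by (simp add: continuous_on_eq_continuous_at)
  moreover have "isCont (\<lambda>z. z * G (Suc n) (z, w0)) 0"
    using holomorphic_on_imp_continuous_on[OF k] \<open>0 < r\<close> by (simp add: continuous_on_eq_continuous_at)
  ultimately have "((\<lambda>z. h z - z * G (Suc n) (z, w0)) \<longlongrightarrow> h 0 - 0 * G (Suc n) (0, w0)) (at 0)"
    unfolding isCont_def by (rule tendsto_diff)
  moreover have "\<forall>\<^sub>F z in at 0. h z - z * G (Suc n) (z, w0) = 0"
    unfolding eventually_at
  proof (intro exI[of _ s] conjI ballI impI)
    fix z :: complex assume z: "z \<noteq> 0 \<and> dist z 0 < s"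
    then have "z \<in> ball 0 s" by simp
    have "z \<in> ball 0 r" using h(3) \<open>z \<in> ball 0 s\<close> by blast
    then have "g z = z ^ Suc n * G (Suc n) (z, w0)"
      using FG[of "(z, w0)" "Suc n"] zr by (simp add: g_def bidisc_0_iff)
    then have "z ^ n * h z = z ^ n * (z * G (Suc n) (z, w0))"
      using h(5)[OF \<open>z \<in> ball 0 s\<close>] by simp
    then show "h z - z * G (Suc n) (z, w0) = 0" using z by simp
  qed (rule h)
  ultimately have "h 0 = 0"
    using tendsto_unique[OF at_neq_bot _ tendsto_eventually] by fastforce
  then show False using h(2) h(6)[of 0] by simp
qed

text \<open>The exponent n is the least number of divisions by x after which the quotient is not
  identically zero on x = 0. The quotient may still vanish at the origin.\<close>

lemma analytic_order_x:
  assumes f: "real_analytic_at f 0" and nz: "\<not> (\<forall>\<^sub>F z in nhds 0. f z = 0)"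
  obtains n w where "real_analytic_at w 0" "\<forall>\<^sub>F z in nhds 0. f z = (z $ 1) ^ n * w z"
    "\<not> (\<forall>\<^sub>F z::real^2 in nhds 0. w (vec2 0 (z $ 2)) = 0)"
proof -
  obtain F e where F: "e > 0" "hol2 F (bidisc 0 e)" "real_at_reals F (bidisc 0 e)"
    "\<And>z. z \<in> box2 0 e \<Longrightarrow> F (cx z) = of_real (f z)" using analytic_at_0E[OF f] by blast
  define G where "G = (\<lambda>n. ((\<lambda>G. avg1 (c1 G)) ^^ n) F)"
  define w where "w = (\<lambda>n z. Re (G n (cx z)))"
  have G_Suc: "G (Suc n) = avg1 (c1 (G n))" for n by (simp add: G_def)
  have hG: "hol2 (G n) (bidisc 0 e) \<and> real_at_reals (G n) (bidisc 0 e)" for n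
  proof (induction n)
    case 0
    then show ?case using F by (simp add: G_def)
  next
    case (Suc n)
    then show ?case unfolding G_Suc
      by (intro conjI hol2_avg1 hol2_c1 open_bidisc real_at_reals_avg1 real_at_reals_c1) auto
  qed
  have Gw: "G n (cx z) = of_real (w n z)" if "z \<in> box2 0 e" for n z
    using extension_real_at_reals[OF _ that, of "G n"] hG by (simp add: w_def)
  obtain z0 where z0: "z0 \<in> box2 0 e" "f z0 \<noteq> 0"
    using nz F(1) unfolding eventually_box2 by blast
  have "\<exists>n w. cmod w < e \<and> G n (0, w) \<noteq> 0"
    unfolding G_def by (rule hol2_order[OF F(2), of "cx z0"]) (use z0 F(4) in \<open>auto simp: box2_def\<close>)
  then obtain m u where m: "cmod u < e" "G m (0, u) \<noteq> 0" by blast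
  define P where "P = (\<lambda>n. \<not> (\<forall>\<^sub>F z::real^2 in nhds 0. w n (vec2 0 (z $ 2)) = 0))"
  \<comment> \<open>By the identity theorem in one variable, a nonzero value at some complex point
    of the axis shows up at real points arbitrarily near 0.\<close>
  have "P m"
    unfolding P_def
  proof
    assume "\<forall>\<^sub>F z::real^2 in nhds 0. w m (vec2 0 (z $ 2)) = 0"
    then obtain d where d: "d > 0" "\<And>z::real^2. z \<in> box2 0 d \<Longrightarrow> w m (vec2 0 (z $ 2)) = 0"
      unfolding eventually_box2 by blast
    have "G m (0, u) = 0"
    proof (rule holomorphic_zero_from_reals[where k = "\<lambda>u. G m (0, u)" and r = e and e = "min d e"])
      show "(\<lambda>u. G m (0, u)) holomorphic_on ball 0 e"
        by (rule hol2_holo2) (use hG F(1) in \<open>auto simp: bidisc_0_iff\<close>)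
      show "G m (0, of_real y) = 0" if "\<bar>y\<bar> < min d e" for y
      proof -
        have "vec2 0 y \<in> box2 0 e" "vec2 0 y \<in> box2 0 d" using that d(1) F(1) by (auto simp: box2_iff)
        then show ?thesis using Gw[of "vec2 0 y" m] d(2)[of "vec2 0 y"] by (simp add: cx_vec2)
      qed
    qed (use F d m in auto)
    then show False using m by simp
  qed
  define n where "n = (LEAST n. P n)"
  have n: "P n" "k < n \<Longrightarrow> \<not> P k" for k
    unfolding n_def by (rule LeastI[of P, OF \<open>P m\<close>], rule not_less_Least)
  have fact: "\<forall>\<^sub>F z in nhds 0. f z = (z $ 1) ^ k * w k z" if "k \<le> n" for k
    using that
  proof (induction k)
    case 0
    show ?case unfolding eventually_box2
      by (intro exI[of _ e]) (use F in \<open>auto simp: w_def G_def\<close>)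
  next
    case (Suc k)
    have "\<forall>\<^sub>F z::real^2 in nhds 0. w k (vec2 0 (z $ 2)) = 0" using n(2)[of k] Suc.prems by (auto simp: P_def)
    moreover have "\<forall>\<^sub>F z in nhds 0. f z = (z $ 1) ^ k * w k z" using Suc by simp
    moreover have "\<forall>\<^sub>F z in nhds 0. z \<in> box2 0 e" using F(1) by (rule eventually_box2_in)
    ultimately show ?case
    proof eventually_elim
      case (elim z)
      have z0: "vec2 0 (z $ 2) \<in> box2 0 e" using elim F(1) by (auto simp: box2_iff)
      have "G k (cx z) = G k (0, snd (cx z)) + fst (cx z) * avg1 (c1 (G k)) (cx z)"
        by (rule hadamard1) (use hG elim in \<open>auto simp: box2_def\<close>)
      also have "G k (0, snd (cx z)) = 0" using Gw[OF z0, of k] elim by (simp add: cx_vec2)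
      also have "avg1 (c1 (G k)) (cx z) = of_real (w (Suc k) z)"
        using Gw[of z "Suc k"] elim by (simp add: G_Suc)
      finally have "complex_of_real (w k z) = of_real (z $ 1 * w (Suc k) z)"
        using Gw[of z k] elim by simp
      then have "w k z = z $ 1 * w (Suc k) z" by (simp only: of_real_eq_iff)
      then show ?case using elim by simp
    qed
  qed
  have "real_analytic_at (w n) 0" unfolding w_def using analytic_at_0I[OF F(1)] hG by blast
  then show ?thesis using that[of "w n" n] fact[of n] n(1) by (simp add: P_def)
qed

lemma analytic_swap:
  assumes "real_analytic_at f 0" shows "real_analytic_at (\<lambda>z. f (vec2 (z $ 2) (z $ 1))) 0"
  by (rule analytic_compose) (use assms in auto)

lemma eventually_swap:
  assumes "\<forall>\<^sub>F z in nhds 0. P z" shows "\<forall>\<^sub>F z::real^2 in nhds 0. P (vec2 (z $ 2) (z $ 1))"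
  by (rule eventually_vec2_compose) (use assms in auto)

lemma analytic_order_y:
  assumes f: "real_analytic_at f 0" and nz: "\<not> (\<forall>\<^sub>F z in nhds 0. f z = 0)"
  obtains n w where "real_analytic_at w 0" "\<forall>\<^sub>F z in nhds 0. f z = (z $ 2) ^ n * w z"
    "\<not> (\<forall>\<^sub>F z::real^2 in nhds 0. w (vec2 (z $ 1) 0) = 0)"
proof -
  let ?s = "\<lambda>z::real^2. vec2 (z $ 2) (z $ 1)"
  have ss: "?s (?s z) = z" for z by simp
  have "\<not> (\<forall>\<^sub>F z in nhds 0. f (?s z) = 0)"
  proof
    assume "\<forall>\<^sub>F z in nhds 0. f (?s z) = 0"
    from eventually_swap[OF this] show False using nz by simp
  qed
  then obtain n w where w: "real_analytic_at w 0" "\<forall>\<^sub>F z in nhds 0. f (?s z) = (z $ 1) ^ n * w z"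
    "\<not> (\<forall>\<^sub>F z::real^2 in nhds 0. w (vec2 0 (z $ 2)) = 0)"
    using analytic_order_x[OF analytic_swap[OF f]] by blast
  show ?thesis
  proof (rule that[of "\<lambda>z. w (?s z)" n])
    show "real_analytic_at (\<lambda>z. w (?s z)) 0" by (rule analytic_swap[OF w(1)])
    show "\<forall>\<^sub>F z in nhds 0. f z = (z $ 2) ^ n * w (?s z)"
      using eventually_swap[OF w(2)] by simp
    show "\<not> (\<forall>\<^sub>F z::real^2 in nhds 0. w (?s (vec2 (z $ 1) 0)) = 0)"
      using w(3) eventually_swap[of "\<lambda>z::real^2. w (?s (vec2 (z $ 1) 0)) = 0"] by auto
  qed
qed

lemma analytic_hadamard_y:
  assumes f: "real_analytic_at f 0"
  obtains g where "real_analytic_at g 0" "\<forall>\<^sub>F z in nhds 0. f z = f (vec2 (z $ 1) 0) + z $ 2 * g z"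
proof -
  let ?s = "\<lambda>z::real^2. vec2 (z $ 2) (z $ 1)"
  obtain g where g: "real_analytic_at g 0" "\<forall>\<^sub>F z in nhds 0. f (?s z) = f (?s (vec2 0 (z $ 2))) + z $ 1 * g z"
    using analytic_hadamard1[OF analytic_swap[OF f]] by blast
  show ?thesis
    by (rule that[OF analytic_swap[OF g(1)]]) (use eventually_swap[OF g(2)] in simp)
qed

text \<open>The last clause makes the remainder a function of y alone; this allows it to be expanded
  again in the induction step.\<close>

lemma taylor_in_y:
  assumes f: "real_analytic_at f 0"
  obtains c g where "real_analytic_at g 0" "\<forall>\<^sub>F z::real^2 in nhds 0. f (vec2 0 (z $ 2)) = (\<Sum>i<n. c i * (z $ 2) ^ i) + (z $ 2) ^ n * g z"
    "\<And>z. g z = g (vec2 0 (z $ 2))"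
proof -
  have "\<exists>c g. real_analytic_at g 0 \<and> (\<forall>\<^sub>F z::real^2 in nhds 0. f (vec2 0 (z $ 2)) = (\<Sum>i<n. c i * (z $ 2) ^ i) + (z $ 2) ^ n * g z)
      \<and> (\<forall>z. g z = g (vec2 0 (z $ 2)))"
  proof (induction n)
    case 0
    have "real_analytic_at (\<lambda>z. f (vec2 0 (z $ 2))) 0" by (rule analytic_compose) (use f in auto)
    then show ?case by (intro exI[of _ "\<lambda>z. f (vec2 0 (z $ 2))"] exI[of _ "\<lambda>_. 0"]) auto
  next
    case (Suc n)
    then obtain c g where g: "real_analytic_at g 0"
      "\<forall>\<^sub>F z::real^2 in nhds 0. f (vec2 0 (z $ 2)) = (\<Sum>i<n. c i * (z $ 2) ^ i) + (z $ 2) ^ n * g z"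
      "\<And>z. g z = g (vec2 0 (z $ 2))" by blast
    obtain h where h: "real_analytic_at h 0" "\<forall>\<^sub>F z in nhds 0. g z = g (vec2 (z $ 1) 0) + z $ 2 * h z"
      using analytic_hadamard_y[OF g(1)] by blast
    have e: "\<forall>\<^sub>F z::real^2 in nhds 0. g (vec2 0 (z $ 2)) = g 0 + z $ 2 * h (vec2 0 (z $ 2))"
      using eventually_vec2_compose[of "\<lambda>_. 0" 0 "\<lambda>z. z $ 2" "\<lambda>z. g z = g (vec2 (z $ 1) 0) + z $ 2 * h z"] h(2)
      by simp
    have "real_analytic_at (\<lambda>z. h (vec2 0 (z $ 2))) 0" by (rule analytic_compose) (use h in auto)
    moreover have "\<forall>\<^sub>F z::real^2 in nhds 0. f (vec2 0 (z $ 2)) =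
        (\<Sum>i<Suc n. (c(n := g 0)) i * (z $ 2) ^ i) + (z $ 2) ^ Suc n * h (vec2 0 (z $ 2))"
      using g(2) e
    proof eventually_elim
      case (elim z)
      have "(\<Sum>i<n. (c(n := g 0)) i * (z $ 2) ^ i) = (\<Sum>i<n. c i * (z $ 2) ^ i)"
        by (rule sum.cong) auto
      moreover have "g z = g 0 + z $ 2 * h (vec2 0 (z $ 2))" using elim(2) g(3)[of z] by simp
      ultimately show ?case using elim(1) by (simp add: algebra_simps)
    qed
    ultimately show ?case by (intro exI[of _ "c(n := g 0)"] exI[of _ "\<lambda>z. h (vec2 0 (z $ 2))"]) auto
  qed
  then show ?thesis using that by blast
qed

lemma analytic_cauchy_problem:
  assumes f: "real_analytic_at f 0"
  obtains \<phi> where "real_analytic_at \<phi> 0" "\<forall>\<^sub>F z in nhds 0. D1 \<phi> z = f (vec2 (z $ 1) (\<phi> z))" "\<And>y. \<phi> (vec2 0 y) = y"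
proof -
  obtain F R where F: "R > 0" "hol2 F (bidisc 0 R)" "real_at_reals F (bidisc 0 R)"
    "\<And>z. z \<in> box2 0 R \<Longrightarrow> F (cx z) = of_real (f z)" using analytic_at_0E[OF f] by blast
  obtain \<phi> \<rho> where \<phi>: "\<rho> > 0" "\<rho> \<le> R" "hol2 \<phi> (bidisc 0 \<rho>)"
    "\<And>p. p \<in> bidisc 0 \<rho> \<Longrightarrow> cmod (\<phi> p) < R"
    "\<And>p. p \<in> bidisc 0 \<rho> \<Longrightarrow> c1 \<phi> p = F (fst p, \<phi> p)"
    "\<And>w. \<phi> (0, w) = w"
    "real_at_reals \<phi> (bidisc 0 \<rho>)"
    using hol2_cauchy_problem[OF F(2,1)] F(3) by (smt (verit))
  let ?p = "\<lambda>z. Re (\<phi> (cx z))"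
  have "D1 ?p z = f (vec2 (z $ 1) (?p z))" if z: "z \<in> box2 0 \<rho>" for z
  proof -
    have cz: "cx z \<in> bidisc 0 \<rho>" using z by (simp add: box2_def)
    have e: "\<phi> (cx z) = of_real (?p z)" by (rule extension_real_at_reals[OF \<phi>(7) z])
    have "\<bar>?p z\<bar> < R" using \<phi>(4)[OF cz] e by (metis norm_of_real)
    then have "vec2 (z $ 1) (?p z) \<in> box2 0 R" using z \<phi>(2) by (auto simp: box2_iff)
    from F(4)[OF this] have 1: "F (of_real (z $ 1), of_real (?p z)) = of_real (f (vec2 (z $ 1) (?p z)))"
      by (simp add: cx_vec2)
    have "c1 \<phi> (cx z) = of_real (D1 ?p z)"
      by (rule extension_derivative(2)[of \<phi> 0 \<rho>]) (use \<phi>(3) z extension_real_at_reals[OF \<phi>(7)] in auto)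
    moreover have "c1 \<phi> (cx z) = F (of_real (z $ 1), of_real (?p z))"
      using \<phi>(5)[OF cz] e by simp
    ultimately show ?thesis using 1 by (simp del: of_real_eq_iff add: of_real_eq_iff[where 'a = complex, symmetric])
  qed
  then have "\<forall>\<^sub>F z in nhds 0. D1 ?p z = f (vec2 (z $ 1) (?p z))"
    unfolding eventually_box2 using \<phi>(1) by blast
  moreover have "?p (vec2 0 y) = y" for y by (simp add: cx_vec2 \<phi>(6))
  ultimately show ?thesis using that[of ?p] analytic_at_0I[OF \<phi>(1,3,7)] by blast
qed

text \<open>The complex inverse is used only as a holomorphic extension. The real inverse exists
  already: G is injective on the real points of the complex domain, and by invariance of domain the
  image of an open set of such points is open.\<close>

lemma analytic_inverse_map:
  fixes G :: "real^2 \<Rightarrow> real^2"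
  assumes g: "real_analytic_at (\<lambda>z. G z $ 1) a" "real_analytic_at (\<lambda>z. G z $ 2) a" and N: "open N" "a \<in> N"
    and det: "D1 (\<lambda>z. G z $ 1) a * D2 (\<lambda>z. G z $ 2) a - D2 (\<lambda>z. G z $ 1) a * D1 (\<lambda>z. G z $ 2) a \<noteq> 0"
  obtains U V H where "open U" "a \<in> U" "U \<subseteq> N" "open V" "homeomorphism U V G H"
    "\<And>z i. z \<in> U \<Longrightarrow> real_analytic_at (\<lambda>z. G z $ i) z" "\<And>z i. z \<in> V \<Longrightarrow> real_analytic_at (\<lambda>z. H z $ i) z"
proof -
  obtain F1 e1 where F1: "e1 > 0" "hol2 F1 (bidisc (cx a) e1)"
    "\<And>z. z \<in> box2 a e1 \<Longrightarrow> F1 (cx z) = of_real (G z $ 1)"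
    "\<And>z. z \<in> box2 a e1 \<Longrightarrow> c1 F1 (cx z) = of_real (D1 (\<lambda>z. G z $ 1) z)"
    "\<And>z. z \<in> box2 a e1 \<Longrightarrow> c2 F1 (cx z) = of_real (D2 (\<lambda>z. G z $ 1) z)"
    by (rule real_analytic_atE[OF g(1)]) (rule that)
  obtain F2 e2 where F2: "e2 > 0" "hol2 F2 (bidisc (cx a) e2)"
    "\<And>z. z \<in> box2 a e2 \<Longrightarrow> F2 (cx z) = of_real (G z $ 2)"
    "\<And>z. z \<in> box2 a e2 \<Longrightarrow> c1 F2 (cx z) = of_real (D1 (\<lambda>z. G z $ 2) z)"
    "\<And>z. z \<in> box2 a e2 \<Longrightarrow> c2 F2 (cx z) = of_real (D2 (\<lambda>z. G z $ 2) z)"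
    by (rule real_analytic_atE[OF g(2)]) (rule that)
  define e where "e = min e1 e2"
  have e: "e > 0" "hol2 F1 (bidisc (cx a) e)" "hol2 F2 (bidisc (cx a) e)"
    using F1 F2 hol2_subset bidisc_mono[of e e1 "cx a"] bidisc_mono[of e e2 "cx a"] by (auto simp: e_def)
  have sub: "z \<in> box2 a e1 \<and> z \<in> box2 a e2" if "z \<in> box2 a e" for z
    using that by (auto simp: box2_iff e_def)
  have aa: "a \<in> box2 a e" using e by (simp add: box2_def)
  have "c1 F1 (cx a) * c2 F2 (cx a) - c2 F1 (cx a) * c1 F2 (cx a) =
    of_real (D1 (\<lambda>z. G z $ 1) a * D2 (\<lambda>z. G z $ 2) a - D2 (\<lambda>z. G z $ 1) a * D1 (\<lambda>z. G z $ 2) a)"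
    using F1(4,5) F2(4,5) sub[OF aa] by simp
  then have dc: "c1 F1 (cx a) * c2 F2 (cx a) - c2 F1 (cx a) * c1 F2 (cx a) \<noteq> 0"
    using det by (metis of_real_eq_0_iff)
  have ca: "cx a \<in> bidisc (cx a) e" using e(1) by simp
  obtain U V H K where U: "open U" "U \<subseteq> bidisc (cx a) e" "cx a \<in> U" "open V"
    "homeomorphism U V (\<lambda>q. (F1 q, F2 q)) (\<lambda>q. (H q, K q))" "hol2 H V" "hol2 K V"
    by (rule hol2_inverse_function[OF open_bidisc e(2,3) ca dc]) (rule that)
  define U' where "U' = {z. cx z \<in> U} \<inter> N \<inter> {z. real_analytic_at (\<lambda>z. G z $ 1) z \<and> real_analytic_at (\<lambda>z. G z $ 2) z}"
  have "open {z. real_analytic_at (\<lambda>z. G z $ 1) z \<and> real_analytic_at (\<lambda>z. G z $ 2) z}"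
    unfolding open_subopen[of "{z. real_analytic_at (\<lambda>z. G z $ 1) z \<and> real_analytic_at (\<lambda>z. G z $ 2) z}"]
  proof
    fix z assume "z \<in> {z. real_analytic_at (\<lambda>z. G z $ 1) z \<and> real_analytic_at (\<lambda>z. G z $ 2) z}"
    then have "\<forall>\<^sub>F w in nhds z. real_analytic_at (\<lambda>z. G z $ 1) w \<and> real_analytic_at (\<lambda>z. G z $ 2) w"
      by (auto intro: eventually_conj analytic_eventually)
    then show "\<exists>T. open T \<and> z \<in> T \<and> T \<subseteq> {z. real_analytic_at (\<lambda>z. G z $ 1) z \<and> real_analytic_at (\<lambda>z. G z $ 2) z}"
      unfolding eventually_nhds by blast
  qed
  moreover have "open {z. cx z \<in> U}"
    using open_vimage[OF U(1) continuous_on_cx] by (simp add: vimage_def)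
  ultimately have oU: "open U'" unfolding U'_def using N by (intro open_Int)
  have aU: "a \<in> U'" using U N g by (simp add: U'_def)
  have cxG: "(F1 (cx z), F2 (cx z)) = cx (G z)" if "z \<in> U'" for z
  proof -
    have "z \<in> box2 a e" using that U(2) by (auto simp: U'_def box2_def)
    then show ?thesis using F1(3) F2(3) sub by (auto simp: cx_def)
  qed
  have HG: "(H (cx (G z)), K (cx (G z))) = cx z" "cx (G z) \<in> V" if "z \<in> U'" for z
  proof -
    have "cx z \<in> U" using that by (simp add: U'_def)
    then show "(H (cx (G z)), K (cx (G z))) = cx z" "cx (G z) \<in> V"
      using U(5) cxG[OF that] unfolding homeomorphism_def by (metis, metis imageI)
  qed
  have inj: "inj_on G U'"
    by (rule inj_onI) (metis HG(1) cx_inj)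
  have anG: "real_analytic_at (\<lambda>z. G z $ i) z" if "z \<in> U'" for z i
    using that exhaust_2[of i] by (auto simp: U'_def)
  have "isCont G z" if "z \<in> U'" for z
    using isCont_vec2[OF analytic_isCont[OF anG[OF that, of 1]] analytic_isCont[OF anG[OF that, of 2]]] by simp
  then have cG: "continuous_on U' G" by (simp add: continuous_at_imp_continuous_on)
  obtain g where hom: "homeomorphism U' (G ` U') G g"
    using invariance_of_domain_homeomorphism[OF oU cG _ inj] by auto
  have oV: "open (G ` U')" by (rule invariance_of_domain[OF cG oU inj])
  have gH: "H (cx y) = of_real (g y $ 1)" "K (cx y) = of_real (g y $ 2)" if "y \<in> G ` U'" for y
  proof -
    have "g y \<in> U'" "G (g y) = y" using hom that by (auto simp: homeomorphism_def)
    then have "(H (cx y), K (cx y)) = cx (g y)" using HG(1)[of "g y"] by simp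
    then show "H (cx y) = of_real (g y $ 1)" "K (cx y) = of_real (g y $ 2)" by (auto simp: cx_def)
  qed
  have "real_analytic_at (\<lambda>y. g y $ i) y" if y: "y \<in> G ` U'" for y i
  proof -
    have cy: "cx y \<in> V" using y HG(2) by auto
    have "real_analytic_at (\<lambda>y. g y $ 1) y" by (rule real_analytic_atI[OF U(4) cy U(6) oV y]) (use gH in auto)
    moreover have "real_analytic_at (\<lambda>y. g y $ 2) y" by (rule real_analytic_atI[OF U(4) cy U(7) oV y]) (use gH in auto)
    ultimately show ?thesis using exhaust_2[of i] by auto
  qed
  then show ?thesis using that[OF oU aU _ oV hom anG] by (auto simp: U'_def)
qed

section \<open>Charts and the Nijenhuis equations\<close>

lemma is_chart_inv:
  assumes "is_chart c"
  shows "q \<in> fst c \<Longrightarrow> inv_into (fst c) (snd c) (snd c q) = q"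
    and "z \<in> snd c ` fst c \<Longrightarrow> snd c (inv_into (fst c) (snd c) z) = z"
    and "z \<in> snd c ` fst c \<Longrightarrow> inv_into (fst c) (snd c) z \<in> fst c"
  using assms unfolding is_chart_def homeomorphism_def by (auto simp: f_inv_into_f inv_into_into)

lemma analytic_vec_compose:
  fixes f :: "real^2 \<Rightarrow> real^2"
  assumes "real_analytic_at g (f a)" "\<And>i. real_analytic_at (\<lambda>z. f z $ i) a"
  shows "real_analytic_at (\<lambda>z. g (f z)) a"
  using analytic_compose[of g "\<lambda>z. f z $ 1" a "\<lambda>z. f z $ 2"] assms by simp

text \<open>Membership in \<open>charts A\<close> is tested against the members of \<open>A\<close>
  only. The transition maps are those of c followed by \<Psi> in one direction and preceded by
  \<open>\<Psi>'\<close> in the other.\<close>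

lemma chart_compose:
  assumes atlas: "analytic_atlas A" and c: "c \<in> charts A" and U: "open U" "U \<subseteq> snd c ` fst c" and V: "open V"
    and hom: "homeomorphism U V \<Psi> \<Psi>'"
    and an1: "\<And>z i. z \<in> U \<Longrightarrow> real_analytic_at (\<lambda>z. \<Psi> z $ i) z" and an2: "\<And>z i. z \<in> V \<Longrightarrow> real_analytic_at (\<lambda>z. \<Psi>' z $ i) z"
    and c': "c' = (fst c \<inter> snd c -` U, \<Psi> \<circ> snd c)"
  shows "c' \<in> charts A" "snd c' ` fst c' = V"
    "\<And>z. z \<in> V \<Longrightarrow> inv_into (fst c') (snd c') z = inv_into (fst c) (snd c) (\<Psi>' z)"
proof -
  let ?i = "inv_into (fst c) (snd c)"
  have ch: "is_chart c" and comp: "\<And>a. a \<in> A \<Longrightarrow> compatible a c" using c by (auto simp: charts_def)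
  note inv = is_chart_inv[OF ch]
  have oc: "open (fst c)" and homc: "homeomorphism (fst c) (snd c ` fst c) (snd c) ?i"
    using ch by (auto simp: is_chart_def)
  have cc: "continuous_on (fst c) (snd c)" and ci: "continuous_on (snd c ` fst c) ?i"
    using homc by (auto simp: homeomorphism_def)
  have h: "\<Psi>' (\<Psi> x) = x" "\<Psi> x \<in> V" if "x \<in> U" for x using hom that by (auto simp: homeomorphism_def)
  have h': "\<Psi> (\<Psi>' y) = y" "\<Psi>' y \<in> U" if "y \<in> V" for y using hom that by (auto simp: homeomorphism_def)
  have cP: "continuous_on U \<Psi>" and cP': "continuous_on V \<Psi>'" using hom by (auto simp: homeomorphism_def)
  have open1: "open (fst c')"
    unfolding c' fst_conv by (rule continuous_open_preimage[OF cc oc U(1)])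
  have bk: "?i (\<Psi>' z) \<in> fst c'" "snd c' (?i (\<Psi>' z)) = z" if "z \<in> V" for z
    using h'[OF that] U(2) inv(2,3)[of "\<Psi>' z"] by (auto simp: c')
  show img: "snd c' ` fst c' = V"
  proof
    show "snd c' ` fst c' \<subseteq> V" using h by (auto simp: c')
    show "V \<subseteq> snd c' ` fst c'" using bk by (metis image_eqI subsetI)
  qed
  have inj: "inj_on (snd c') (fst c')"
  proof (rule inj_onI)
    fix x y assume "x \<in> fst c'" "y \<in> fst c'" "snd c' x = snd c' y"
    then have "x \<in> fst c" "y \<in> fst c" "snd c x = snd c y" using h(1) by (auto simp: c') (metis)
    then show "x = y" using inv(1) by metis
  qed
  show inv': "inv_into (fst c') (snd c') z = ?i (\<Psi>' z)" if "z \<in> V" for z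
    using bk[OF that] inv_into_f_f[OF inj, of "?i (\<Psi>' z)"] by simp
  have "is_chart c'"
    unfolding is_chart_def
  proof (intro conjI open1)
    show "open (snd c' ` fst c')" unfolding img by (rule V)
    show "homeomorphism (fst c') (snd c' ` fst c') (snd c') (inv_into (fst c') (snd c'))"
    proof (rule homeomorphismI)
      show "continuous_on (fst c') (snd c')"
        unfolding c' fst_conv snd_conv
        by (intro continuous_on_compose continuous_on_subset[OF cc] continuous_on_subset[OF cP]) auto
      have "continuous_on V (\<lambda>z. ?i (\<Psi>' z))"
        by (rule continuous_on_compose2[OF ci cP']) (use h' U in auto)
      then show "continuous_on (snd c' ` fst c') (inv_into (fst c') (snd c'))"
        unfolding img using inv' continuous_on_cong by metis
    qed (use inj in \<open>auto simp: f_inv_into_f inv_into_into\<close>)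
  qed
  moreover have "compatible a c'" if a: "a \<in> A" for a
  proof -
    have cmp: "real_analytic_on (transition a c) (snd a ` (fst a \<inter> fst c))"
      "real_analytic_on (transition c a) (snd c ` (fst a \<inter> fst c))"
      using comp[OF a] by (auto simp: compatible_def)
    have ac: "real_analytic_at (\<lambda>z. transition a c z $ i) z" if "z \<in> snd a ` (fst a \<inter> fst c)" for z i
      using cmp(1) that exhaust_2[of i] unfolding real_analytic_on_vec2 by auto
    have ca: "real_analytic_at (\<lambda>z. transition c a z $ i) z" if "z \<in> snd c ` (fst a \<inter> fst c)" for z i
      using cmp(2) that exhaust_2[of i] unfolding real_analytic_on_vec2 by auto
    show ?thesis
      unfolding compatible_def real_analytic_on_vec2
    proof (intro conjI ballI)
      fix z assume z: "z \<in> snd a ` (fst a \<inter> fst c')"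
      have zc: "z \<in> snd a ` (fst a \<inter> fst c)" using z by (auto simp: c')
      have tr: "transition a c' = (\<lambda>z. \<Psi> (transition a c z))"
        by (auto simp: transition_def c' fun_eq_iff)
      have "transition a c z \<in> U"
      proof -
        obtain q where q: "q \<in> fst a" "q \<in> fst c'" "z = snd a q" using z by auto
        have "is_chart a" using atlas a by (simp add: analytic_atlas_def)
        then have "inv_into (fst a) (snd a) z = q" using is_chart_inv(1) q by blast
        then show ?thesis using q by (simp add: transition_def c')
      qed
      then have "real_analytic_at (\<lambda>z. \<Psi> (transition a c z) $ i) z" for i
        using analytic_vec_compose[of "\<lambda>w. \<Psi> w $ i" "transition a c" z] an1 ac[OF zc] by blast
      then show "real_analytic_at (\<lambda>z. transition a c' z $ 1) z" "real_analytic_at (\<lambda>z. transition a c' z $ 2) z"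
        unfolding tr by auto
    next
      fix z assume z: "z \<in> snd c' ` (fst a \<inter> fst c')"
      then have zV: "z \<in> V" using img by auto
      obtain q where q: "q \<in> fst c'" "q \<in> fst a" "z = snd c' q" using z by auto
      have "\<Psi>' z = snd c q" using q h by (auto simp: c')
      then have zc: "\<Psi>' z \<in> snd c ` (fst a \<inter> fst c)" using q by (auto simp: c')
      have "\<forall>\<^sub>F w in nhds z. w \<in> V" using V zV eventually_nhds by blast
      then have ev: "\<forall>\<^sub>F w in nhds z. transition c' a w $ i = transition c a (\<Psi>' w) $ i" for i
        by eventually_elim (simp add: transition_def inv')
      have "real_analytic_at (\<lambda>z. transition c a (\<Psi>' z) $ i) z" for i
        using analytic_vec_compose[of "\<lambda>w. transition c a w $ i" "\<Psi>'" z, OF ca[OF zc] an2[OF zV]] .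
      then show "real_analytic_at (\<lambda>z. transition c' a z $ 1) z" "real_analytic_at (\<lambda>z. transition c' a z $ 2) z"
        using analytic_cong[OF _ ev] by blast+
    qed
  qed
  ultimately show "c' \<in> charts A" by (simp add: charts_def)
qed

lemma jacobian_analytic:
  fixes f :: "real^2 \<Rightarrow> real^2"
  assumes "real_analytic_at (\<lambda>z. f z $ 1) z" "real_analytic_at (\<lambda>z. f z $ 2) z"
  shows "jacobian f (at z) = mat2 (D1 (\<lambda>z. f z $ 1) z) (D2 (\<lambda>z. f z $ 1) z) (D1 (\<lambda>z. f z $ 2) z) (D2 (\<lambda>z. f z $ 2) z)"
    and "(f has_derivative (\<lambda>h. vec2 (D1 (\<lambda>z. f z $ 1) z * h $ 1 + D2 (\<lambda>z. f z $ 1) z * h $ 2)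
      (D1 (\<lambda>z. f z $ 2) z * h $ 1 + D2 (\<lambda>z. f z $ 2) z * h $ 2))) (at z)"
proof -
  show d: "(f has_derivative (\<lambda>h. vec2 (D1 (\<lambda>z. f z $ 1) z * h $ 1 + D2 (\<lambda>z. f z $ 1) z * h $ 2)
      (D1 (\<lambda>z. f z $ 2) z * h $ 1 + D2 (\<lambda>z. f z $ 2) z * h $ 2))) (at z)"
    using has_derivative_vec2[OF analytic_has_derivative[OF assms(1)] analytic_has_derivative[OF assms(2)]] by simp
  show "jacobian f (at z) = mat2 (D1 (\<lambda>z. f z $ 1) z) (D2 (\<lambda>z. f z $ 1) z) (D1 (\<lambda>z. f z $ 2) z) (D2 (\<lambda>z. f z $ 2) z)"
    unfolding jacobian_def frechet_derivative_at[OF d, symmetric]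
    by (simp add: matrix_def mat2_def vec_eq_iff forall_2 axis_def)
qed

lemma mat2_nth [simp]: "mat2 a b c d $ 1 $ 1 = a" "mat2 a b c d $ 1 $ 2 = b"
  "mat2 a b c d $ 2 $ 1 = c" "mat2 a b c d $ 2 $ 2 = d"
  by (simp_all add: mat2_def)

lemma mat2_eqI:
  fixes M N :: "real^2^2"
  shows "M $ 1 $ 1 = N $ 1 $ 1 \<Longrightarrow> M $ 1 $ 2 = N $ 1 $ 2 \<Longrightarrow> M $ 2 $ 1 = N $ 2 $ 1 \<Longrightarrow> M $ 2 $ 2 = N $ 2 $ 2 \<Longrightarrow> M = N"
  by (simp add: vec_eq_iff forall_2)

lemma mult_mat2_nth:
  fixes M N :: "real^2^2"
  shows "(M ** N) $ i $ j = M $ i $ 1 * N $ 1 $ j + M $ i $ 2 * N $ 2 $ j"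
  by (simp add: matrix_matrix_mult_def sum_2)

lemma matrix_inv_mult_left:
  fixes M :: "real^2^2"
  assumes "invertible M"
  shows "matrix_inv M ** M = mat 1"
  using assms unfolding invertible_def matrix_inv_def by (rule someI2_ex) blast

text \<open>The transformation law multiplied on the right by the Jacobian matrix J: row i of L' J =
  J L, one conclusion for each column. In this form no inverse matrix has to be computed
  later.\<close>

lemma operator_transform:
  assumes L: "operator_field A W L" and c: "c \<in> charts A" and c': "c' \<in> charts A" "c' = (fst c \<inter> snd c -` U, \<Psi> \<circ> snd c)"
    and U: "open U" "U \<subseteq> snd c ` (W \<inter> fst c)" and inv: "inv_into (fst c') (snd c') (\<Psi> w) = inv_into (fst c) (snd c) w"
    and real_analytic_at: "\<And>i. real_analytic_at (\<lambda>z. \<Psi> z $ i) w" and w: "w \<in> U"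
    and det: "D1 (\<lambda>z. \<Psi> z $ 1) w * D2 (\<lambda>z. \<Psi> z $ 2) w - D2 (\<lambda>z. \<Psi> z $ 1) w * D1 (\<lambda>z. \<Psi> z $ 2) w \<noteq> 0"
  shows "in_coords L c' (\<Psi> w) $ i $ 1 * D1 (\<lambda>z. \<Psi> z $ 1) w + in_coords L c' (\<Psi> w) $ i $ 2 * D1 (\<lambda>z. \<Psi> z $ 2) w =
      D1 (\<lambda>z. \<Psi> z $ i) w * in_coords L c w $ 1 $ 1 + D2 (\<lambda>z. \<Psi> z $ i) w * in_coords L c w $ 2 $ 1"
    "in_coords L c' (\<Psi> w) $ i $ 1 * D2 (\<lambda>z. \<Psi> z $ 1) w + in_coords L c' (\<Psi> w) $ i $ 2 * D2 (\<lambda>z. \<Psi> z $ 2) w =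
      D1 (\<lambda>z. \<Psi> z $ i) w * in_coords L c w $ 1 $ 2 + D2 (\<lambda>z. \<Psi> z $ i) w * in_coords L c w $ 2 $ 2"
proof -
  have ch: "is_chart c" using c by (auto simp: charts_def)
  let ?q = "inv_into (fst c) (snd c) w"
  have wc: "w \<in> snd c ` fst c" using U w by auto
  have q: "?q \<in> fst c" "snd c ?q = w" using is_chart_inv(2,3)[OF ch wc] by auto
  have qW: "?q \<in> W"
    using U(2) w is_chart_inv(1)[OF ch] by auto
  have q': "?q \<in> fst c'" using q w by (simp add: c'(2))
  have "\<forall>\<^sub>F z in nhds w. z \<in> U" using U w eventually_nhds by blast
  then have "\<forall>\<^sub>F z in nhds w. transition c c' z = \<Psi> z"
  proof eventually_elim
    case (elim z)
    then have "z \<in> snd c ` fst c" using U by auto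
    then show ?case using is_chart_inv(2)[OF ch] by (simp add: transition_def c'(2))
  qed
  then have ev: "\<forall>\<^sub>F z in nhds w. transition c c' z $ i = \<Psi> z $ i" for i
    by eventually_elim simp
  define J where "J = jacobian (transition c c') (at w)"
  have J: "J = mat2 (D1 (\<lambda>z. \<Psi> z $ 1) w) (D2 (\<lambda>z. \<Psi> z $ 1) w) (D1 (\<lambda>z. \<Psi> z $ 2) w) (D2 (\<lambda>z. \<Psi> z $ 2) w)"
    unfolding J_def by (subst jacobian_analytic) (auto intro: analytic_cong[OF real_analytic_at ev] simp: D_cong[OF ev])
  have "invertible J" unfolding invertible_det_nz det_2 using det by (simp add: J)
  have "L c' ?q = J ** L c ?q ** matrix_inv J"
  proof -
    have "?q \<in> W \<inter> fst c \<inter> fst c'" using qW q q' by simp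
    from L[unfolded operator_field_def, rule_format, OF c c'(1) this]
    show ?thesis unfolding Let_def q(2) J_def .
  qed
  then have "L c' ?q ** J = J ** L c ?q ** (matrix_inv J ** J)"
    by (simp add: matrix_mul_assoc)
  then have "L c' ?q ** J = J ** L c ?q"
    using matrix_inv_mult_left[OF \<open>invertible J\<close>] by simp
  moreover have "in_coords L c' (\<Psi> w) = L c' ?q" "in_coords L c w = L c ?q"
    using inv by (simp_all add: in_coords_def)
  ultimately have eq: "(in_coords L c' (\<Psi> w) ** J) $ i $ j = (J ** in_coords L c w) $ i $ j" for i j by simp
  have Ji: "J $ i $ 1 = D1 (\<lambda>z. \<Psi> z $ i) w" "J $ i $ 2 = D2 (\<lambda>z. \<Psi> z $ i) w" for i
    using exhaust_2[of i] by (auto simp: J)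
  show "in_coords L c' (\<Psi> w) $ i $ 1 * D1 (\<lambda>z. \<Psi> z $ 1) w + in_coords L c' (\<Psi> w) $ i $ 2 * D1 (\<lambda>z. \<Psi> z $ 2) w =
      D1 (\<lambda>z. \<Psi> z $ i) w * in_coords L c w $ 1 $ 1 + D2 (\<lambda>z. \<Psi> z $ i) w * in_coords L c w $ 2 $ 1"
    "in_coords L c' (\<Psi> w) $ i $ 1 * D2 (\<lambda>z. \<Psi> z $ 1) w + in_coords L c' (\<Psi> w) $ i $ 2 * D2 (\<lambda>z. \<Psi> z $ 2) w =
      D1 (\<lambda>z. \<Psi> z $ i) w * in_coords L c w $ 1 $ 2 + D2 (\<lambda>z. \<Psi> z $ i) w * in_coords L c w $ 2 $ 2"
    using eq[of i 1] eq[of i 2] unfolding mult_mat2_nth Ji .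
qed

section \<open>Trace and determinant of a Nijenhuis operator\<close>

definition tr2 :: "real^2^2 \<Rightarrow> real" where "tr2 M = M $ 1 $ 1 + M $ 2 $ 2"

definition neg_det :: "real^2^2 \<Rightarrow> real" where "neg_det M = M $ 1 $ 2 * M $ 2 $ 1 - M $ 1 $ 1 * M $ 2 $ 2"

text \<open>In dimension two the value on the pair of coordinate fields carries all the information.
  Its two components are, up to sign and order, the entries of the covector dv o L - v dv - du,
  whence the first two equations.\<close>

lemma nijenhuis_equations:
  assumes N: "nijenhuis_on T V" and z: "z \<in> V" and real_analytic_at: "\<And>i j. real_analytic_at (\<lambda>z. T z $ i $ j) z"
  defines "v \<equiv> \<lambda>z. tr2 (T z)" and "u \<equiv> \<lambda>z. neg_det (T z)"
  shows "D1 v z * T z $ 1 $ 1 + D2 v z * T z $ 2 $ 1 = v z * D1 v z + D1 u z"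
    "D1 v z * T z $ 1 $ 2 + D2 v z * T z $ 2 $ 2 = v z * D2 v z + D2 u z"
    "D1 u z * T z $ 1 $ 1 + D2 u z * T z $ 2 $ 1 = u z * D1 v z"
    "D1 u z * T z $ 1 $ 2 + D2 u z * T z $ 2 $ 2 = u z * D2 v z"
proof -
  define a b c d where abcd: "a = (\<lambda>z. T z $ 1 $ 1)" "b = (\<lambda>z. T z $ 1 $ 2)" "c = (\<lambda>z. T z $ 2 $ 1)" "d = (\<lambda>z. T z $ 2 $ 2)"
  have anabcd: "real_analytic_at a z" "real_analytic_at b z" "real_analytic_at c z" "real_analytic_at d z" using real_analytic_at by (auto simp: abcd)
  have T1: "(\<lambda>w. T w *v axis 1 1) = (\<lambda>w. vec2 (a w) (c w))" and T2: "(\<lambda>w. T w *v axis 2 1) = (\<lambda>w. vec2 (b w) (d w))"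
    by (auto simp: fun_eq_iff vec2_eq_iff matrix_vector_mult_def sum_2 axis_def abcd)
  have f1: "frechet_derivative (\<lambda>w. vec2 (a w) (c w)) (at z) =
      (\<lambda>h. vec2 (D1 a z * h $ 1 + D2 a z * h $ 2) (D1 c z * h $ 1 + D2 c z * h $ 2))"
    by (rule frechet_derivative_at[symmetric], rule has_derivative_vec2) (intro analytic_has_derivative anabcd)+
  have f2: "frechet_derivative (\<lambda>w. vec2 (b w) (d w)) (at z) =
      (\<lambda>h. vec2 (D1 b z * h $ 1 + D2 b z * h $ 2) (D1 d z * h $ 1 + D2 d z * h $ 2))"
    by (rule frechet_derivative_at[symmetric], rule has_derivative_vec2) (intro analytic_has_derivative anabcd)+
  have "nijenhuis_tensor T (\<lambda>_. axis 1 1) (\<lambda>_. axis 2 1) z = 0"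
    using N z real_analytic_on_const unfolding nijenhuis_on_def by blast
  then have n: "T z *v (T z *v 0) - T z *v (0 - vec2 (D2 a z) (D2 c z)) - T z *v (vec2 (D1 b z) (D1 d z))
      + (vec2 (D1 b z * a z + D2 b z * c z) (D1 d z * a z + D2 d z * c z)
       - vec2 (D1 a z * b z + D2 a z * d z) (D1 c z * b z + D2 c z * d z)) = 0"
    unfolding nijenhuis_tensor_def lie_bracket_def T1 T2 f1 f2
    by (simp add: axis_def frechet_derivative_const)
  have n1: "a z * D2 a z + b z * D2 c z - (a z * D1 b z + b z * D1 d z)
      + (D1 b z * a z + D2 b z * c z) - (D1 a z * b z + D2 a z * d z) = 0"
    using arg_cong[OF n, of "\<lambda>x. x $ 1"]
    by (simp add: matrix_vector_mult_def sum_2 abcd algebra_simps)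
  have n2: "c z * D2 a z + d z * D2 c z - (c z * D1 b z + d z * D1 d z)
      + (D1 d z * a z + D2 d z * c z) - (D1 c z * b z + D2 c z * d z) = 0"
    using arg_cong[OF n, of "\<lambda>x. x $ 2"]
    by (simp add: matrix_vector_mult_def sum_2 abcd algebra_simps)
  have v: "v = (\<lambda>z. a z + d z)" and u: "u = (\<lambda>z. b z * c z - a z * d z)"
    by (auto simp: v_def u_def tr2_def neg_det_def abcd)
  have dv: "D1 v z = D1 a z + D1 d z" "D2 v z = D2 a z + D2 d z"
    unfolding v by (simp_all add: D_add anabcd)
  have du: "D1 u z = b z * D1 c z + D1 b z * c z - (a z * D1 d z + D1 a z * d z)"
    "D2 u z = b z * D2 c z + D2 b z * c z - (a z * D2 d z + D2 a z * d z)"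
    unfolding u by (simp_all add: D_diff D_mult analytic_mult anabcd)
  have vz: "v z = a z + d z" and uz: "u z = b z * c z - a z * d z" by (simp_all add: v u)
  have e1: "D1 v z * a z + D2 v z * c z = v z * D1 v z + D1 u z"
    unfolding vz dv du using n2 by (simp add: algebra_simps)
  have e2: "D1 v z * b z + D2 v z * d z = v z * D2 v z + D2 u z"
    unfolding vz dv du using n1 by (simp add: algebra_simps)
  \<comment> \<open>Eliminating u_x and u_y leaves the identity L^2 = v L + u evaluated on dv;
    \<open>e4\<close> is its other component.\<close>
  have e3: "D1 u z * a z + D2 u z * c z = u z * D1 v z"
  proof -
    have u1: "D1 u z = D1 v z * a z + D2 v z * c z - v z * D1 v z"
      and u2: "D2 u z = D1 v z * b z + D2 v z * d z - v z * D2 v z" using e1 e2 by auto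
    show ?thesis unfolding u1 u2 vz uz by (simp add: algebra_simps)
  qed
  have e4: "D1 u z * b z + D2 u z * d z = u z * D2 v z"
  proof -
    have u1: "D1 u z = D1 v z * a z + D2 v z * c z - v z * D1 v z"
      and u2: "D2 u z = D1 v z * b z + D2 v z * d z - v z * D2 v z" using e1 e2 by auto
    show ?thesis unfolding u1 u2 vz uz by (simp add: algebra_simps)
  qed
  show "D1 v z * T z $ 1 $ 1 + D2 v z * T z $ 2 $ 1 = v z * D1 v z + D1 u z"
    "D1 v z * T z $ 1 $ 2 + D2 v z * T z $ 2 $ 2 = v z * D2 v z + D2 u z"
    "D1 u z * T z $ 1 $ 1 + D2 u z * T z $ 2 $ 1 = u z * D1 v z"
    "D1 u z * T z $ 1 $ 2 + D2 u z * T z $ 2 $ 2 = u z * D2 v z"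
    using e1 e2 e3 e4 by (simp_all add: abcd)
qed


lemma analytic_nonzero:
  assumes "real_analytic_at f a" "f a \<noteq> 0" shows "\<forall>\<^sub>F z in nhds a. f z \<noteq> 0"
proof -
  have "open (- {0::real})" by (rule open_Compl) simp
  then have "\<forall>\<^sub>F x in nhds (f a). x \<in> - {0}" using assms(2) unfolding eventually_nhds by blast
  from eventually_nhds_compose[OF analytic_isCont[OF assms(1)] this] show ?thesis by simp
qed

text \<open>If \<open>\<phi>\<close> solves \<open>\<phi>\<^sub>x = f (x, \<phi>)\<close>, \<open>\<phi> (0, c) = c\<close>, then \<open>Y\<close> is obtained by solving \<open>y = \<phi> (x, c)\<close> for \<open>c\<close>.\<close>

lemma first_integral:
  assumes f: "real_analytic_at f 0"
  obtains Y where "real_analytic_at Y 0" "Y 0 = 0" "D2 Y 0 \<noteq> 0" "\<forall>\<^sub>F z in nhds 0. D1 Y z + f z * D2 Y z = 0"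
proof -
  obtain \<phi> where \<phi>: "real_analytic_at \<phi> 0" "\<forall>\<^sub>F z in nhds 0. D1 \<phi> z = f (vec2 (z $ 1) (\<phi> z))" "\<And>y. \<phi> (vec2 0 y) = y"
    by (rule analytic_cauchy_problem[OF f]) (rule that)
  define G where "G = (\<lambda>z. vec2 (z $ 1) (\<phi> z))"
  have "((\<lambda>t. \<phi> (vec2 0 t)) has_field_derivative D2 \<phi> 0) (at 0)"
    using DERIV_D2[OF \<phi>(1)] by simp
  then have D2\<phi>: "D2 \<phi> 0 = 1" unfolding \<phi>(3) using DERIV_unique DERIV_ident by blast
  have "\<phi> 0 = 0" using \<phi>(3)[of 0] by simp
  then have G0: "G 0 = 0" by (simp add: G_def)
  obtain N where N: "open N" "0 \<in> N" "\<And>z. z \<in> N \<Longrightarrow> D1 \<phi> z = f (vec2 (z $ 1) (\<phi> z))"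
    using \<phi>(2) unfolding eventually_nhds by blast
  have g: "real_analytic_at (\<lambda>z. G z $ 1) 0" "real_analytic_at (\<lambda>z. G z $ 2) 0" using \<phi>(1) by (simp_all add: G_def)
  have det: "D1 (\<lambda>z. G z $ 1) 0 * D2 (\<lambda>z. G z $ 2) 0 - D2 (\<lambda>z. G z $ 1) 0 * D1 (\<lambda>z. G z $ 2) 0 \<noteq> 0"
    by (simp add: G_def D2\<phi>)
  obtain U V H where H: "open U" "0 \<in> U" "U \<subseteq> N" "open V" "homeomorphism U V G H"
    "\<And>z i. z \<in> U \<Longrightarrow> real_analytic_at (\<lambda>z. G z $ i) z" "\<And>z i. z \<in> V \<Longrightarrow> real_analytic_at (\<lambda>z. H z $ i) z"
    by (rule analytic_inverse_map[OF g N(1,2) det]) (rule that)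
  define Y where "Y = (\<lambda>z. H z $ 2)"
  have HV: "H w \<in> U" "G (H w) = w" if "w \<in> V" for w using H(5) that by (auto simp: homeomorphism_def)
  have V0: "0 \<in> V" "H 0 = 0" using H(2,5) G0 unfolding homeomorphism_def by (metis imageI)+
  have HY: "H w = vec2 (w $ 1) (Y w)" "\<phi> (H w) = w $ 2" if "w \<in> V" for w
    using HV(2)[OF that] by (auto simp: G_def Y_def vec2_eq_iff)
  have d: "D1 \<phi> (H w) + D2 \<phi> (H w) * D1 Y w = 0" "D2 \<phi> (H w) * D2 Y w = 1" "D1 \<phi> (H w) = f w"
    if w: "w \<in> V" for w
  proof -
    have "\<forall>\<^sub>F x in nhds w. x \<in> V" using H(4) w unfolding eventually_nhds by blast
    then have ev: "\<forall>\<^sub>F x in nhds w. \<phi> (vec2 (x $ 1) (Y x)) = x $ 2"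
      by eventually_elim (metis HY)
    have real_analytic_at\<phi>: "real_analytic_at \<phi> (vec2 (w $ 1) (Y w))"
      using H(6)[OF HV(1)[OF w], of 2] HY(1)[OF w] by (simp add: G_def)
    have anY: "real_analytic_at Y w" using H(7)[OF w] by (simp add: Y_def)
    show "D1 \<phi> (H w) + D2 \<phi> (H w) * D1 Y w = 0" "D2 \<phi> (H w) * D2 Y w = 1"
      using D_compose[OF real_analytic_at\<phi> analytic_x anY] D_cong[OF ev] HY(1)[OF w] by simp_all
    have "H w \<in> N" using HV(1)[OF w] H(3) by blast
    then show "D1 \<phi> (H w) = f w" using N(3)[of "H w"] HV(2)[OF w] by (simp add: G_def)
  qed
  have "\<forall>\<^sub>F x in nhds 0. x \<in> V" using H(4) V0 unfolding eventually_nhds by blast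
  then have "\<forall>\<^sub>F z in nhds 0. D1 Y z + f z * D2 Y z = 0"
  proof eventually_elim
    case (elim w)
    have "D2 \<phi> (H w) \<noteq> 0" using d(2)[OF elim] by auto
    moreover have "D2 \<phi> (H w) * (D1 Y w + f w * D2 Y w) = 0"
      using d[OF elim] by (simp add: algebra_simps)
    ultimately show ?case by simp
  qed
  moreover have "D2 Y 0 \<noteq> 0" using d(2)[OF V0(1)] by auto
  moreover have "real_analytic_at Y 0" using H(7)[OF V0(1)] by (simp add: Y_def)
  moreover have "Y 0 = 0" using V0 by (simp add: Y_def)
  ultimately show ?thesis using that by blast
qed

section \<open>Centred charts and changes of coordinates\<close>

definition centred :: "'m::topological_space chart set \<Rightarrow> 'm set \<Rightarrow> 'm \<Rightarrow> 'm chart \<Rightarrow> bool" where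
  "centred A W p \<phi> \<longleftrightarrow> \<phi> \<in> charts A \<and> p \<in> fst \<phi> \<and> fst \<phi> \<subseteq> W \<and> snd \<phi> p = 0"

lemma centred_domain:
  assumes "centred A W p \<phi>"
  shows "open (snd \<phi> ` fst \<phi>)" "0 \<in> snd \<phi> ` fst \<phi>"
  using assms by (auto simp: centred_def charts_def is_chart_def image_iff)

lemma centred_nijenhuis:
  assumes L: "analytic_nijenhuis_operator A W L" and \<phi>: "centred A W p \<phi>"
  shows "nijenhuis_on (in_coords L \<phi>) (snd \<phi> ` fst \<phi>)"
    and "z \<in> snd \<phi> ` fst \<phi> \<Longrightarrow> real_analytic_at (\<lambda>z. in_coords L \<phi> z $ i $ j) z"
proof -
  have W: "W \<inter> fst \<phi> = fst \<phi>" and ch: "\<phi> \<in> charts A" using \<phi> by (auto simp: centred_def)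
  show "nijenhuis_on (in_coords L \<phi>) (snd \<phi> ` fst \<phi>)"
    using L ch W unfolding analytic_nijenhuis_operator_def by metis
  have "real_analytic_on (in_coords L \<phi>) (snd \<phi> ` fst \<phi>)"
    using L ch W unfolding analytic_nijenhuis_operator_def by metis
  then have "real_analytic_on (\<lambda>z. in_coords L \<phi> z $ i $ j) (snd \<phi> ` fst \<phi>)"
    by (intro real_analytic_on_bounded_linear[OF bounded_linear_vec_nth])
  then show "z \<in> snd \<phi> ` fst \<phi> \<Longrightarrow> real_analytic_at (\<lambda>z. in_coords L \<phi> z $ i $ j) z"
    unfolding real_analytic_on_iff_at by blast
qed

text \<open>The common tool of all reductions; H expresses the old coordinates in the new ones.
  Shrinking the domain turns the germ statement \<open>P\<close> into one valid at every point of
  the new chart, as is needed for normal forms that hold on the whole chart image. The four matrix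
  identities are the entries of S J = J T, where S is the new matrix and J the Jacobian matrix of
  (X, Y).\<close>

lemma coordinate_change:
  fixes X Y :: "real^2 \<Rightarrow> real"
  assumes atlas: "analytic_atlas A" and L: "analytic_nijenhuis_operator A W L" and \<phi>: "centred A W p \<phi>"
    and X: "real_analytic_at X 0" "X 0 = 0" and Y: "real_analytic_at Y 0" "Y 0 = 0"
    and det: "D1 X 0 * D2 Y 0 - D2 X 0 * D1 Y 0 \<noteq> 0" and P: "\<forall>\<^sub>F z in nhds 0. P z"
  defines "T \<equiv> in_coords L \<phi>"
  obtains \<psi> H where "centred A W p \<psi>" "H 0 = 0" "0 \<in> snd \<psi> ` fst \<psi>"
    "\<And>z. z \<in> snd \<psi> ` fst \<psi> \<Longrightarrow> H z \<in> snd \<phi> ` fst \<phi>"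
    "\<And>z. z \<in> snd \<psi> ` fst \<psi> \<Longrightarrow> P (H z)"
    "\<And>z. z \<in> snd \<psi> ` fst \<psi> \<Longrightarrow> X (H z) = z $ 1"
    "\<And>z. z \<in> snd \<psi> ` fst \<psi> \<Longrightarrow> Y (H z) = z $ 2"
    "\<And>z. z \<in> snd \<psi> ` fst \<psi> \<Longrightarrow> D1 X (H z) * D2 Y (H z) - D2 X (H z) * D1 Y (H z) \<noteq> 0"
    "\<And>z. z \<in> snd \<psi> ` fst \<psi> \<Longrightarrow> in_coords L \<psi> z $ 1 $ 1 * D1 X (H z) + in_coords L \<psi> z $ 1 $ 2 * D1 Y (H z)
       = D1 X (H z) * T (H z) $ 1 $ 1 + D2 X (H z) * T (H z) $ 2 $ 1"
    "\<And>z. z \<in> snd \<psi> ` fst \<psi> \<Longrightarrow> in_coords L \<psi> z $ 1 $ 1 * D2 X (H z) + in_coords L \<psi> z $ 1 $ 2 * D2 Y (H z)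
       = D1 X (H z) * T (H z) $ 1 $ 2 + D2 X (H z) * T (H z) $ 2 $ 2"
    "\<And>z. z \<in> snd \<psi> ` fst \<psi> \<Longrightarrow> in_coords L \<psi> z $ 2 $ 1 * D1 X (H z) + in_coords L \<psi> z $ 2 $ 2 * D1 Y (H z)
       = D1 Y (H z) * T (H z) $ 1 $ 1 + D2 Y (H z) * T (H z) $ 2 $ 1"
    "\<And>z. z \<in> snd \<psi> ` fst \<psi> \<Longrightarrow> in_coords L \<psi> z $ 2 $ 1 * D2 X (H z) + in_coords L \<psi> z $ 2 $ 2 * D2 Y (H z)
       = D1 Y (H z) * T (H z) $ 1 $ 2 + D2 Y (H z) * T (H z) $ 2 $ 2"
    "\<And>z. z \<in> snd \<psi> ` fst \<psi> \<Longrightarrow> tr2 (in_coords L \<psi> z) = tr2 (T (H z))"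
    "\<And>z. z \<in> snd \<psi> ` fst \<psi> \<Longrightarrow> neg_det (in_coords L \<psi> z) = neg_det (T (H z))"
proof -
  define \<Psi> where "\<Psi> = (\<lambda>z. vec2 (X z) (Y z))"
  have P12: "(\<lambda>z. \<Psi> z $ 1) = X" "(\<lambda>z. \<Psi> z $ 2) = Y" by (auto simp: \<Psi>_def)
  have g: "real_analytic_at (\<lambda>z. \<Psi> z $ 1) 0" "real_analytic_at (\<lambda>z. \<Psi> z $ 2) 0" using X Y by (simp_all add: P12)
  have det\<Psi>: "D1 (\<lambda>z. \<Psi> z $ 1) 0 * D2 (\<lambda>z. \<Psi> z $ 2) 0 - D2 (\<lambda>z. \<Psi> z $ 1) 0 * D1 (\<lambda>z. \<Psi> z $ 2) 0 \<noteq> 0"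
    unfolding P12 by (rule det)
  define J where "J = (\<lambda>z. D1 X z * D2 Y z - D2 X z * D1 Y z)"
  have "real_analytic_at J 0" unfolding J_def by (intro analytic_diff analytic_mult analytic_D1 analytic_D2 X Y)
  then have J: "\<forall>\<^sub>F z in nhds 0. J z \<noteq> 0" using det by (intro analytic_nonzero) (auto simp: J_def)
  have V0: "open (snd \<phi> ` fst \<phi>)" "0 \<in> snd \<phi> ` fst \<phi>" using centred_domain[OF \<phi>] .
  then have "\<forall>\<^sub>F z in nhds 0. z \<in> snd \<phi> ` fst \<phi>" unfolding eventually_nhds by blast
  with J P have "\<forall>\<^sub>F z in nhds 0. z \<in> snd \<phi> ` fst \<phi> \<and> J z \<noteq> 0 \<and> P z" by eventually_elim simp
  then obtain N where N: "open N" "0 \<in> N" "\<And>z. z \<in> N \<Longrightarrow> z \<in> snd \<phi> ` fst \<phi> \<and> J z \<noteq> 0 \<and> P z"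
    unfolding eventually_nhds by blast
  obtain U V H where H: "open U" "0 \<in> U" "U \<subseteq> N" "open V" "homeomorphism U V \<Psi> H"
    "\<And>z i. z \<in> U \<Longrightarrow> real_analytic_at (\<lambda>z. \<Psi> z $ i) z" "\<And>z i. z \<in> V \<Longrightarrow> real_analytic_at (\<lambda>z. H z $ i) z"
    by (rule analytic_inverse_map[OF g N(1,2) det\<Psi>]) (rule that)
  have HV: "H w \<in> U" "\<Psi> (H w) = w" if "w \<in> V" for w using H(5) that by (auto simp: homeomorphism_def)
  have "\<Psi> 0 = 0" using X Y by (simp add: \<Psi>_def)
  then have V0': "0 \<in> V" "H 0 = 0" using H(2,5) \<open>\<Psi> 0 = 0\<close> unfolding homeomorphism_def by (metis imageI)+
  define \<psi> where "\<psi> = (fst \<phi> \<inter> snd \<phi> -` U, \<Psi> \<circ> snd \<phi>)"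
  have c: "\<phi> \<in> charts A" and cW: "fst \<phi> \<subseteq> W" using \<phi> by (auto simp: centred_def)
  have US: "U \<subseteq> snd \<phi> ` fst \<phi>" using H(3) N(3) by blast
  have cc: "\<psi> \<in> charts A" "snd \<psi> ` fst \<psi> = V"
    "\<And>z. z \<in> V \<Longrightarrow> inv_into (fst \<psi>) (snd \<psi>) z = inv_into (fst \<phi>) (snd \<phi>) (H z)"
    using chart_compose[OF atlas c H(1) US H(4,5,6,7) \<psi>_def] by blast+
  have cen: "centred A W p \<psi>"
    using cc(1) \<phi> H(2) \<open>\<Psi> 0 = 0\<close> by (auto simp: centred_def \<psi>_def)
  have im: "snd \<psi> ` fst \<psi> = V" by (rule cc(2))
  have op: "operator_field A W L" using L by (simp add: analytic_nijenhuis_operator_def)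
  have US': "U \<subseteq> snd \<phi> ` (W \<inter> fst \<phi>)" using US cW by blast
  have tr: "in_coords L \<psi> z $ i $ 1 * D1 X (H z) + in_coords L \<psi> z $ i $ 2 * D1 Y (H z) =
      D1 (\<lambda>z. \<Psi> z $ i) (H z) * T (H z) $ 1 $ 1 + D2 (\<lambda>z. \<Psi> z $ i) (H z) * T (H z) $ 2 $ 1"
    "in_coords L \<psi> z $ i $ 1 * D2 X (H z) + in_coords L \<psi> z $ i $ 2 * D2 Y (H z) =
      D1 (\<lambda>z. \<Psi> z $ i) (H z) * T (H z) $ 1 $ 2 + D2 (\<lambda>z. \<Psi> z $ i) (H z) * T (H z) $ 2 $ 2"
    and Jn: "J (H z) \<noteq> 0" and PH: "P (H z)" if z: "z \<in> V" for z i
  proof -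
    have HN: "H z \<in> N" using HV(1)[OF z] H(3) by blast
    then show "J (H z) \<noteq> 0" "P (H z)" using N(3) by auto
    then have det: "D1 (\<lambda>z. \<Psi> z $ 1) (H z) * D2 (\<lambda>z. \<Psi> z $ 2) (H z) - D2 (\<lambda>z. \<Psi> z $ 1) (H z) * D1 (\<lambda>z. \<Psi> z $ 2) (H z) \<noteq> 0"
      unfolding P12 by (simp add: J_def)
    have inv: "inv_into (fst \<psi>) (snd \<psi>) (\<Psi> (H z)) = inv_into (fst \<phi>) (snd \<phi>) (H z)"
      using cc(3)[OF z] HV(2)[OF z] by simp
    note t = operator_transform[OF op c cc(1) \<psi>_def H(1) US' inv H(6)[OF HV(1)[OF z]] HV(1)[OF z] det, of i]
    show "in_coords L \<psi> z $ i $ 1 * D1 X (H z) + in_coords L \<psi> z $ i $ 2 * D1 Y (H z) =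
      D1 (\<lambda>z. \<Psi> z $ i) (H z) * T (H z) $ 1 $ 1 + D2 (\<lambda>z. \<Psi> z $ i) (H z) * T (H z) $ 2 $ 1"
      "in_coords L \<psi> z $ i $ 1 * D2 X (H z) + in_coords L \<psi> z $ i $ 2 * D2 Y (H z) =
      D1 (\<lambda>z. \<Psi> z $ i) (H z) * T (H z) $ 1 $ 2 + D2 (\<lambda>z. \<Psi> z $ i) (H z) * T (H z) $ 2 $ 2"
      using t unfolding HV(2)[OF z] P12 T_def by auto
  qed
  note tr1 = tr[where i = 1, unfolded P12] and tr2 = tr[where i = 2, unfolded P12]
  have inv: "tr2 (in_coords L \<psi> z) = tr2 (T (H z))" "neg_det (in_coords L \<psi> z) = neg_det (T (H z))"
    if z: "z \<in> V" for z
  proof -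
    define a b c d where abcd: "a = in_coords L \<psi> z $ 1 $ 1" "b = in_coords L \<psi> z $ 1 $ 2"
      "c = in_coords L \<psi> z $ 2 $ 1" "d = in_coords L \<psi> z $ 2 $ 2"
    define a' b' c' d' where abcd': "a' = T (H z) $ 1 $ 1" "b' = T (H z) $ 1 $ 2"
      "c' = T (H z) $ 2 $ 1" "d' = T (H z) $ 2 $ 2"
    define x1 x2 y1 y2 where xy: "x1 = D1 X (H z)" "x2 = D2 X (H z)" "y1 = D1 Y (H z)" "y2 = D2 Y (H z)"
    have e: "a * x1 + b * y1 = x1 * a' + x2 * c'" "a * x2 + b * y2 = x1 * b' + x2 * d'"
      "c * x1 + d * y1 = y1 * a' + y2 * c'" "c * x2 + d * y2 = y1 * b' + y2 * d'"
      using tr1[OF z] tr2[OF z] by (auto simp: abcd abcd' xy)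
    have D: "x1 * y2 - x2 * y1 \<noteq> 0" using Jn[OF z] by (simp add: J_def xy)
    \<comment> \<open>Multiplied by det J, invariance of the trace is a polynomial consequence of
      the four identities; the determinant below is treated likewise.\<close>
    have "(x1 * y2 - x2 * y1) * (a + d) = (x1 * y2 - x2 * y1) * (a' + d')"
      using e by algebra
    then have 1: "a + d = a' + d'" using D by simp
    have "(x1 * y2 - x2 * y1) * (b * c - a * d) = (x1 * y2 - x2 * y1) * (b' * c' - a' * d')"
      using e by algebra
    then have 2: "b * c - a * d = b' * c' - a' * d'" using D by simp
    show "tr2 (in_coords L \<psi> z) = tr2 (T (H z))" "neg_det (in_coords L \<psi> z) = neg_det (T (H z))"
      using 1 2 by (simp_all add: tr2_def neg_det_def abcd abcd')
  qed
  have XY: "X (H z) = z $ 1" "Y (H z) = z $ 2" if "z \<in> V" for z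
    using HV(2)[OF that] by (auto simp: \<Psi>_def vec2_eq_iff)
  show ?thesis
    by (rule that[of \<psi> H, unfolded im])
       (use cen V0' US HV PH XY Jn tr1 tr2 inv in \<open>auto simp: J_def\<close>)
qed

text \<open>A translation moves p to the origin. Its Jacobian matrix is the identity, so the matrix
  of the operator at p does not change.\<close>

lemma centred_chart_exists:
  fixes c\<^sub>0 :: "'m::topological_space chart"
  assumes atlas: "analytic_atlas A" and W: "open W" "p \<in> W" and L: "analytic_nijenhuis_operator A W L"
    and c: "c\<^sub>0 \<in> charts A" "p \<in> fst c\<^sub>0"
  obtains \<phi> where "centred A W p \<phi>" "in_coords L \<phi> 0 = L c\<^sub>0 p"
proof -
  let ?i = "inv_into (fst c\<^sub>0) (snd c\<^sub>0)"
  define a where "a = snd c\<^sub>0 p"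
  have ch: "is_chart c\<^sub>0" using c by (simp add: charts_def)
  define U where "U = snd c\<^sub>0 ` fst c\<^sub>0 \<inter> ?i -` W"
  have "continuous_on (snd c\<^sub>0 ` fst c\<^sub>0) ?i" "open (snd c\<^sub>0 ` fst c\<^sub>0)"
    using ch by (auto simp: is_chart_def homeomorphism_def)
  then have oU: "open U" unfolding U_def using W(1) by (intro continuous_open_preimage)
  have US': "U \<subseteq> snd c\<^sub>0 ` (W \<inter> fst c\<^sub>0)"
    using is_chart_inv[OF ch] by (fastforce simp: U_def)
  then have US: "U \<subseteq> snd c\<^sub>0 ` fst c\<^sub>0" by blast
  have aU: "a \<in> U" using c W is_chart_inv(1)[OF ch c(2)] by (auto simp: U_def a_def)
  let ?\<Psi> = "\<lambda>z. z - a" and ?H = "\<lambda>z. z + a"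
  define V where "V = ?\<Psi> ` U"
  have oV: "open V" unfolding V_def using open_translation_subtract[OF oU] by simp
  have hom: "homeomorphism U V ?\<Psi> ?H"
    unfolding V_def by (rule homeomorphismI) (auto intro!: continuous_intros)
  have an1: "real_analytic_at (\<lambda>z. (z - a) $ i) z" and an2: "real_analytic_at (\<lambda>z. (z + a) $ i) z" for z i
    using exhaust_2[of i] by (auto intro!: analytic_diff analytic_add)
  define \<psi> where "\<psi> = (fst c\<^sub>0 \<inter> snd c\<^sub>0 -` U, ?\<Psi> \<circ> snd c\<^sub>0)"
  note cc = chart_compose[OF atlas c(1) oU US oV hom an1 an2 \<psi>_def]
  have fW: "fst \<psi> \<subseteq> W"
  proof
    fix q assume "q \<in> fst \<psi>"
    then have "q \<in> fst c\<^sub>0" "?i (snd c\<^sub>0 q) \<in> W" by (simp_all add: \<psi>_def U_def)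
    then show "q \<in> W" using is_chart_inv(1)[OF ch] by simp
  qed
  have cen: "centred A W p \<psi>"
    using cc(1) c aU fW by (auto simp: centred_def \<psi>_def a_def)
  have 0: "0 \<in> V" using aU by (force simp: V_def)
  have inv: "inv_into (fst \<psi>) (snd \<psi>) (?\<Psi> a) = ?i a" using cc(3)[OF 0] by simp
  have op: "operator_field A W L" using L by (simp add: analytic_nijenhuis_operator_def)
  have D: "D1 (\<lambda>z. (z - a) $ 1) a = 1" "D2 (\<lambda>z. (z - a) $ 1) a = 0" "D1 (\<lambda>z. (z - a) $ 2) a = 0" "D2 (\<lambda>z. (z - a) $ 2) a = 1"
    by (simp_all add: D_diff)
  have det: "D1 (\<lambda>z. (z - a) $ 1) a * D2 (\<lambda>z. (z - a) $ 2) a - D2 (\<lambda>z. (z - a) $ 1) a * D1 (\<lambda>z. (z - a) $ 2) a \<noteq> 0"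
    unfolding D by simp
  note t = operator_transform[OF op c(1) cc(1) \<psi>_def oU US' inv an1 aU det]
  have "in_coords L \<psi> 0 = in_coords L c\<^sub>0 a"
    by (rule mat2_eqI) (use t[of 1] t[of 2] in \<open>simp_all only: D, simp_all\<close>)
  also have "\<dots> = L c\<^sub>0 p" using is_chart_inv(1)[OF ch c(2)] by (simp add: in_coords_def a_def)
  finally show ?thesis using that cen by blast
qed

section \<open>Normal forms of the trace\<close>

lemma eventually_axis:
  assumes "\<forall>\<^sub>F z in nhds 0. P z"
  shows "\<forall>\<^sub>F z::real^2 in nhds 0. P (vec2 (z $ 1) 0)" "\<forall>\<^sub>F z::real^2 in nhds 0. P (vec2 0 (z $ 2))"
  by (rule eventually_vec2_compose[of "\<lambda>z. z $ 1" 0 "\<lambda>_. 0"], use assms in simp_all)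
     (rule eventually_vec2_compose[of "\<lambda>_. 0" 0 "\<lambda>z. z $ 2"], use assms in simp_all)

lemma eventually_D_cong:
  assumes "\<forall>\<^sub>F z in nhds a. f z = g z"
  shows "\<forall>\<^sub>F z in nhds a. D1 f z = D1 g z \<and> D2 f z = D2 g z"
proof -
  have "\<forall>\<^sub>F z in nhds a. \<forall>\<^sub>F x in nhds z. f x = g x"
    using assms by (simp add: eventually_eventually)
  then show ?thesis by eventually_elim (auto intro: D_cong)
qed

lemma D_ypow:
  assumes "real_analytic_at f a"
  shows "D1 (\<lambda>z. (z $ 2) ^ n * f z) a = (a $ 2) ^ n * D1 f a"
    "D2 (\<lambda>z. (z $ 2) ^ n * f z) a = (a $ 2) ^ n * D2 f a + real n * (a $ 2) ^ (n - 1) * f a"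
  using assms by (simp_all add: D_mult D_power analytic_power)

lemma analytic_ypow [simp]: "real_analytic_at (\<lambda>z. (z $ 2) ^ n) a"
  by (intro analytic_power analytic_y)

lemma eventually_D_ypow:
  assumes w: "real_analytic_at w 0" and v: "\<forall>\<^sub>F z in nhds 0. v z = (z $ 2) ^ r * w z"
  shows "\<forall>\<^sub>F z in nhds 0. D1 v z = (z $ 2) ^ r * D1 w z \<and>
           D2 v z = (z $ 2) ^ r * D2 w z + real r * (z $ 2) ^ (r - 1) * w z"
  using analytic_eventually[OF w] eventually_D_cong[OF v] by eventually_elim (simp add: D_ypow)

text \<open>The x-dependent part of h is y^s H with H a primitive of g, and the rest is a function
  of y of order at least q. Taylor terms of order q + k = s + 1 or more have the form y^s (y h1) and
  can be absorbed into the new coordinate X; exactly k coefficients are left over. The number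
  \<alpha> only rescales X.\<close>

lemma normalise_x:
  assumes h: "real_analytic_at h 0" and g0: "real_analytic_at g0 0" "\<forall>\<^sub>F z in nhds 0. h z = (z $ 2) ^ q * g0 z"
    and g: "real_analytic_at g 0" "g 0 \<noteq> 0" "\<forall>\<^sub>F z in nhds 0. D1 h z = (z $ 2) ^ s * g z"
    and qs: "q + k = Suc s" "k \<ge> 1" and \<alpha>: "\<alpha> \<noteq> 0"
  obtains X c where "real_analytic_at X 0" "X 0 = 0" "D1 X 0 \<noteq> 0" "c 0 = g0 0"
    "\<forall>\<^sub>F z in nhds 0. h z = \<alpha> * X z * (z $ 2) ^ s + (z $ 2) ^ q * cpoly k c (z $ 2)"
proof -
  obtain c h1 where c: "real_analytic_at h1 0"
    "\<forall>\<^sub>F z::real^2 in nhds 0. g0 (vec2 0 (z $ 2)) = (\<Sum>i<k. c i * (z $ 2) ^ i) + (z $ 2) ^ k * h1 z"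
    "\<And>z. h1 z = h1 (vec2 0 (z $ 2))"
    by (rule taylor_in_y[OF g0(1), where n = k]) (rule that)
  obtain H where H: "real_analytic_at H 0" "\<forall>\<^sub>F z in nhds 0. D1 H z = g z" "\<And>y. H (vec2 0 y) = 0"
    by (rule analytic_primitive[OF g(1)]) (rule that)
  have "g0 0 = (\<Sum>i<k. c i * 0 ^ i)"
    using eventually_nhds_x_imp_x[OF c(2)] qs(2) by simp
  also have "\<dots> = c 0" using qs(2) by (cases k) (simp_all add: sum.lessThan_Suc_shift del: sum.lessThan_Suc)
  finally have c0: "c 0 = g0 0" by simp
  define X where "X = (\<lambda>z. inverse \<alpha> * (H z + z $ 2 * h1 z))"
  have yh: "real_analytic_at (\<lambda>z. z $ 2 * h1 z) 0" by (intro analytic_mult analytic_y c(1))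
  have anX: "real_analytic_at X 0" unfolding X_def by (intro analytic_mult analytic_add analytic_const H(1) yh)
  have H0: "H 0 = 0" using H(3)[of 0] by simp
  have X0: "X 0 = 0" by (simp add: X_def H0)
  have "D1 X 0 = inverse \<alpha> * (D1 H 0 + 0)"
    unfolding X_def by (simp add: D_mult D_add analytic_add H(1) yh c(1))
  then have D1X: "D1 X 0 \<noteq> 0" using eventually_nhds_x_imp_x[OF H(2)] g(2) \<alpha> by simp
  \<comment> \<open>The derivative of f in x vanishes, so f coincides with h on x = 0 and with its
    value there along each x-line.\<close>
  define f where "f = (\<lambda>z. h z - (z $ 2) ^ s * H z)"
  have anf: "real_analytic_at f 0" unfolding f_def by (intro analytic_diff analytic_mult analytic_ypow h H(1))
  have "\<forall>\<^sub>F z in nhds 0. D1 f z = 0"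
    using analytic_eventually[OF h] analytic_eventually[OF H(1)] H(2) g(3)
    by eventually_elim (simp add: f_def D_diff D_ypow analytic_mult)
  from D1_zero_const[OF anf this] eventually_axis(2)[OF g0(2)] c(2)
  have "\<forall>\<^sub>F z in nhds 0. h z = \<alpha> * X z * (z $ 2) ^ s + (z $ 2) ^ q * cpoly k c (z $ 2)"
  proof eventually_elim
    case (elim z)
    have "h z = (z $ 2) ^ s * H z + h (vec2 0 (z $ 2))"
      using elim(1) by (simp add: f_def H(3))
    also have "h (vec2 0 (z $ 2)) = (z $ 2) ^ q * ((\<Sum>i<k. c i * (z $ 2) ^ i) + (z $ 2) ^ k * h1 z)"
      using elim(2,3) by simp
    also have "\<dots> = (z $ 2) ^ q * cpoly k c (z $ 2) + (z $ 2) ^ (q + k) * h1 z"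
      by (simp add: cpoly_def power_add algebra_simps)
    also have "(z $ 2) ^ (q + k) = (z $ 2) ^ s * z $ 2" by (simp add: qs(1))
    finally have "h z = (H z + z $ 2 * h1 z) * (z $ 2) ^ s + (z $ 2) ^ q * cpoly k c (z $ 2)"
      by (simp add: algebra_simps)
    moreover have "\<alpha> * X z = H z + z $ 2 * h1 z" using \<alpha> by (simp add: X_def)
    ultimately show ?case by simp
  qed
  then show ?thesis using that[of X c, OF anX X0 D1X c0] by blast
qed

text \<open>In coordinates with \<open>u = \<epsilon> y\<^sup>d\<close> the second row of the operator is \<open>(y v\<^sub>x / d, y v\<^sub>y / d)\<close>,
  and the Nijenhuis equations reduce to the equation \<open>eq\<close> for the trace \<open>v\<close>, in which \<open>m\<close> is the
  upper right entry. The cases are distinguished by comparing \<open>d\<close> with twice the order \<open>r\<close> of \<open>v\<close> in \<open>y\<close>.\<close>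

lemma trace_normal_form:
  fixes \<epsilon> :: real
  assumes v: "real_analytic_at v 0" and m: "real_analytic_at m 0" "m 0 \<noteq> 0" and v0: "v 0 = 0" and d: "2 \<le> d"
    and \<epsilon>: "\<epsilon> \<in> {1, -1}" "odd d \<longrightarrow> \<epsilon> = 1"
    and eq: "\<forall>\<^sub>F z in nhds 0. m z * D1 v z = real d * \<epsilon> * (z $ 2) ^ (d - 1) + D2 v z * (v z - z $ 2 * D2 v z / real d)"
  shows "(\<exists>k\<ge>1. \<exists>\<sigma>\<in>{1, -1}. d = 2 * k \<and> \<epsilon> = -1 \<and> (\<forall>\<^sub>F z in nhds 0. v z = 2 * \<sigma> * (z $ 2) ^ k)) \<or>
    (\<exists>X. real_analytic_at X 0 \<and> X 0 = 0 \<and> D1 X 0 \<noteq> 0 \<and>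
      ((\<exists>k\<ge>1. 2 * k + 1 \<le> d \<and> (\<exists>c. O_alpha k d c \<noteq> 0 \<and> (\<forall>\<^sub>F z in nhds 0. v z = O_v k d c (vec2 (X z) (z $ 2))))) \<or>
       (\<exists>k\<ge>1. \<exists>s\<ge>2*k. \<exists>\<sigma>\<in>{1, -1}. \<exists>c. d = 2 * k \<and> \<epsilon> = -1 \<and> P_alpha k \<sigma> c \<noteq> 0 \<and>
          (\<forall>\<^sub>F z in nhds 0. v z = P_v k \<sigma> s c (vec2 (X z) (z $ 2)))) \<or>
       (\<exists>k\<ge>1. \<exists>c. d = 2 * k \<and> S_even_alpha k \<epsilon> c \<noteq> 0 \<and> (\<forall>\<^sub>F z in nhds 0. v z = S_even_v k \<epsilon> c (vec2 (X z) (z $ 2)))) \<or>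
       (\<exists>k\<ge>1. \<exists>c. d = 2 * k + 1 \<and> (\<forall>\<^sub>F z in nhds 0. v z = S_odd_v k c (vec2 (X z) (z $ 2))))))"
    (is "?N \<or> (\<exists>X. ?X X \<and> X 0 = 0 \<and> D1 X 0 \<noteq> 0 \<and> (?O X \<or> ?P X \<or> ?S0 X \<or> ?S1 X))")
proof -
  have \<epsilon>0: "\<epsilon> \<noteq> 0" using \<epsilon> by auto
  have mnz: "\<forall>\<^sub>F z in nhds 0. m z \<noteq> 0" by (rule analytic_nonzero[OF m])
  have vnz: "\<not> (\<forall>\<^sub>F z in nhds 0. v z = 0)"
  proof
    assume z: "\<forall>\<^sub>F z in nhds 0. v z = 0"
    from eventually_D_cong[OF this] z eq
    have "\<forall>\<^sub>F z::real^2 in nhds 0. (z $ 2) ^ (d - 1) * (real d * \<epsilon>) = (z $ 2) ^ (d - 1) * 0"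
      by eventually_elim auto
    from eventually_nhds_x_imp_x[OF cancel_power_y[OF _ _ this]] show False using \<epsilon>0 d by simp
  qed
  obtain r w where w: "real_analytic_at w 0" and vw: "\<forall>\<^sub>F z in nhds 0. v z = (z $ 2) ^ r * w z"
    and wnz: "\<not> (\<forall>\<^sub>F z::real^2 in nhds 0. w (vec2 (z $ 1) 0) = 0)"
    by (rule analytic_order_y[OF v vnz]) (rule that)
  \<comment> \<open>On y = 0 the equation reads m v_x = v v_y, because d is at least 2. This is
    linear in v with coefficient v_y / m, so v(0) = 0 would make v vanish on the axis, and r = 0 is
    impossible.\<close>
  have r: "r \<ge> 1"
  proof (rule ccontr)
    assume "\<not> r \<ge> 1"
    then have "r = 0" by simp
    then have vw': "\<forall>\<^sub>F z in nhds 0. v z = w z" using vw by simp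
    have "\<forall>\<^sub>F z::real^2 in nhds 0. D1 v (vec2 (z $ 1) 0) = (D2 v (vec2 (z $ 1) 0) / m (vec2 (z $ 1) 0)) * v (vec2 (z $ 1) 0)"
      using eventually_axis(1)[OF eq] eventually_axis(1)[OF mnz]
      by eventually_elim (use d in \<open>simp add: field_simps\<close>)
    from linear_ode_zero[OF v _ v0 this]
    have "\<forall>\<^sub>F z::real^2 in nhds 0. v (vec2 (z $ 1) 0) = 0"
      using analytic_divide[OF analytic_D2[OF v] m] by simp
    with eventually_axis(1)[OF vw'] have "\<forall>\<^sub>F z::real^2 in nhds 0. w (vec2 (z $ 1) 0) = 0"
      by eventually_elim simp
    then show False using wnz by simp
  qed
  \<comment> \<open>Chosen so that v_y = y^(r-1) B and v_y (v - y v_y / d) = y^(2r-1) Q. On y = 0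
    one has B = r w, hence Q = r (1 - r/d) w^2.\<close>
  define B where "B = (\<lambda>z. real r * w z + z $ 2 * D2 w z)"
  define Q where "Q = (\<lambda>z. B z * (w z - B z / real d))"
  have anB: "real_analytic_at B 0" unfolding B_def by (intro analytic_add analytic_mult analytic_const analytic_y w analytic_D2)
  have anQ: "real_analytic_at Q 0" unfolding Q_def by (intro analytic_diff analytic_mult analytic_divide analytic_const anB w) (use d in simp)
  have Q0: "Q z = real r * (1 - real r / real d) * (w z)\<^sup>2" if "z $ 2 = 0" for z
    using d that by (simp add: Q_def B_def power2_eq_square field_simps)
  note Dv = eventually_D_ypow[OF w vw]
  have eq1: "\<forall>\<^sub>F z in nhds 0. m z * D1 v z = real d * \<epsilon> * (z $ 2) ^ (d - 1) + (z $ 2) ^ (2 * r - 1) * Q z"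
    using eq vw Dv
  proof eventually_elim
    case (elim z)
    obtain r' where r': "r = Suc r'" using r by (cases r) auto
    have 1: "D2 v z = (z $ 2) ^ r' * B z" using elim(3) by (simp add: B_def r' algebra_simps)
    have 2: "v z - z $ 2 * D2 v z / real d = (z $ 2) ^ r * (w z - B z / real d)"
      using elim(2) unfolding 1 by (simp add: r' algebra_simps)
    have "D2 v z * (v z - z $ 2 * D2 v z / real d) = ((z $ 2) ^ r' * (z $ 2) ^ r) * Q z"
      unfolding 2 unfolding 1 Q_def by (simp only: mult_ac)
    also have "(z $ 2) ^ r' * (z $ 2) ^ r = (z $ 2) ^ (2 * r - 1)"
      by (simp add: r' flip: power_add mult_2)
    finally show ?case using elim(1) by simp
  qed
  have eq2: "\<forall>\<^sub>F z in nhds 0. m z * ((z $ 2) ^ r * D1 w z) = real d * \<epsilon> * (z $ 2) ^ (d - 1) + (z $ 2) ^ (2 * r - 1) * Q z"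
    using eq1 Dv by eventually_elim simp
  \<comment> \<open>For r >= d every term of \<open>eq2\<close> except d \<epsilon> y^(d-1) is
    divisible by y^d, which is absurd.\<close>
  have rd: "r < d"
  proof (rule ccontr)
    assume "\<not> r < d"
    then have e: "r = (d - 1) + (r - (d - 1))" "2 * r - 1 = (d - 1) + (2 * r - d)" "r - (d - 1) \<noteq> 0" "2 * r - d \<noteq> 0"
      using d by auto
    have "\<forall>\<^sub>F z in nhds 0. (z $ 2) ^ (d - 1) * (m z * ((z $ 2) ^ (r - (d - 1)) * D1 w z)) =
        (z $ 2) ^ (d - 1) * (real d * \<epsilon> + (z $ 2) ^ (2 * r - d) * Q z)"
      using eq2
    proof eventually_elim
      case (elim z)
      have "(z $ 2) ^ r = (z $ 2) ^ (d - 1) * (z $ 2) ^ (r - (d - 1))"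
        "(z $ 2) ^ (2 * r - 1) = (z $ 2) ^ (d - 1) * (z $ 2) ^ (2 * r - d)"
        using e(1,2) by (metis power_add)+
      then show ?case using elim by (simp add: algebra_simps)
    qed
    from eventually_nhds_x_imp_x[OF cancel_power_y[OF _ _ this]]
    have "m 0 * ((0::real) ^ (r - (d - 1)) * D1 w 0) = real d * \<epsilon> + 0 ^ (2 * r - d) * Q 0"
      using analytic_mult[OF m(1) analytic_mult[OF analytic_ypow analytic_D1[OF w]]] analytic_add[OF analytic_const analytic_mult[OF analytic_ypow anQ]] by simp
    then show False using e(3,4) \<epsilon>0 d by (simp add: zero_power)
  qed
  show ?thesis
  proof (cases "d < 2 * r")
    case True
    \<comment> \<open>Now d - 1 < 2r - 1, so d \<epsilon> y^(d-1) dominates and v_x has order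
      exactly d - 1. The parity of d then selects the even or the odd series S.\<close>
    define g where "g = (\<lambda>z. (real d * \<epsilon> + (z $ 2) ^ (2 * r - d) * Q z) / m z)"
    have g: "real_analytic_at g 0" unfolding g_def by (intro analytic_divide analytic_add analytic_const analytic_mult analytic_ypow anQ m)
    have g0: "g 0 \<noteq> 0" using True d \<epsilon>0 m(2) by (simp add: g_def zero_power)
    have Dg: "\<forall>\<^sub>F z in nhds 0. D1 v z = (z $ 2) ^ (d - 1) * g z"
      using eq1 mnz
    proof eventually_elim
      case (elim z)
      have "2 * r - 1 = (d - 1) + (2 * r - d)" using True d by simp
      then have "(z $ 2) ^ (2 * r - 1) = (z $ 2) ^ (d - 1) * (z $ 2) ^ (2 * r - d)" by (metis power_add)
      then have "m z * D1 v z = (z $ 2) ^ (d - 1) * (real d * \<epsilon> + (z $ 2) ^ (2 * r - d) * Q z)"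
        using elim by (simp add: algebra_simps)
      then show ?case using elim(2) by (simp add: g_def field_simps)
    qed
    show ?thesis
    proof (cases "even d")
      case ev: True
      then obtain k where k: "d = 2 * k" by (elim evenE)
      have k1: "k \<ge> 1" "k < r" using d k True by auto
      let ?g0 = "\<lambda>z. (z $ 2) ^ (r - k) * w z"
      have vg0: "\<forall>\<^sub>F z in nhds 0. v z = (z $ 2) ^ k * ?g0 z"
        using vw
      proof eventually_elim
        case (elim z)
        have "r = k + (r - k)" using k1 by simp
        then have "(z $ 2) ^ r = (z $ 2) ^ k * (z $ 2) ^ (r - k)" by (metis power_add)
        then show ?case using elim by simp
      qed
      have ang0: "real_analytic_at ?g0 0" by (intro analytic_mult analytic_ypow w)
      have \<alpha>: "2 * real k * \<epsilon> \<noteq> 0" using k1 \<epsilon>0 by simp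
      have kk: "k + k = Suc (d - 1)" using k d by simp
      obtain X c where
        X: "real_analytic_at X 0" "X 0 = 0" "D1 X 0 \<noteq> 0" "c 0 = (0::real^2) $ 2 ^ (r - k) * w 0"
        "\<forall>\<^sub>F z in nhds 0. v z = 2 * real k * \<epsilon> * X z * (z $ 2) ^ (d - 1) + (z $ 2) ^ k * cpoly k c (z $ 2)"
        by (rule normalise_x[OF v ang0 vg0 g g0 Dg kk k1(1) \<alpha>]) (rule that)
      \<comment> \<open>Since k < r, the coefficient of y^k in v(0, y) is zero, and the general
        constant of the even series S reduces to 2 k \<epsilon>.\<close>
      have c0: "c 0 = 0" using X(4) k1 by (simp add: zero_power)
      have a: "S_even_alpha k \<epsilon> c = 2 * real k * \<epsilon>" by (simp add: S_even_alpha_def c0)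
      have "?S0 X"
        using X(5) k1(1) \<alpha> k by (intro exI[of _ k] conjI exI[of _ c]) (simp_all add: a S_even_v_def)
      then show ?thesis using X(1,2,3) by blast
    next
      case od: False
      then obtain k where k: "d = 2 * k + 1" by (elim oddE)
      have k1: "k \<ge> 1" "k < r" using d k True by auto
      let ?g0 = "\<lambda>z. (z $ 2) ^ (r - (k + 1)) * w z"
      have vg0: "\<forall>\<^sub>F z in nhds 0. v z = (z $ 2) ^ (k + 1) * ?g0 z"
        using vw
      proof eventually_elim
        case (elim z)
        have "r = (k + 1) + (r - (k + 1))" using k1 by simp
        then have "(z $ 2) ^ r = (z $ 2) ^ (k + 1) * (z $ 2) ^ (r - (k + 1))" by (metis power_add)
        then show ?case using elim by simp
      qed
      have ang0: "real_analytic_at ?g0 0" by (intro analytic_mult analytic_ypow w)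
      have \<alpha>: "real (2 * k + 1) \<noteq> 0" by simp
      have kk: "(k + 1) + k = Suc (d - 1)" using k d by simp
      obtain X c where
        X: "real_analytic_at X 0" "X 0 = 0" "D1 X 0 \<noteq> 0" "c 0 = (0::real^2) $ 2 ^ (r - (k + 1)) * w 0"
        "\<forall>\<^sub>F z in nhds 0. v z = real (2 * k + 1) * X z * (z $ 2) ^ (d - 1) + (z $ 2) ^ (k + 1) * cpoly k c (z $ 2)"
        by (rule normalise_x[OF v ang0 vg0 g g0 Dg kk k1(1) \<alpha>]) (rule that)
      have "?S1 X"
        using X(5) k1(1) k by (intro exI[of _ k] conjI exI[of _ c]) (simp_all add: S_odd_v_def)
      then show ?thesis using X(1,2,3) by blast
    qed
  next
    case False
    then have dr: "2 * r \<le> d" by simp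
    \<comment> \<open>Here 2r - 1 <= d - 1, so y^(2r-1) can be taken out; the exponent d - 2r is
      zero exactly in the balanced case, where both summands of R count at the origin.\<close>
    define R where "R = (\<lambda>z. real d * \<epsilon> * (z $ 2) ^ (d - 2 * r) + Q z)"
    have anR: "real_analytic_at R 0" unfolding R_def by (intro analytic_add analytic_mult analytic_const analytic_ypow anQ)
    have eq3: "\<forall>\<^sub>F z in nhds 0. m z * D1 v z = (z $ 2) ^ (2 * r - 1) * R z"
      using eq1
    proof eventually_elim
      case (elim z)
      have "d - 1 = (2 * r - 1) + (d - 2 * r)" using dr r by simp
      then have "(z $ 2) ^ (d - 1) = (z $ 2) ^ (2 * r - 1) * (z $ 2) ^ (d - 2 * r)" by (metis power_add)
      then show ?case using elim by (simp add: R_def algebra_simps)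
    qed
    let ?g = "\<lambda>z. R z / m z"
    have g: "real_analytic_at ?g 0" by (intro analytic_divide anR m)
    have Dg: "\<forall>\<^sub>F z in nhds 0. D1 v z = (z $ 2) ^ (2 * r - 1) * ?g z"
      using eq3 mnz by eventually_elim (simp add: field_simps)
    have rr: "r + r = Suc (2 * r - 1)" using r by simp
    show ?thesis
    proof (cases "2 * r < d")
      case True
      \<comment> \<open>If w(0) = 0, dividing \<open>eq3\<close> by y^r and restricting to y = 0
        gives m w_x = 0^(r-1) r (1 - r/d) w^2. One factor w is put into the coefficient, so this is
        a linear equation and w vanishes on the axis. The convention 0^0 = 1 covers r = 1.\<close>
      have "w 0 \<noteq> 0"
      proof
        assume w0: "w 0 = 0"
        have "\<forall>\<^sub>F z in nhds 0. (z $ 2) ^ r * (m z * D1 w z) = (z $ 2) ^ r * ((z $ 2) ^ (r - 1) * R z)"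
          using eq3 Dv
        proof eventually_elim
          case (elim z)
          have "2 * r - 1 = r + (r - 1)" using r by simp
          then have "(z $ 2) ^ (2 * r - 1) = (z $ 2) ^ r * (z $ 2) ^ (r - 1)" by (metis power_add)
          then show ?case using elim by (simp add: algebra_simps)
        qed
        from cancel_power_y[OF _ _ this]
        have "\<forall>\<^sub>F z in nhds 0. m z * D1 w z = (z $ 2) ^ (r - 1) * R z"
          by (simp add: analytic_mult m analytic_D1 w anR)
        from eventually_axis(1)[OF this] eventually_axis(1)[OF mnz]
        have "\<forall>\<^sub>F z::real^2 in nhds 0. D1 w (vec2 (z $ 1) 0) =
            (0 ^ (r - 1) * (real r * (1 - real r / real d)) * w (vec2 (z $ 1) 0) / m (vec2 (z $ 1) 0)) * w (vec2 (z $ 1) 0)"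
        proof eventually_elim
          case (elim z)
          have "R (vec2 (z $ 1) 0) = real r * (1 - real r / real d) * (w (vec2 (z $ 1) 0))\<^sup>2"
            using True Q0[of "vec2 (z $ 1) 0"] by (simp add: R_def zero_power)
          then have "m (vec2 (z $ 1) 0) * D1 w (vec2 (z $ 1) 0) =
              0 ^ (r - 1) * (real r * (1 - real r / real d) * (w (vec2 (z $ 1) 0))\<^sup>2)"
            using elim(1) by simp
          then show ?case using elim(2) by (simp add: eq_divide_eq power2_eq_square mult_ac)
        qed
        from linear_ode_zero[OF w _ w0 this] show False
          using wnz analytic_divide[OF analytic_mult[OF analytic_const w] m] by simp
      qed
      have \<alpha>: "real r * (w 0)\<^sup>2 * (1 - real r / real d) \<noteq> 0"
        using \<open>w 0 \<noteq> 0\<close> r rd by simp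
      have g0: "?g 0 \<noteq> 0" using True Q0[of 0] \<alpha> m by (simp add: R_def zero_power)
      obtain X c where
        X: "real_analytic_at X 0" "X 0 = 0" "D1 X 0 \<noteq> 0" "c 0 = w 0"
        "\<forall>\<^sub>F z in nhds 0. v z = real r * (w 0)\<^sup>2 * (1 - real r / real d) * X z * (z $ 2) ^ (2 * r - 1)
            + (z $ 2) ^ r * cpoly r c (z $ 2)" by (rule normalise_x[OF v w vw g g0 Dg rr r \<alpha>]) (rule that)
      have a: "O_alpha r d c = real r * (w 0)\<^sup>2 * (1 - real r / real d)" by (simp add: O_alpha_def X(4))
      have "?O X"
        using X(5) r True \<alpha> by (intro exI[of _ r] conjI exI[of _ c]) (simp_all add: a O_v_def)
      then show ?thesis using X(1,2,3) by blast
    next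
      case False
      then have d2: "d = 2 * r" using dr by simp
      have R0: "R 0 = real r / 2 * ((w 0)\<^sup>2 + 4 * \<epsilon>)"
        using Q0[of 0] r by (simp add: R_def d2 field_simps)
      show ?thesis
      \<comment> \<open>The discriminant v^2 + 4u of the characteristic polynomial is y^(2r) (w^2 +
        4 \<epsilon>). Whether its second factor vanishes at the origin decides whether v_x has
        order 2r - 1.\<close>
      proof (cases "(w 0)\<^sup>2 + 4 * \<epsilon> = 0")
        case False
        then have \<alpha>: "real r / 2 * ((w 0)\<^sup>2 + 4 * \<epsilon>) \<noteq> 0" using r by simp
        have g0: "?g 0 \<noteq> 0" using \<alpha> m(2) unfolding R0 by simp
        obtain X c where
          X: "real_analytic_at X 0" "X 0 = 0" "D1 X 0 \<noteq> 0" "c 0 = w 0"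
          "\<forall>\<^sub>F z in nhds 0. v z = real r / 2 * ((w 0)\<^sup>2 + 4 * \<epsilon>) * X z * (z $ 2) ^ (2 * r - 1)
              + (z $ 2) ^ r * cpoly r c (z $ 2)" by (rule normalise_x[OF v w vw g g0 Dg rr r \<alpha>]) (rule that)
        have a: "S_even_alpha r \<epsilon> c = real r / 2 * ((w 0)\<^sup>2 + 4 * \<epsilon>)" by (simp add: S_even_alpha_def X(4))
        have "?S0 X"
          using X(5) r d2 \<alpha> by (intro exI[of _ r] conjI exI[of _ c]) (simp_all add: a S_even_v_def)
        then show ?thesis using X(1,2,3) by blast
      next
        case True
        have em: "\<epsilon> = -1"
        proof (rule ccontr)
          assume "\<epsilon> \<noteq> -1"
          then have "(w 0)\<^sup>2 + 4 = 0" using \<epsilon>(1) True by auto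
          then show False using zero_le_power2[of "w 0"] by linarith
        qed
        then have "(w 0)\<^sup>2 = 2\<^sup>2" using True by simp
        then have "w 0 = 2 \<or> w 0 = -2" by (simp only: power2_eq_iff)
        then obtain \<sigma> :: real where \<sigma>: "\<sigma> \<in> {1, -1}" "w 0 = 2 * \<sigma>" by fastforce
        have \<sigma>2: "\<sigma> * \<sigma> = 1" using \<sigma>(1) by auto
        \<comment> \<open>For v = 2 \<sigma> y^r and u = -y^(2r) both eigenvalues equal \<sigma>
          y^r; h measures the deviation from this exact solution.\<close>
        define h where "h = (\<lambda>z. v z - 2 * \<sigma> * (z $ 2) ^ r)"
        have h: "real_analytic_at h 0" unfolding h_def by (intro analytic_diff v analytic_mult analytic_const analytic_ypow)
        show ?thesis
        proof (cases "\<forall>\<^sub>F z in nhds 0. h z = 0")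
          case True
          then have "\<forall>\<^sub>F z in nhds 0. v z = 2 * \<sigma> * (z $ 2) ^ r"
            by eventually_elim (simp add: h_def)
          then have ?N using r \<sigma>(1) d2 em by blast
          then show ?thesis by blast
        next
          case False
          obtain q g where ang: "real_analytic_at g 0" and hg: "\<forall>\<^sub>F z in nhds 0. h z = (z $ 2) ^ q * g z"
            and gnz: "\<not> (\<forall>\<^sub>F z::real^2 in nhds 0. g (vec2 (z $ 1) 0) = 0)"
            by (rule analytic_order_y[OF h False]) (rule that)
          have q1: "q \<ge> 1"
          proof (rule ccontr)
            assume "\<not> q \<ge> 1"
            then have "q = 0" by simp
            from eventually_axis(1)[OF hg] eventually_axis(1)[OF vw]
            have "\<forall>\<^sub>F z::real^2 in nhds 0. g (vec2 (z $ 1) 0) = 0"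
              by eventually_elim (use r \<open>q = 0\<close> in \<open>simp add: h_def zero_power\<close>)
            then show False using gnz by simp
          qed
          define C where "C = (\<lambda>z. real q * g z + z $ 2 * D2 g z)"
          define K where "K = (\<lambda>z. C z * (g z - C z / real d))"
          have anC: "real_analytic_at C 0" unfolding C_def by (intro analytic_add analytic_mult analytic_const analytic_y ang analytic_D2)
          have anK: "real_analytic_at K 0" unfolding K_def by (intro analytic_diff analytic_mult analytic_divide analytic_const anC ang) (use d in simp)
          have K0: "K z = real q * (1 - real q / real d) * (g z)\<^sup>2" if "z $ 2 = 0" for z
            using d that by (simp add: K_def C_def power2_eq_square field_simps)
          note Dh = eventually_D_ypow[OF ang hg]
          have Dhv: "\<forall>\<^sub>F z in nhds 0. D1 h z = D1 v z \<and> D2 h z = D2 v z - 2 * \<sigma> * (real r * (z $ 2) ^ (r - 1))"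
            using analytic_eventually[OF v]
            by eventually_elim (simp add: h_def D_diff D_mult D_power analytic_mult analytic_power)
          \<comment> \<open>Since 2 \<sigma> y^r solves the equation by itself, the terms free of h
            cancel by \<sigma>^2 = 1, and two mixed terms with h_y cancel because d = 2r. What
            remains is a multiple of h and the quadratic term h_y (h - y h_y / d).\<close>
          have eq4: "\<forall>\<^sub>F z in nhds 0. m z * D1 h z = (z $ 2) ^ q * (2 * real r * \<sigma> * (z $ 2) ^ (r - 1) * g z + (z $ 2) ^ (q - 1) * K z)"
            using eq hg Dh Dhv
          proof eventually_elim
            case (elim z)
            obtain r' where r': "r = Suc r'" using r by (cases r) auto
            obtain q' where q': "q = Suc q'" using q1 by (cases q) auto
            define y where "y = z $ 2"
            have hz: "h z = y ^ q * g z" using elim(2) by (simp add: y_def)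
            have vz: "v z = h z + 2 * \<sigma> * (y * y ^ r')" by (simp add: h_def r' y_def)
            have Dh2: "D2 h z = y ^ q' * C z" using elim(3) by (simp add: C_def q' y_def algebra_simps)
            have Dv2: "D2 v z = D2 h z + 2 * \<sigma> * (real r * y ^ r')" using elim(4) by (simp add: r' y_def)
            have dr0: "real d = 2 * real r" "real r \<noteq> 0" using d2 r by auto
            have yv: "v z - y * D2 v z / real d = \<sigma> * (y * y ^ r') + (h z - y * D2 h z / real d)"
              using dr0 unfolding vz Dv2 by (simp add: field_simps)
            have hq: "h z - y * D2 h z / real d = y ^ q * (g z - C z / real d)"
              by (simp add: hz Dh2 q' algebra_simps)
            have yd: "y ^ (d - 1) = y * y ^ r' * y ^ r'"
              by (simp add: d2 r' flip: power_add mult_2)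
            have "m z * D1 h z = m z * D1 v z" using elim(4) by simp
            also have "\<dots> = real d * \<epsilon> * y ^ (d - 1) + D2 v z * (v z - y * D2 v z / real d)"
              using elim(1) by (simp add: y_def)
            also have "\<dots> = - real d * (y * y ^ r' * y ^ r') +
                (D2 h z + 2 * \<sigma> * (real r * y ^ r')) * (\<sigma> * (y * y ^ r') + (h z - y * D2 h z / real d))"
              unfolding yv unfolding Dv2 yd em by simp
            also have "\<dots> = 2 * real r * \<sigma> * y ^ r' * h z + D2 h z * (h z - y * D2 h z / real d)
                + (\<sigma> * \<sigma> - 1) * (2 * real r * (y * y ^ r' * y ^ r'))
                + (D2 h z * \<sigma> * y * y ^ r' - 2 * \<sigma> * real r * y ^ r' * (y * D2 h z / real d))"
              by (simp add: dr0 algebra_simps)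
            also have "\<sigma> * \<sigma> - 1 = 0" using \<sigma>2 by simp
            also have "D2 h z * \<sigma> * y * y ^ r' - 2 * \<sigma> * real r * y ^ r' * (y * D2 h z / real d) = 0"
              using dr0 by (simp add: field_simps)
            also have "D2 h z * (h z - y * D2 h z / real d) = y ^ q * (y ^ q' * K z)"
              unfolding hq unfolding Dh2 K_def by (simp only: mult_ac)
            finally show ?case unfolding hz by (simp add: y_def q' r' algebra_simps)
          qed
          \<comment> \<open>The argument used above for w: after division by y^q, the restriction to
            y = 0 is linear in g once a factor of the quadratic term is put into the
            coefficient.\<close>
          have gn0: "g 0 \<noteq> 0"
          proof
            assume g0: "g 0 = 0"
            have "\<forall>\<^sub>F z in nhds 0. (z $ 2) ^ q * (m z * D1 g z) =
                (z $ 2) ^ q * (2 * real r * \<sigma> * (z $ 2) ^ (r - 1) * g z + (z $ 2) ^ (q - 1) * K z)"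
              using eq4 Dh by eventually_elim (simp add: mult_ac)
            from cancel_power_y[OF _ _ this]
            have "\<forall>\<^sub>F z in nhds 0. m z * D1 g z = 2 * real r * \<sigma> * (z $ 2) ^ (r - 1) * g z + (z $ 2) ^ (q - 1) * K z"
              by (simp add: analytic_mult analytic_add m analytic_D1 ang anK)
            from eventually_axis(1)[OF this] eventually_axis(1)[OF mnz]
            have "\<forall>\<^sub>F z::real^2 in nhds 0. D1 g (vec2 (z $ 1) 0) =
                ((2 * real r * \<sigma> * 0 ^ (r - 1) + 0 ^ (q - 1) * (real q * (1 - real q / real d)) * g (vec2 (z $ 1) 0))
                / m (vec2 (z $ 1) 0)) * g (vec2 (z $ 1) 0)"
            proof eventually_elim
              case (elim z)
              have "m (vec2 (z $ 1) 0) * D1 g (vec2 (z $ 1) 0) =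
                 2 * real r * \<sigma> * 0 ^ (r - 1) * g (vec2 (z $ 1) 0) + 0 ^ (q - 1) * (real q * (1 - real q / real d) * (g (vec2 (z $ 1) 0))\<^sup>2)"
                using elim(1) K0[of "vec2 (z $ 1) 0"] by simp
              also have "\<dots> = (2 * real r * \<sigma> * 0 ^ (r - 1) + 0 ^ (q - 1) * (real q * (1 - real q / real d)) * g (vec2 (z $ 1) 0)) * g (vec2 (z $ 1) 0)"
                by (simp add: power2_eq_square ring_distribs mult_ac)
              finally show ?case using elim(2) by (simp add: eq_divide_eq mult_ac)
            qed
            from linear_ode_zero[OF ang _ g0 this] show False
              using gnz analytic_divide[OF analytic_add[OF analytic_const analytic_mult[OF analytic_const ang]] m] by simp
          qed
          \<comment> \<open>Otherwise g = y^(r-q) (w - 2 \<sigma>), and w(0) = 2 \<sigma>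
            contradicts that g(0) is nonzero.\<close>
          have qr: "q > r"
          proof (rule ccontr)
            assume "\<not> q > r"
            have "\<forall>\<^sub>F z in nhds 0. (z $ 2) ^ q * g z = (z $ 2) ^ q * ((z $ 2) ^ (r - q) * (w z - 2 * \<sigma>))"
              using hg vw
            proof eventually_elim
              case (elim z)
              have "r = q + (r - q)" using \<open>\<not> q > r\<close> by simp
              then have "(z $ 2) ^ r = (z $ 2) ^ q * (z $ 2) ^ (r - q)" by (metis power_add)
              then show ?case using elim by (simp add: h_def algebra_simps)
            qed
            from eventually_nhds_x_imp_x[OF cancel_power_y[OF ang _ this]]
            show False using gn0 \<sigma>(2) analytic_mult[OF analytic_ypow analytic_diff[OF w analytic_const]] by simp
          qed
          \<comment> \<open>By q > r the linear term of \<open>eq4\<close> dominates, so h_x has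
            order exactly q + r - 1. Hence s >= 2r, and q = s - r + 1 is the exponent in
            \<open>P_v\<close>.\<close>
          define s where "s = r + q - 1"
          let ?G = "\<lambda>z. (2 * real r * \<sigma> * g z + (z $ 2) ^ (q - r) * K z) / m z"
          have anG: "real_analytic_at ?G 0" by (intro analytic_divide analytic_add analytic_mult analytic_const analytic_ypow ang anK m)
          have G0: "?G 0 \<noteq> 0" using qr r gn0 m(2) \<sigma>(1) by (auto simp: zero_power)
          have DG: "\<forall>\<^sub>F z in nhds 0. D1 h z = (z $ 2) ^ s * ?G z"
            using eq4 mnz
          proof eventually_elim
            case (elim z)
            have "s = q + (r - 1)" "q - 1 = (r - 1) + (q - r)" using qr r by (auto simp: s_def)
            then have "(z $ 2) ^ s = (z $ 2) ^ q * (z $ 2) ^ (r - 1)"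
              "(z $ 2) ^ (q - 1) = (z $ 2) ^ (r - 1) * (z $ 2) ^ (q - r)" by (metis power_add)+
            then have "m z * D1 h z = (z $ 2) ^ s * (2 * real r * \<sigma> * g z + (z $ 2) ^ (q - r) * K z)"
              using elim(1) by (simp add: algebra_simps)
            then show ?case using elim(2) by (simp add: eq_divide_eq mult_ac)
          qed
          have \<alpha>: "2 * \<sigma> * real r * g 0 \<noteq> 0" using \<sigma>(1) r gn0 by auto
          have kk: "q + r = Suc s" using r by (simp add: s_def)
          obtain X c where
            X: "real_analytic_at X 0" "X 0 = 0" "D1 X 0 \<noteq> 0" "c 0 = g 0"
            "\<forall>\<^sub>F z in nhds 0. h z = 2 * \<sigma> * real r * g 0 * X z * (z $ 2) ^ s + (z $ 2) ^ q * cpoly r c (z $ 2)" by (rule normalise_x[OF h ang hg anG G0 DG kk r \<alpha>]) (rule that)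
          have a: "P_alpha r \<sigma> c = 2 * \<sigma> * real r * g 0" by (simp add: P_alpha_def X(4))
          have sq: "s - r + 1 = q" "s \<ge> 2 * r" using r qr by (auto simp: s_def)
          have "\<forall>\<^sub>F z in nhds 0. v z = P_v r \<sigma> s c (vec2 (X z) (z $ 2))"
            using X(5) by eventually_elim (simp only: P_v_def a sq vec2_nth, simp add: h_def algebra_simps)
          then have "?P X"
            using r sq(2) \<sigma>(1) d2 em \<alpha> unfolding a[symmetric]
            by (intro exI[of _ r] conjI exI[of _ s] bexI[of _ \<sigma>] exI[of _ c])
          then show ?thesis using X(1,2,3) by blast
        qed
      qed
    qed
  qed
qed

section \<open>Normal forms of the operator\<close>

text \<open>The factor y^d is constant along the x-lines, so the quotient satisfies the same linear
  equation. If it vanished at the origin it would vanish on y = 0, contrary to the choice of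
  d.\<close>

lemma order_of_unit_multiple:
  assumes f: "real_analytic_at f 0" and nz: "\<not> (\<forall>\<^sub>F z in nhds 0. f z = 0)"
    and \<kappa>: "real_analytic_at \<kappa> 0" and ode: "\<forall>\<^sub>F z in nhds 0. D1 f z = \<kappa> z * f z"
  obtains d w where "real_analytic_at w 0" "w 0 \<noteq> 0" "\<forall>\<^sub>F z in nhds 0. f z = (z $ 2) ^ d * w z"
proof -
  obtain d w where w: "real_analytic_at w 0" and fw: "\<forall>\<^sub>F z in nhds 0. f z = (z $ 2) ^ d * w z"
    and wnz: "\<not> (\<forall>\<^sub>F z::real^2 in nhds 0. w (vec2 (z $ 1) 0) = 0)"
    by (rule analytic_order_y[OF f nz]) (rule that)
  have "\<forall>\<^sub>F z in nhds 0. (z $ 2) ^ d * D1 w z = (z $ 2) ^ d * (\<kappa> z * w z)"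
    using eventually_D_ypow[OF w fw] fw ode by eventually_elim auto
  from cancel_power_y[OF analytic_D1[OF w] analytic_mult[OF \<kappa> w] this]
  have ode': "\<forall>\<^sub>F z in nhds 0. D1 w z = \<kappa> z * w z" .
  have "w 0 \<noteq> 0"
    using linear_ode_zero[OF w \<kappa> _ eventually_axis(1)[OF ode']] wnz by blast
  then show ?thesis using that w fw by blast
qed

lemma powr_inverse_power:
  fixes x :: real
  assumes "x > 0" "d \<ge> 1"
  shows "(x powr (1 / real d)) ^ d = x"
proof -
  have "(x powr (1 / real d)) ^ d = (x powr (1 / real d)) powr real d"
    using assms by (simp add: powr_realpow)
  also have "\<dots> = x" using assms by (simp add: powr_powr)
  finally show ?thesis .
qed

text \<open>For odd d the sign of w(0) is its own d-th power and can be moved into g; for even d it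
  remains as \<epsilon>. This is the origin of the convention \<epsilon> = 1 for odd d.\<close>

lemma signed_root:
  assumes w: "real_analytic_at w 0" "w 0 \<noteq> 0" and d: "d \<ge> 1"
  obtains \<epsilon> g where "\<epsilon> \<in> {1, -1}" "odd d \<longrightarrow> \<epsilon> = 1" "real_analytic_at g 0" "g 0 \<noteq> 0"
    "\<forall>\<^sub>F z in nhds 0. w z = \<epsilon> * g z ^ d"
proof -
  define \<tau> :: real where "\<tau> = sgn (w 0)"
  have \<tau>: "\<tau> \<in> {1, -1}" "\<tau> * w 0 > 0" using w(2) by (auto simp: \<tau>_def sgn_if)
  have real_analytic_at\<tau>: "real_analytic_at (\<lambda>z. \<tau> * w z) 0" by (intro analytic_mult analytic_const w)
  define h where "h = (\<lambda>z. (\<tau> * w z) powr (1 / real d))"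
  have h: "real_analytic_at h 0" "h 0 \<noteq> 0" unfolding h_def using analytic_powr[OF real_analytic_at\<tau> \<tau>(2)] \<tau>(2) by auto
  have "open {0::real<..}" by simp
  then have "\<forall>\<^sub>F x in nhds (\<tau> * w 0). x \<in> {0<..}" using \<tau>(2) unfolding eventually_nhds by blast
  from eventually_nhds_compose[OF analytic_isCont[OF real_analytic_at\<tau>] this]
  have "\<forall>\<^sub>F z in nhds 0. \<tau> * w z > 0" by simp
  then have hw: "\<forall>\<^sub>F z in nhds 0. w z = \<tau> * h z ^ d"
    by eventually_elim (use \<tau>(1) d in \<open>auto simp: h_def powr_inverse_power\<close>)
  show ?thesis
  proof (cases "odd d")
    case False
    then show ?thesis using that[of \<tau> h] \<tau>(1) h hw by blast
  next
    case True
    have g: "real_analytic_at (\<lambda>z. \<tau> * h z) 0" "\<tau> * h 0 \<noteq> 0" using h \<tau>(1) by (auto intro: analytic_mult)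
    have td: "\<tau> ^ d = \<tau>" using \<tau>(1) True by auto
    from hw have "\<forall>\<^sub>F z in nhds 0. w z = 1 * (\<tau> * h z) ^ d"
      by eventually_elim (simp add: power_mult_distrib td)
    then show ?thesis using that[of 1 "\<lambda>z. \<tau> * h z"] g by simp
  qed
qed

section \<open>Nijenhuis equations and adapted charts\<close>

lemma centred_equations:
  assumes L: "analytic_nijenhuis_operator A W L" and \<phi>: "centred A W p \<phi>" and z: "z \<in> snd \<phi> ` fst \<phi>"
  defines "T \<equiv> in_coords L \<phi>"
  shows "real_analytic_at (\<lambda>z. tr2 (T z)) z" "real_analytic_at (\<lambda>z. neg_det (T z)) z"
    "D1 (\<lambda>z. tr2 (T z)) z * T z $ 1 $ 1 + D2 (\<lambda>z. tr2 (T z)) z * T z $ 2 $ 1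
      = tr2 (T z) * D1 (\<lambda>z. tr2 (T z)) z + D1 (\<lambda>z. neg_det (T z)) z"
    "D1 (\<lambda>z. tr2 (T z)) z * T z $ 1 $ 2 + D2 (\<lambda>z. tr2 (T z)) z * T z $ 2 $ 2
      = tr2 (T z) * D2 (\<lambda>z. tr2 (T z)) z + D2 (\<lambda>z. neg_det (T z)) z"
    "D1 (\<lambda>z. neg_det (T z)) z * T z $ 1 $ 1 + D2 (\<lambda>z. neg_det (T z)) z * T z $ 2 $ 1
      = neg_det (T z) * D1 (\<lambda>z. tr2 (T z)) z"
    "D1 (\<lambda>z. neg_det (T z)) z * T z $ 1 $ 2 + D2 (\<lambda>z. neg_det (T z)) z * T z $ 2 $ 2
      = neg_det (T z) * D2 (\<lambda>z. tr2 (T z)) z"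
proof -
  have real_analytic_at: "\<And>i j. real_analytic_at (\<lambda>z. T z $ i $ j) z" unfolding T_def by (rule centred_nijenhuis(2)[OF L \<phi> z])
  show "real_analytic_at (\<lambda>z. tr2 (T z)) z" "real_analytic_at (\<lambda>z. neg_det (T z)) z"
    unfolding tr2_def neg_det_def by (intro analytic_add analytic_diff analytic_mult real_analytic_at)+
  note N = nijenhuis_equations[OF centred_nijenhuis(1)[OF L \<phi>, folded T_def] z real_analytic_at]
  show "D1 (\<lambda>z. tr2 (T z)) z * T z $ 1 $ 1 + D2 (\<lambda>z. tr2 (T z)) z * T z $ 2 $ 1
      = tr2 (T z) * D1 (\<lambda>z. tr2 (T z)) z + D1 (\<lambda>z. neg_det (T z)) z"
    "D1 (\<lambda>z. tr2 (T z)) z * T z $ 1 $ 2 + D2 (\<lambda>z. tr2 (T z)) z * T z $ 2 $ 2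
      = tr2 (T z) * D2 (\<lambda>z. tr2 (T z)) z + D2 (\<lambda>z. neg_det (T z)) z"
    "D1 (\<lambda>z. neg_det (T z)) z * T z $ 1 $ 1 + D2 (\<lambda>z. neg_det (T z)) z * T z $ 2 $ 1
      = neg_det (T z) * D1 (\<lambda>z. tr2 (T z)) z"
    "D1 (\<lambda>z. neg_det (T z)) z * T z $ 1 $ 2 + D2 (\<lambda>z. neg_det (T z)) z * T z $ 2 $ 2
      = neg_det (T z) * D2 (\<lambda>z. tr2 (T z)) z"
    by (rule N)+
qed

lemma eventually_in_domain:
  assumes "centred A W p \<phi>" "\<And>z. z \<in> snd \<phi> ` fst \<phi> \<Longrightarrow> P z"
  shows "\<forall>\<^sub>F z in nhds 0. P z"
  using centred_domain[OF assms(1)] assms(2) unfolding eventually_nhds by blast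

text \<open>When x is kept and y is replaced by Y, the new second coordinate field is a multiple of
  the old one. The lower right entry is then a multiple of the derivative of Y along the image under
  L of that field, whose slope is f; a first integral makes it zero.\<close>

lemma flow_box_chart:
  assumes atlas: "analytic_atlas A" and L: "analytic_nijenhuis_operator A W L" and \<phi>: "centred A W p \<phi>"
    and T0: "in_coords L \<phi> 0 = mat2 0 1 0 0"
  obtains \<psi> where "centred A W p \<psi>"
    "\<And>z. z \<in> snd \<psi> ` fst \<psi> \<Longrightarrow> in_coords L \<psi> z $ 1 $ 2 \<noteq> 0 \<and> in_coords L \<psi> z $ 2 $ 2 = 0"
    "tr2 (in_coords L \<psi> 0) = 0" "neg_det (in_coords L \<psi> 0) = 0"
proof -
  let ?T = "in_coords L \<phi>"
  have real_analytic_at: "real_analytic_at (\<lambda>z. ?T z $ i $ j) 0" for i j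
    by (rule centred_nijenhuis(2)[OF L \<phi> centred_domain(2)[OF \<phi>]])
  have b: "?T 0 $ 1 $ 2 \<noteq> 0" by (simp add: T0)
  define f where "f = (\<lambda>z. ?T z $ 2 $ 2 / ?T z $ 1 $ 2)"
  have "real_analytic_at f 0" unfolding f_def by (rule analytic_divide[OF real_analytic_at real_analytic_at b])
  then obtain Y where Y: "real_analytic_at Y 0" "Y 0 = 0" "D2 Y 0 \<noteq> 0" "\<forall>\<^sub>F z in nhds 0. D1 Y z + f z * D2 Y z = 0"
    by (rule first_integral) (rule that)
  have P: "\<forall>\<^sub>F z in nhds 0. ?T z $ 1 $ 2 \<noteq> 0 \<and> D1 Y z + f z * D2 Y z = 0"
    using analytic_nonzero[OF real_analytic_at b] Y(4) by eventually_elim simp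
  have det: "D1 (\<lambda>z. z $ 1) 0 * D2 Y 0 - D2 (\<lambda>z. z $ 1) 0 * D1 Y 0 \<noteq> 0" using Y(3) by simp
  show ?thesis
  proof (rule coordinate_change[OF atlas L \<phi> analytic_x _ Y(1,2) det P])
    fix \<psi> H
    let ?V = "snd \<psi> ` fst \<psi>" and ?S = "in_coords L \<psi>"
    assume \<psi>: "centred A W p \<psi>" "H 0 = 0" "0 \<in> ?V"
      and PH: "\<And>z. z \<in> ?V \<Longrightarrow> ?T (H z) $ 1 $ 2 \<noteq> 0 \<and> D1 Y (H z) + f (H z) * D2 Y (H z) = 0"
      and J: "\<And>z. z \<in> ?V \<Longrightarrow> D1 (\<lambda>z. z $ 1) (H z) * D2 Y (H z) - D2 (\<lambda>z. z $ 1) (H z) * D1 Y (H z) \<noteq> 0"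
      and e12: "\<And>z. z \<in> ?V \<Longrightarrow> ?S z $ 1 $ 1 * D2 (\<lambda>z. z $ 1) (H z) + ?S z $ 1 $ 2 * D2 Y (H z)
         = D1 (\<lambda>z. z $ 1) (H z) * ?T (H z) $ 1 $ 2 + D2 (\<lambda>z. z $ 1) (H z) * ?T (H z) $ 2 $ 2"
      and e22: "\<And>z. z \<in> ?V \<Longrightarrow> ?S z $ 2 $ 1 * D2 (\<lambda>z. z $ 1) (H z) + ?S z $ 2 $ 2 * D2 Y (H z)
         = D1 Y (H z) * ?T (H z) $ 1 $ 2 + D2 Y (H z) * ?T (H z) $ 2 $ 2"
      and tr: "\<And>z. z \<in> ?V \<Longrightarrow> tr2 (?S z) = tr2 (?T (H z))" "\<And>z. z \<in> ?V \<Longrightarrow> neg_det (?S z) = neg_det (?T (H z))"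
    show ?thesis
    proof (rule that[OF \<psi>(1)])
      fix z assume z: "z \<in> ?V"
      have D: "D2 Y (H z) \<noteq> 0" using J[OF z] by simp
      have b: "?T (H z) $ 1 $ 2 \<noteq> 0" and Y0: "D1 Y (H z) + f (H z) * D2 Y (H z) = 0" using PH[OF z] by auto
      have "?S z $ 1 $ 2 \<noteq> 0" using e12[OF z] b by auto
      moreover have "?S z $ 2 $ 2 * D2 Y (H z) = ?T (H z) $ 1 $ 2 * (D1 Y (H z) + f (H z) * D2 Y (H z))"
        using e22[OF z] b by (simp add: f_def field_simps)
      ultimately show "?S z $ 1 $ 2 \<noteq> 0 \<and> ?S z $ 2 $ 2 = 0"
        using Y0 D by simp
    qed (use tr[OF \<psi>(3)] \<psi>(2) T0 in \<open>simp_all add: tr2_def neg_det_def\<close>)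
  qed simp
qed

text \<open>The target matrix says dX o L = dY and dY o L = g(Y) dY. With b the upper right entry
  and v the trace, the first condition requires X_x = Y_y / b and v X_x = Y_x, which are compatible
  by \<open>eq\<close>; so X is a primitive along the x-lines. The second condition is again
  \<open>eq\<close>.\<close>

lemma unipotent_form:
  assumes atlas: "analytic_atlas A" and L: "analytic_nijenhuis_operator A W L" and \<psi>: "centred A W p \<psi>"
  defines "T \<equiv> in_coords L \<psi>"
  assumes T: "\<forall>\<^sub>F z in nhds 0. T z $ 1 $ 2 \<noteq> 0 \<and> T z $ 2 $ 2 = 0 \<and> T z $ 2 $ 1 = 0" and v0: "tr2 (T 0) = 0"
    and Y: "real_analytic_at Y 0" "Y 0 = 0" "D2 Y 0 \<noteq> 0"
    and eq: "\<forall>\<^sub>F z in nhds 0. T z $ 1 $ 2 * D1 Y z = tr2 (T z) * D2 Y z"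
    and v: "\<forall>\<^sub>F z in nhds 0. tr2 (T z) = g (Y z)"
  obtains \<rho> where "centred A W p \<rho>"
    "\<And>z. z \<in> snd \<rho> ` fst \<rho> \<Longrightarrow> in_coords L \<rho> z = mat2 0 1 0 (g (z $ 2))"
proof -
  have real_analytic_at: "real_analytic_at (\<lambda>z. T z $ i $ j) 0" for i j
    unfolding T_def by (rule centred_nijenhuis(2)[OF L \<psi> centred_domain(2)[OF \<psi>]])
  have b: "T 0 $ 1 $ 2 \<noteq> 0" using eventually_nhds_x_imp_x[OF T] by simp
  obtain X where X: "real_analytic_at X 0" "\<forall>\<^sub>F z in nhds 0. D1 X z = D2 Y z / T z $ 1 $ 2" "\<And>y. X (vec2 0 y) = 0"
    by (rule analytic_primitive[OF analytic_divide[OF analytic_D2[OF Y(1)] real_analytic_at b]]) (rule that)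
  have X0: "X 0 = 0" using X(3)[of 0] by simp
  have D1Y: "D1 Y 0 = 0" using eventually_nhds_x_imp_x[OF eq] b v0 by simp
  have D1X: "D1 X 0 \<noteq> 0" using eventually_nhds_x_imp_x[OF X(2)] b Y(3) by simp
  have det: "D1 X 0 * D2 Y 0 - D2 X 0 * D1 Y 0 \<noteq> 0" using D1X D1Y Y(3) by simp
  have P: "\<forall>\<^sub>F z in nhds 0. (T z $ 1 $ 2 \<noteq> 0 \<and> T z $ 2 $ 2 = 0 \<and> T z $ 2 $ 1 = 0) \<and>
      T z $ 1 $ 2 * D1 Y z = tr2 (T z) * D2 Y z \<and> tr2 (T z) = g (Y z) \<and> D1 X z = D2 Y z / T z $ 1 $ 2"
    using T eq v X(2) by eventually_elim simp
  show ?thesis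
  proof (rule coordinate_change[OF atlas L \<psi> X(1) X0 Y(1,2) det P])
    fix \<rho> H
    let ?V = "snd \<rho> ` fst \<rho>" and ?S = "in_coords L \<rho>"
    assume \<rho>: "centred A W p \<rho>"
      and PH: "\<And>z. z \<in> ?V \<Longrightarrow> (T (H z) $ 1 $ 2 \<noteq> 0 \<and> T (H z) $ 2 $ 2 = 0 \<and> T (H z) $ 2 $ 1 = 0) \<and>
        T (H z) $ 1 $ 2 * D1 Y (H z) = tr2 (T (H z)) * D2 Y (H z) \<and> tr2 (T (H z)) = g (Y (H z)) \<and>
        D1 X (H z) = D2 Y (H z) / T (H z) $ 1 $ 2"
      and YH: "\<And>z. z \<in> ?V \<Longrightarrow> Y (H z) = z $ 2"
      and J: "\<And>z. z \<in> ?V \<Longrightarrow> D1 X (H z) * D2 Y (H z) - D2 X (H z) * D1 Y (H z) \<noteq> 0"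
      and e: "\<And>z. z \<in> ?V \<Longrightarrow> ?S z $ 1 $ 1 * D1 X (H z) + ?S z $ 1 $ 2 * D1 Y (H z)
         = D1 X (H z) * in_coords L \<psi> (H z) $ 1 $ 1 + D2 X (H z) * in_coords L \<psi> (H z) $ 2 $ 1"
      "\<And>z. z \<in> ?V \<Longrightarrow> ?S z $ 1 $ 1 * D2 X (H z) + ?S z $ 1 $ 2 * D2 Y (H z)
         = D1 X (H z) * in_coords L \<psi> (H z) $ 1 $ 2 + D2 X (H z) * in_coords L \<psi> (H z) $ 2 $ 2"
      "\<And>z. z \<in> ?V \<Longrightarrow> ?S z $ 2 $ 1 * D1 X (H z) + ?S z $ 2 $ 2 * D1 Y (H z)
         = D1 Y (H z) * in_coords L \<psi> (H z) $ 1 $ 1 + D2 Y (H z) * in_coords L \<psi> (H z) $ 2 $ 1"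
      "\<And>z. z \<in> ?V \<Longrightarrow> ?S z $ 2 $ 1 * D2 X (H z) + ?S z $ 2 $ 2 * D2 Y (H z)
         = D1 Y (H z) * in_coords L \<psi> (H z) $ 1 $ 2 + D2 Y (H z) * in_coords L \<psi> (H z) $ 2 $ 2"
    show ?thesis
    proof (rule that[OF \<rho>])
      fix z assume z: "z \<in> ?V"
      define x1 x2 y1 y2 b w where xy: "x1 = D1 X (H z)" "x2 = D2 X (H z)" "y1 = D1 Y (H z)" "y2 = D2 Y (H z)"
        "b = T (H z) $ 1 $ 2" "w = g (z $ 2)"
      have a: "b \<noteq> 0" "T (H z) $ 2 $ 2 = 0" "T (H z) $ 2 $ 1 = 0" "b * y1 = w * y2" "T (H z) $ 1 $ 1 = w" "b * x1 = y2"
        using PH[OF z] YH[OF z] by (auto simp: xy tr2_def)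
      have D: "x1 * y2 - x2 * y1 \<noteq> 0" using J[OF z] by (simp add: xy)
      have y1: "y1 = x1 * w" using a(1,4,6) by algebra
      have E: "?S z $ 1 $ 1 * x1 + ?S z $ 1 $ 2 * y1 = x1 * w" "?S z $ 1 $ 1 * x2 + ?S z $ 1 $ 2 * y2 = x1 * b"
        "?S z $ 2 $ 1 * x1 + ?S z $ 2 $ 2 * y1 = y1 * w" "?S z $ 2 $ 1 * x2 + ?S z $ 2 $ 2 * y2 = y1 * b"
        using e[OF z] a(2,3,5) by (simp_all add: T_def xy)
      have "(x1 * y2 - x2 * y1) * ?S z $ 1 $ 1 = 0" "(x1 * y2 - x2 * y1) * (?S z $ 1 $ 2 - 1) = 0"
        "(x1 * y2 - x2 * y1) * ?S z $ 2 $ 1 = 0" "(x1 * y2 - x2 * y1) * (?S z $ 2 $ 2 - w) = 0"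
        using E y1 a(4,6) by algebra+
      then show "?S z = mat2 0 1 0 (g (z $ 2))"
        using D by (intro mat2_eqI) (auto simp: xy)
    qed
  qed
qed

section \<open>Assembling the list of normal forms\<close>

definition normal_form :: "(real^2 \<Rightarrow> real^2^2) \<Rightarrow> (real^2) set \<Rightarrow> bool" where
  "normal_form T V \<longleftrightarrow>
       (\<forall>z\<in>V. T z = L_nil z) \<or>
       (\<forall>z\<in>V. T z = L_nd z) \<or>
       (\<exists>k\<ge>1. \<forall>z\<in>V. T z = M_odd k z) \<or>
       (\<exists>k\<ge>1. \<exists>\<epsilon>\<in>{1, -1}. \<forall>z\<in>V. T z = M_even k \<epsilon> z) \<or>
       (\<exists>k\<ge>1. \<forall>z\<in>V. T z = N_odd k z) \<or>
       (\<exists>k\<ge>1. \<exists>\<epsilon>\<in>{1, -1}. \<forall>z\<in>V. T z = N_even k \<epsilon> z) \<or>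
       (\<exists>k\<ge>1. \<exists>d\<ge>2*k+1. \<exists>\<epsilon>\<in>{1, -1}. \<exists>c. (odd d \<longrightarrow> \<epsilon> = 1) \<and> O_alpha k d c \<noteq> 0 \<and>
          reconstructed_from T (O_v k d c) (O_u d \<epsilon>) V) \<or>
       (\<exists>k\<ge>1. \<exists>s\<ge>2*k. \<exists>\<epsilon>\<in>{1, -1}. \<exists>c. P_alpha k \<epsilon> c \<noteq> 0 \<and>
          reconstructed_from T (P_v k \<epsilon> s c) (P_u k) V) \<or>
       (\<exists>k\<ge>1. \<exists>\<epsilon>\<in>{1, -1}. \<exists>c. S_even_alpha k \<epsilon> c \<noteq> 0 \<and>
          reconstructed_from T (S_even_v k \<epsilon> c) (S_even_u k \<epsilon>) V) \<or>
       (\<exists>k\<ge>1. \<exists>c. reconstructed_from T (S_odd_v k c) (S_odd_u k) V)"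

lemma normal_form_L_nil: "(\<forall>z\<in>V. T z = L_nil z) \<Longrightarrow> normal_form T V"
  unfolding normal_form_def by (rule disjI1, blast)

lemma normal_form_L_nd: "(\<forall>z\<in>V. T z = L_nd z) \<Longrightarrow> normal_form T V"
  unfolding normal_form_def by (rule disjI2, rule disjI1, blast)

lemma normal_form_M_odd: "k \<ge> 1 \<Longrightarrow> (\<forall>z\<in>V. T z = M_odd k z) \<Longrightarrow> normal_form T V"
  unfolding normal_form_def by (rule disjI2, rule disjI2, rule disjI1, blast)

lemma normal_form_M_even: "k \<ge> 1 \<Longrightarrow> \<epsilon> \<in> {1, -1} \<Longrightarrow> (\<forall>z\<in>V. T z = M_even k \<epsilon> z) \<Longrightarrow> normal_form T V"
  unfolding normal_form_def by (rule disjI2, rule disjI2, rule disjI2, rule disjI1, blast)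

lemma normal_form_N_odd: "k \<ge> 1 \<Longrightarrow> (\<forall>z\<in>V. T z = N_odd k z) \<Longrightarrow> normal_form T V"
  unfolding normal_form_def by (rule disjI2, rule disjI2, rule disjI2, rule disjI2, rule disjI1, blast)

lemma normal_form_N_even: "k \<ge> 1 \<Longrightarrow> \<epsilon> \<in> {1, -1} \<Longrightarrow> (\<forall>z\<in>V. T z = N_even k \<epsilon> z) \<Longrightarrow> normal_form T V"
  unfolding normal_form_def by (rule disjI2, rule disjI2, rule disjI2, rule disjI2, rule disjI2, rule disjI1, blast)

lemma normal_form_O: "k \<ge> 1 \<Longrightarrow> 2 * k + 1 \<le> d \<Longrightarrow> \<epsilon> \<in> {1, -1} \<Longrightarrow> (odd d \<longrightarrow> \<epsilon> = 1) \<Longrightarrow> O_alpha k d c \<noteq> 0 \<Longrightarrow> reconstructed_from T (O_v k d c) (O_u d \<epsilon>) V \<Longrightarrow> normal_form T V"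
  unfolding normal_form_def by (rule disjI2, rule disjI2, rule disjI2, rule disjI2, rule disjI2, rule disjI2, rule disjI1, blast)

lemma normal_form_P: "k \<ge> 1 \<Longrightarrow> 2 * k \<le> s \<Longrightarrow> \<epsilon> \<in> {1, -1} \<Longrightarrow> P_alpha k \<epsilon> c \<noteq> 0 \<Longrightarrow> reconstructed_from T (P_v k \<epsilon> s c) (P_u k) V \<Longrightarrow> normal_form T V"
  unfolding normal_form_def by (rule disjI2, rule disjI2, rule disjI2, rule disjI2, rule disjI2, rule disjI2, rule disjI2, rule disjI1, blast)

lemma normal_form_S_even: "k \<ge> 1 \<Longrightarrow> \<epsilon> \<in> {1, -1} \<Longrightarrow> S_even_alpha k \<epsilon> c \<noteq> 0 \<Longrightarrow> reconstructed_from T (S_even_v k \<epsilon> c) (S_even_u k \<epsilon>) V \<Longrightarrow> normal_form T V"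
  unfolding normal_form_def by (rule disjI2, rule disjI2, rule disjI2, rule disjI2, rule disjI2, rule disjI2, rule disjI2, rule disjI2, rule disjI1, blast)

lemma normal_form_S_odd: "k \<ge> 1 \<Longrightarrow> reconstructed_from T (S_odd_v k c) (S_odd_u k) V \<Longrightarrow> normal_form T V"
  unfolding normal_form_def by (rule disjI2, rule disjI2, rule disjI2, rule disjI2, rule disjI2, rule disjI2, rule disjI2, rule disjI2, rule disjI2, blast)

text \<open>The Nijenhuis equations are the matrix identity J T = C J with C =
  \<open>mat2 (v z) 1 (u z) 0\<close>, to be solved for T where J is invertible. By
  \<open>nd\<close> this includes all points off y = 0, which are dense.\<close>

lemma reconstructed_from_trace_det:
  assumes L: "analytic_nijenhuis_operator A W L" and \<phi>: "centred A W p \<phi>"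
  defines "T \<equiv> in_coords L \<phi>" and "V \<equiv> snd \<phi> ` fst \<phi>"
  assumes v: "\<And>z. z \<in> V \<Longrightarrow> tr2 (T z) = v z" and u: "\<And>z. z \<in> V \<Longrightarrow> neg_det (T z) = u z"
    and nd: "\<And>z. z \<in> V \<Longrightarrow> z $ 2 \<noteq> 0 \<Longrightarrow> D1 v z * D2 u z - D2 v z * D1 u z \<noteq> 0"
  shows "reconstructed_from T v u V"
proof -
  have V: "open V" unfolding V_def by (rule centred_domain(1)[OF \<phi>])
  have evV: "\<forall>\<^sub>F w in nhds z. w \<in> V" if "z \<in> V" for z
    using V that unfolding eventually_nhds by blast
  have ev: "\<forall>\<^sub>F w in nhds z. v w = tr2 (T w)" "\<forall>\<^sub>F w in nhds z. u w = neg_det (T w)" if "z \<in> V" for z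
    using evV[OF that] by (eventually_elim, simp add: v u)+
  note N = centred_equations[OF L \<phi>, folded T_def V_def]
  have real_analytic_at: "real_analytic_at v z" "real_analytic_at u z" if "z \<in> V" for z
    using analytic_cong[OF N(1)[OF that] ev(1)[OF that]] analytic_cong[OF N(2)[OF that] ev(2)[OF that]] by auto
  have anT: "real_analytic_at (\<lambda>z. T z $ i $ j) z" if "z \<in> V" for z i j
    using centred_nijenhuis(2)[OF L \<phi>, folded T_def V_def, OF that] .
  define J where "J = (\<lambda>z. jacobian (\<lambda>w. vector [v w, u w] :: real^2) (at z))"
  have J: "J z = mat2 (D1 v z) (D2 v z) (D1 u z) (D2 u z)" if "z \<in> V" for z
    using jacobian_analytic(1)[of "\<lambda>w. vec2 (v w) (u w)" z] real_analytic_at[OF that] by (simp add: J_def vec2_def[symmetric])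
  have iJ: "invertible (J z)" if "z \<in> V" "z $ 2 \<noteq> 0" for z
    using nd[OF that] unfolding invertible_det_nz det_2 J[OF that(1)] by simp
  have "V \<subseteq> closure {z \<in> V. invertible (J z)}"
  proof
    fix z assume z: "z \<in> V"
    show "z \<in> closure {z \<in> V. invertible (J z)}"
      unfolding closure_approachable
    proof (intro allI impI)
      fix e :: real assume "e > 0"
      obtain \<delta> where \<delta>: "\<delta> > 0" "\<And>w. w \<in> box2 z \<delta> \<Longrightarrow> w \<in> V"
        using evV[OF z] unfolding eventually_box2 by blast
      define \<tau> where "\<tau> = min \<delta> e / 4"
      have \<tau>: "\<tau> > 0" "\<tau> < \<delta>" "\<tau> < e / 2" using \<delta> \<open>e > 0\<close> by (auto simp: \<tau>_def)
      \<comment> \<open>Moving in the direction given by the sign of y guarantees that the second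
        coordinate does not become zero.\<close>
      define w where "w = vec2 (z $ 1) (z $ 2 + (if z $ 2 \<ge> 0 then \<tau> else - \<tau>))"
      have w0: "w $ 2 \<noteq> 0" using \<tau> by (auto simp: w_def)
      have "w \<in> box2 z \<delta>" "w \<in> box2 z (e / 2)" using \<tau> by (auto simp: w_def box2_iff)
      then have "w \<in> V" "dist w z < e" using \<delta> box2_subset_ball[of z e] by (auto simp: dist_commute)
      then show "\<exists>y\<in>{z \<in> V. invertible (J z)}. dist y z < e" using iJ w0 by blast
    qed
  qed
  moreover have "continuous_on V T"
  proof (rule continuous_at_imp_continuous_on, rule ballI)
    fix z assume z: "z \<in> V"
    show "isCont T z"
      unfolding isCont_def
      by (intro vec_tendstoI) (use analytic_isCont[OF anT[OF z]] in \<open>simp add: isCont_def\<close>)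
  qed
  moreover have "T z = matrix_inv (J z) ** mat2 (v z) 1 (u z) 0 ** J z" if z: "z \<in> V" and i: "invertible (J z)" for z
  proof -
    have D: "D1 (\<lambda>z. tr2 (T z)) z = D1 v z" "D2 (\<lambda>z. tr2 (T z)) z = D2 v z"
      "D1 (\<lambda>z. neg_det (T z)) z = D1 u z" "D2 (\<lambda>z. neg_det (T z)) z = D2 u z"
      using D_cong[OF ev(1)[OF z]] D_cong[OF ev(2)[OF z]] by auto
    have "J z ** T z = mat2 (v z) 1 (u z) 0 ** J z"
      using N(3,4,5,6)[OF z] unfolding D J[OF z] v[OF z] u[OF z]
      by (intro mat2_eqI) (simp_all add: mult_mat2_nth)
    then have "matrix_inv (J z) ** (J z ** T z) = matrix_inv (J z) ** (mat2 (v z) 1 (u z) 0 ** J z)" by simp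
    then show ?thesis using matrix_inv_mult_left[OF i] by (simp add: matrix_mul_assoc)
  qed
  ultimately show ?thesis unfolding reconstructed_from_def Let_def J_def by blast
qed

text \<open>The summand with \<beta> is there for the series P, whose trace contains 2 \<epsilon>
  y^k; the other series take \<beta> = 0. Only the first summand depends on x, so the Jacobian
  determinant is \<alpha> \<gamma> d y^(s+d-1), which is nonzero off y = 0.\<close>

lemma reduce_trace:
  assumes atlas: "analytic_atlas A" and L: "analytic_nijenhuis_operator A W L" and \<psi>: "centred A W p \<psi>"
    and u: "\<forall>\<^sub>F z in nhds 0. neg_det (in_coords L \<psi> z) = \<gamma> * (z $ 2) ^ d"
    and X: "real_analytic_at X 0" "X 0 = 0" "D1 X 0 \<noteq> 0"
    and v: "\<forall>\<^sub>F z in nhds 0. tr2 (in_coords L \<psi> z) = VV (vec2 (X z) (z $ 2))"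
    and VV: "\<And>z. VV z = \<alpha> * z $ 1 * (z $ 2) ^ s + (z $ 2) ^ q * cpoly k c (z $ 2) + \<beta> * (z $ 2) ^ l"
    and nz: "\<alpha> \<noteq> 0" "\<gamma> \<noteq> 0" "d \<ge> 1"
  obtains \<rho> where "centred A W p \<rho>"
    "reconstructed_from (in_coords L \<rho>) VV (\<lambda>z. \<gamma> * (z $ 2) ^ d) (snd \<rho> ` fst \<rho>)"
proof -
  let ?T = "in_coords L \<psi>"
  have det: "D1 X 0 * D2 (\<lambda>z. z $ 2) 0 - D2 X 0 * D1 (\<lambda>z. z $ 2) 0 \<noteq> 0" using X by simp
  have P: "\<forall>\<^sub>F z in nhds 0. neg_det (?T z) = \<gamma> * (z $ 2) ^ d \<and> tr2 (?T z) = VV (vec2 (X z) (z $ 2))"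
    using u v by eventually_elim simp
  have y0: "(0::real^2) $ 2 = 0" by simp
  show ?thesis
  proof (rule coordinate_change[OF atlas L \<psi> X(1,2) analytic_y y0 det P])
    fix \<rho> H
    let ?V = "snd \<rho> ` fst \<rho>" and ?S = "in_coords L \<rho>"
    assume \<rho>: "centred A W p \<rho>"
      and PH: "\<And>z. z \<in> ?V \<Longrightarrow> neg_det (?T (H z)) = \<gamma> * (H z $ 2) ^ d \<and> tr2 (?T (H z)) = VV (vec2 (X (H z)) (H z $ 2))"
      and XY: "\<And>z. z \<in> ?V \<Longrightarrow> X (H z) = z $ 1" "\<And>z. z \<in> ?V \<Longrightarrow> H z $ 2 = z $ 2"
      and tr: "\<And>z. z \<in> ?V \<Longrightarrow> tr2 (?S z) = tr2 (?T (H z))" "\<And>z. z \<in> ?V \<Longrightarrow> neg_det (?S z) = neg_det (?T (H z))"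
    show ?thesis
    proof (rule that[OF \<rho>], rule reconstructed_from_trace_det[OF L \<rho>])
      fix z assume z: "z \<in> ?V"
      show "tr2 (?S z) = VV z" "neg_det (?S z) = \<gamma> * (z $ 2) ^ d"
        using tr[OF z] PH[OF z] XY[OF z] by simp_all
      assume y: "z $ 2 \<noteq> 0"
      have VVe: "VV = (\<lambda>z. \<alpha> * z $ 1 * (z $ 2) ^ s + ((z $ 2) ^ q * (\<Sum>i<k. c i * (z $ 2) ^ i) + \<beta> * (z $ 2) ^ l))"
        using VV by (auto simp: cpoly_def)
      define r where "r = (\<lambda>z::real^2. (z $ 2) ^ q * (\<Sum>i<k. c i * (z $ 2) ^ i) + \<beta> * (z $ 2) ^ l)"
      have anr: "real_analytic_at r z" unfolding r_def by (intro analytic_add analytic_mult analytic_ypow analytic_sum analytic_const)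
      have "((\<lambda>t. r (vec2 t (z $ 2))) has_field_derivative D1 r z) (at (z $ 1))"
        by (rule DERIV_D1[OF anr])
      then have "((\<lambda>t. r z) has_field_derivative D1 r z) (at (z $ 1))" by (simp add: r_def)
      then have D1r: "D1 r z = 0" using DERIV_unique DERIV_const by blast
      have "VV = (\<lambda>z. \<alpha> * z $ 1 * (z $ 2) ^ s + r z)" unfolding VVe r_def ..
      then have "D1 VV z = \<alpha> * (z $ 2) ^ s"
        using anr by (simp add: D_add D_mult D_power analytic_mult analytic_power D1r)
      moreover have "D1 (\<lambda>z. \<gamma> * (z $ 2) ^ d) z = 0" "D2 (\<lambda>z. \<gamma> * (z $ 2) ^ d) z = \<gamma> * (real d * (z $ 2) ^ (d - 1))"
        by (simp_all add: D_mult D_power analytic_power)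
      ultimately show "D1 VV z * D2 (\<lambda>z. \<gamma> * (z $ 2) ^ d) z - D2 VV z * D1 (\<lambda>z. \<gamma> * (z $ 2) ^ d) z \<noteq> 0"
        using nz y by simp
    qed
  qed
qed

text \<open>The upper right entry b is nonzero and the lower right one is 0, so vanishing of the
  determinant kills the second row. What the Nijenhuis equations leave to be exploited is b v_x = v
  v_y for the trace v.\<close>

lemma normal_form_det_zero:
  assumes atlas: "analytic_atlas A" and L: "analytic_nijenhuis_operator A W L" and \<psi>: "centred A W p \<psi>"
  defines "T \<equiv> in_coords L \<psi>"
  assumes T: "\<And>z. z \<in> snd \<psi> ` fst \<psi> \<Longrightarrow> T z $ 1 $ 2 \<noteq> 0 \<and> T z $ 2 $ 2 = 0"
    and v0: "tr2 (T 0) = 0" and u: "\<forall>\<^sub>F z in nhds 0. neg_det (T z) = 0"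
  shows "\<exists>\<rho>. centred A W p \<rho> \<and> normal_form (in_coords L \<rho>) (snd \<rho> ` fst \<rho>)"
proof -
  let ?v = "\<lambda>z. tr2 (T z)"
  note V0 = centred_domain(2)[OF \<psi>]
  note N = centred_equations[OF L \<psi>, folded T_def]
  have anv: "real_analytic_at ?v 0" using N(1)[OF V0] .
  have anT: "real_analytic_at (\<lambda>z. T z $ i $ j) 0" for i j
    using centred_nijenhuis(2)[OF L \<psi> V0, folded T_def] .
  have b0: "T 0 $ 1 $ 2 \<noteq> 0" using T[OF V0] by simp
  have TN: "\<forall>\<^sub>F z in nhds 0. (T z $ 1 $ 2 \<noteq> 0 \<and> T z $ 2 $ 2 = 0) \<and>
      D1 ?v z * T z $ 1 $ 2 + D2 ?v z * T z $ 2 $ 2 = ?v z * D2 ?v z + D2 (\<lambda>z. neg_det (T z)) z"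
    by (rule eventually_in_domain[OF \<psi>]) (use T N(4) in auto)
  have T': "\<forall>\<^sub>F z in nhds 0. T z $ 1 $ 2 \<noteq> 0 \<and> T z $ 2 $ 2 = 0 \<and> T z $ 2 $ 1 = 0"
    using TN u by eventually_elim (auto simp: neg_det_def)
  have bv: "\<forall>\<^sub>F z in nhds 0. T z $ 1 $ 2 * D1 ?v z = ?v z * D2 ?v z"
    using TN eventually_D_cong[OF u] by eventually_elim (auto simp: mult.commute)
  show ?thesis
  proof (cases "\<forall>\<^sub>F z in nhds 0. ?v z = 0")
    case True
    have eq: "\<forall>\<^sub>F z in nhds 0. T z $ 1 $ 2 * D1 (\<lambda>z. z $ 2) z = tr2 (T z) * D2 (\<lambda>z. z $ 2) z"
      using True by eventually_elim simp
    obtain \<rho> where "centred A W p \<rho>" "\<And>z. z \<in> snd \<rho> ` fst \<rho> \<Longrightarrow> in_coords L \<rho> z = mat2 0 1 0 0"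
      by (rule unipotent_form[OF atlas L \<psi> T'[unfolded T_def] v0[unfolded T_def] analytic_y _ _ eq[unfolded T_def],
            where g = "\<lambda>_. 0"])
         (use True in \<open>simp_all add: T_def\<close>)
    then show ?thesis by (intro exI[of _ \<rho>] conjI normal_form_L_nil) (simp_all add: L_nil_def)
  next
    case False
    have \<kappa>: "real_analytic_at (\<lambda>z. D2 ?v z / T z $ 1 $ 2) 0" by (rule analytic_divide[OF analytic_D2[OF anv] anT b0])
    have ode: "\<forall>\<^sub>F z in nhds 0. D1 ?v z = (D2 ?v z / T z $ 1 $ 2) * ?v z"
      using bv T' by eventually_elim (simp add: field_simps)
    obtain k w where w: "real_analytic_at w 0" "w 0 \<noteq> 0" "\<forall>\<^sub>F z in nhds 0. ?v z = (z $ 2) ^ k * w z"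
      by (rule order_of_unit_multiple[OF anv False \<kappa> ode]) (rule that)
    have k: "k \<ge> 1"
      using eventually_nhds_x_imp_x[OF w(3)] w(2) v0 by (cases k) auto
    obtain \<epsilon> g where g: "\<epsilon> \<in> {1, -1}" "odd k \<longrightarrow> \<epsilon> = 1" "real_analytic_at g 0" "g 0 \<noteq> 0"
      "\<forall>\<^sub>F z in nhds 0. w z = \<epsilon> * g z ^ k"
      by (rule signed_root[OF w(1,2) k]) (rule that)
    define Y where "Y = (\<lambda>z. z $ 2 * g z)"
    have Y: "real_analytic_at Y 0" "Y 0 = 0" "D2 Y 0 \<noteq> 0" using g(3,4) by (simp_all add: Y_def analytic_mult D_mult)
    have vY: "\<forall>\<^sub>F z in nhds 0. ?v z = \<epsilon> * Y z ^ k"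
      using w(3) g(5) by eventually_elim (simp add: Y_def power_mult_distrib)
    \<comment> \<open>Both derivatives of the trace carry the factor \<epsilon> k Y^(k-1), so its
      equation passes to Y once y^(k-1) and the unit g^(k-1) are cancelled.\<close>
    have eq: "\<forall>\<^sub>F z in nhds 0. T z $ 1 $ 2 * D1 Y z = ?v z * D2 Y z"
    proof -
      have "\<forall>\<^sub>F z in nhds 0. (z $ 2) ^ (k - 1) * (T z $ 1 $ 2 * D1 Y z) = (z $ 2) ^ (k - 1) * (?v z * D2 Y z)"
        using eventually_D_cong[OF vY] analytic_eventually[OF Y(1)] analytic_nonzero[OF g(3,4)] bv
      proof eventually_elim
        case (elim z)
        have D: "D1 ?v z = \<epsilon> * (real k * Y z ^ (k - 1) * D1 Y z)" "D2 ?v z = \<epsilon> * (real k * Y z ^ (k - 1) * D2 Y z)"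
          using elim(1,2) by (simp_all add: D_mult D_power analytic_power)
        have "\<epsilon> * real k * g z ^ (k - 1) * ((z $ 2) ^ (k - 1) * (T z $ 1 $ 2 * D1 Y z)) =
            T z $ 1 $ 2 * D1 ?v z"
          by (simp add: D Y_def power_mult_distrib)
        also have "\<dots> = \<epsilon> * real k * g z ^ (k - 1) * ((z $ 2) ^ (k - 1) * (?v z * D2 Y z))"
          unfolding elim(4) by (simp add: D Y_def power_mult_distrib)
        finally show ?case using g(1) k elim(3) by auto
      qed
      then show ?thesis
        by (rule cancel_power_y[rotated 2]) (intro analytic_mult analytic_D1 analytic_D2 Y anT anv)+
    qed
    obtain \<rho> where \<rho>: "centred A W p \<rho>" "\<And>z. z \<in> snd \<rho> ` fst \<rho> \<Longrightarrow> in_coords L \<rho> z = mat2 0 1 0 (\<epsilon> * (z $ 2) ^ k)"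
      by (rule unipotent_form[OF atlas L \<psi> T'[unfolded T_def] v0[unfolded T_def] Y eq[unfolded T_def] vY[unfolded T_def]])
         (rule that)
    have "normal_form (in_coords L \<rho>) (snd \<rho> ` fst \<rho>)"
    proof (cases "odd k")
      case True
      then obtain j where "k = 2 * j + 1" by (elim oddE)
      then have j: "k = 2 * Suc j - 1" "Suc j \<ge> 1" by auto
      have "\<forall>z\<in>snd \<rho> ` fst \<rho>. in_coords L \<rho> z = M_odd (Suc j) z"
        using \<rho>(2) g(2) True by (simp add: M_odd_def j(1))
      then show ?thesis by (rule normal_form_M_odd[OF j(2)])
    next
      case False
      then have "even k" by simp
      then obtain j where j: "k = 2 * j" by (elim evenE)
      have "\<forall>z\<in>snd \<rho> ` fst \<rho>. in_coords L \<rho> z = M_even j \<epsilon> z"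
        using \<rho>(2) by (simp add: M_even_def j)
      moreover have "j \<ge> 1" using k j by simp
      ultimately show ?thesis using normal_form_M_even g(1) by blast
    qed
    then show ?thesis using \<rho>(1) by blast
  qed
qed

text \<open>With eigenvalue \<lambda> = \<sigma> y^k and Y = \<tau> y, the target says dX o L =
  \<lambda> dX + dY, which amounts to X_x = \<tau> / b for the upper right entry b. The factor
  \<tau> absorbs the sign \<sigma> when k is odd; \<epsilon> is what remains of it, so that
  \<open>\<epsilon> * \<tau> ^ k = \<sigma>\<close>.\<close>

lemma normal_form_double_eigenvalue:
  assumes atlas: "analytic_atlas A" and L: "analytic_nijenhuis_operator A W L" and \<psi>: "centred A W p \<psi>"
  defines "T \<equiv> in_coords L \<psi>"
  assumes \<sigma>: "\<sigma> \<in> {1, -1}" and k: "k \<ge> 1"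
    and T: "\<forall>\<^sub>F z in nhds 0. T z $ 1 $ 1 = \<sigma> * (z $ 2) ^ k \<and> T z $ 2 $ 1 = 0 \<and> T z $ 2 $ 2 = \<sigma> * (z $ 2) ^ k \<and> T z $ 1 $ 2 \<noteq> 0"
  shows "\<exists>\<rho>. centred A W p \<rho> \<and> normal_form (in_coords L \<rho>) (snd \<rho> ` fst \<rho>)"
proof -
  define \<tau> :: real where "\<tau> = (if odd k then \<sigma> else 1)"
  define \<epsilon> :: real where "\<epsilon> = (if odd k then 1 else \<sigma>)"
  have \<tau>: "\<tau> \<noteq> 0" using \<sigma> by (auto simp: \<tau>_def)
  have \<epsilon>\<tau>: "\<epsilon> * \<tau> ^ k = \<sigma>" using \<sigma> by (auto simp: \<tau>_def \<epsilon>_def)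
  have b: "T 0 $ 1 $ 2 \<noteq> 0" using eventually_nhds_x_imp_x[OF T] by simp
  have anT: "real_analytic_at (\<lambda>z. T z $ i $ j) 0" for i j
    using centred_nijenhuis(2)[OF L \<psi> centred_domain(2)[OF \<psi>], folded T_def] .
  obtain X where X: "real_analytic_at X 0" "\<forall>\<^sub>F z in nhds 0. D1 X z = \<tau> / T z $ 1 $ 2" "\<And>y. X (vec2 0 y) = 0"
    by (rule analytic_primitive[OF analytic_divide[OF analytic_const anT b]]) (rule that)
  have X0: "X 0 = 0" using X(3)[of 0] by simp
  let ?Y = "\<lambda>z::real^2. \<tau> * z $ 2"
  have Y: "real_analytic_at ?Y 0" "?Y 0 = 0" by (simp_all add: analytic_mult)
  have DY: "D1 ?Y z = 0" "D2 ?Y z = \<tau>" for z by (simp_all add: D_mult)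
  have det: "D1 X 0 * D2 ?Y 0 - D2 X 0 * D1 ?Y 0 \<noteq> 0"
    using eventually_nhds_x_imp_x[OF X(2)] \<tau> b by (simp add: DY)
  have P: "\<forall>\<^sub>F z in nhds 0. (T z $ 1 $ 1 = \<sigma> * (z $ 2) ^ k \<and> T z $ 2 $ 1 = 0 \<and> T z $ 2 $ 2 = \<sigma> * (z $ 2) ^ k \<and> T z $ 1 $ 2 \<noteq> 0)
      \<and> D1 X z = \<tau> / T z $ 1 $ 2"
    using T X(2) by eventually_elim simp
  show ?thesis
  proof (rule coordinate_change[OF atlas L \<psi> X(1) X0 Y det P])
    fix \<rho> H
    let ?V = "snd \<rho> ` fst \<rho>" and ?S = "in_coords L \<rho>"
    assume \<rho>: "centred A W p \<rho>"
      and PH: "\<And>z. z \<in> ?V \<Longrightarrow> (T (H z) $ 1 $ 1 = \<sigma> * (H z $ 2) ^ k \<and> T (H z) $ 2 $ 1 = 0 \<and>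
        T (H z) $ 2 $ 2 = \<sigma> * (H z $ 2) ^ k \<and> T (H z) $ 1 $ 2 \<noteq> 0) \<and> D1 X (H z) = \<tau> / T (H z) $ 1 $ 2"
      and YH: "\<And>z. z \<in> ?V \<Longrightarrow> \<tau> * H z $ 2 = z $ 2"
      and e: "\<And>z. z \<in> ?V \<Longrightarrow> ?S z $ 1 $ 1 * D1 X (H z) + ?S z $ 1 $ 2 * D1 ?Y (H z)
         = D1 X (H z) * in_coords L \<psi> (H z) $ 1 $ 1 + D2 X (H z) * in_coords L \<psi> (H z) $ 2 $ 1"
      "\<And>z. z \<in> ?V \<Longrightarrow> ?S z $ 1 $ 1 * D2 X (H z) + ?S z $ 1 $ 2 * D2 ?Y (H z)
         = D1 X (H z) * in_coords L \<psi> (H z) $ 1 $ 2 + D2 X (H z) * in_coords L \<psi> (H z) $ 2 $ 2"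
      "\<And>z. z \<in> ?V \<Longrightarrow> ?S z $ 2 $ 1 * D1 X (H z) + ?S z $ 2 $ 2 * D1 ?Y (H z)
         = D1 ?Y (H z) * in_coords L \<psi> (H z) $ 1 $ 1 + D2 ?Y (H z) * in_coords L \<psi> (H z) $ 2 $ 1"
      "\<And>z. z \<in> ?V \<Longrightarrow> ?S z $ 2 $ 1 * D2 X (H z) + ?S z $ 2 $ 2 * D2 ?Y (H z)
         = D1 ?Y (H z) * in_coords L \<psi> (H z) $ 1 $ 2 + D2 ?Y (H z) * in_coords L \<psi> (H z) $ 2 $ 2"
    have S: "?S z = mat2 (\<epsilon> * (z $ 2) ^ k) 1 0 (\<epsilon> * (z $ 2) ^ k)" if z: "z \<in> ?V" for z
    proof -
      define x1 x2 b w where xb: "x1 = D1 X (H z)" "x2 = D2 X (H z)" "b = T (H z) $ 1 $ 2" "w = \<sigma> * (H z $ 2) ^ k"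
      have w: "w = \<epsilon> * (z $ 2) ^ k"
        unfolding YH[OF z, symmetric] power_mult_distrib xb(4) \<epsilon>\<tau>[symmetric] by simp
      have a: "T (H z) $ 1 $ 1 = w" "T (H z) $ 2 $ 1 = 0" "T (H z) $ 2 $ 2 = w" "b \<noteq> 0" "x1 * b = \<tau>"
        using PH[OF z] by (auto simp: xb)
      have x1: "x1 \<noteq> 0" using a(5) \<tau> by auto
      have E: "?S z $ 1 $ 1 * x1 = x1 * w" "?S z $ 1 $ 1 * x2 + ?S z $ 1 $ 2 * \<tau> = x1 * b + x2 * w"
        "?S z $ 2 $ 1 * x1 = 0" "?S z $ 2 $ 1 * x2 + ?S z $ 2 $ 2 * \<tau> = \<tau> * w"
        using e[OF z] a by (simp_all add: T_def xb DY)
      have "?S z $ 1 $ 1 = w" "?S z $ 2 $ 1 = 0" using E(1,3) x1 by auto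
      moreover from this have "?S z $ 1 $ 2 = 1" "?S z $ 2 $ 2 = w" using E(2,4) a(5) \<tau> by auto
      ultimately show ?thesis by (intro mat2_eqI) (auto simp: w)
    qed
    have "normal_form ?S ?V"
    proof (cases "odd k")
      case True
      then obtain j where "k = 2 * j + 1" by (elim oddE)
      then have j: "k = 2 * Suc j - 1" "Suc j \<ge> 1" by auto
      have "\<epsilon> = 1" using True by (simp add: \<epsilon>_def)
      then have "\<forall>z\<in>?V. ?S z = N_odd (Suc j) z" using S by (simp add: N_odd_def j(1))
      then show ?thesis by (rule normal_form_N_odd[OF j(2)])
    next
      case False
      then have "even k" by simp
      then obtain j where j: "k = 2 * j" by (elim evenE)
      have "\<forall>z\<in>?V. ?S z = N_even j \<epsilon> z" using S by (simp add: N_even_def j)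
      moreover have "j \<ge> 1" "\<epsilon> \<in> {1, -1}" using k j \<sigma> False by (auto simp: \<epsilon>_def)
      ultimately show ?thesis using normal_form_N_even by blast
    qed
    then show ?thesis using \<rho> by blast
  qed
qed

lemma normal_form_nondegenerate:
  assumes atlas: "analytic_atlas A" and L: "analytic_nijenhuis_operator A W L" and \<psi>: "centred A W p \<psi>"
  defines "T \<equiv> in_coords L \<psi>"
  assumes v0: "tr2 (T 0) = 0" and u0: "neg_det (T 0) = 0"
    and J: "D1 (\<lambda>z. tr2 (T z)) 0 * D2 (\<lambda>z. neg_det (T z)) 0 - D2 (\<lambda>z. tr2 (T z)) 0 * D1 (\<lambda>z. neg_det (T z)) 0 \<noteq> 0"
  shows "\<exists>\<rho>. centred A W p \<rho> \<and> normal_form (in_coords L \<rho>) (snd \<rho> ` fst \<rho>)"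
proof -
  note V0 = centred_domain(2)[OF \<psi>]
  have real_analytic_at: "real_analytic_at (\<lambda>z. tr2 (T z)) 0" "real_analytic_at (\<lambda>z. neg_det (T z)) 0"
    using centred_equations(1,2)[OF L \<psi> V0, folded T_def] .
  have P: "\<forall>\<^sub>F z in nhds 0. True" by simp
  show ?thesis
  proof (rule coordinate_change[OF atlas L \<psi> real_analytic_at(1) v0 real_analytic_at(2) u0 J P])
    fix \<rho> H
    let ?V = "snd \<rho> ` fst \<rho>" and ?S = "in_coords L \<rho>"
    assume \<rho>: "centred A W p \<rho>"
      and XY: "\<And>z. z \<in> ?V \<Longrightarrow> tr2 (T (H z)) = z $ 1" "\<And>z. z \<in> ?V \<Longrightarrow> neg_det (T (H z)) = z $ 2"
      and tr: "\<And>z. z \<in> ?V \<Longrightarrow> tr2 (?S z) = tr2 (in_coords L \<psi> (H z))" "\<And>z. z \<in> ?V \<Longrightarrow> neg_det (?S z) = neg_det (in_coords L \<psi> (H z))"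
    have tr': "tr2 (?S z) = z $ 1" "neg_det (?S z) = z $ 2" if "z \<in> ?V" for z
      using tr[OF that] XY[OF that] by (simp_all add: T_def)
    have "?S z = L_nd z" if z: "z \<in> ?V" for z
    proof -
      have "\<forall>\<^sub>F w in nhds z. w \<in> ?V" using centred_domain(1)[OF \<rho>] z unfolding eventually_nhds by blast
      then have ev: "\<forall>\<^sub>F w in nhds z. tr2 (?S w) = w $ 1" "\<forall>\<^sub>F w in nhds z. neg_det (?S w) = w $ 2"
        by (eventually_elim, simp add: tr')+
      show ?thesis
        using centred_equations(3-6)[OF L \<rho> z] unfolding D_cong[OF ev(1)] D_cong[OF ev(2)] tr'[OF z]
        by (intro mat2_eqI) (simp_all add: L_nd_def)
    qed
    then have "normal_form ?S ?V" by (intro normal_form_L_nd ballI)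
    then show ?thesis using \<rho> by blast
  qed
qed

lemma normal_form_det_power:
  assumes atlas: "analytic_atlas A" and L: "analytic_nijenhuis_operator A W L" and \<psi>: "centred A W p \<psi>"
  defines "T \<equiv> in_coords L \<psi>"
  assumes b0: "T 0 $ 1 $ 2 \<noteq> 0" and v0: "tr2 (T 0) = 0"
    and \<epsilon>: "\<epsilon> \<in> {1, -1}" "odd d \<longrightarrow> \<epsilon> = 1" and d: "d \<ge> 1"
    and u: "\<forall>\<^sub>F z in nhds 0. neg_det (T z) = \<epsilon> * (z $ 2) ^ d"
  shows "\<exists>\<rho>. centred A W p \<rho> \<and> normal_form (in_coords L \<rho>) (snd \<rho> ` fst \<rho>)"
proof -
  let ?v = "\<lambda>z. tr2 (T z)" and ?u = "\<lambda>z. neg_det (T z)"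
  note V0 = centred_domain(2)[OF \<psi>]
  note N = centred_equations[OF L \<psi>, folded T_def]
  have \<epsilon>0: "\<epsilon> \<noteq> 0" using \<epsilon> by auto
  have anv: "real_analytic_at ?v 0" using N(1)[OF V0] .
  have anT: "real_analytic_at (\<lambda>z. T z $ i $ j) 0" for i j
    using centred_nijenhuis(2)[OF L \<psi> V0, folded T_def] .
  have u0: "neg_det (T 0) = 0" using eventually_nhds_x_imp_x[OF u] d by (simp add: zero_power)
  have Du: "\<forall>\<^sub>F z in nhds 0. D1 ?u z = 0 \<and> D2 ?u z = \<epsilon> * (real d * (z $ 2) ^ (d - 1))"
    using eventually_D_cong[OF u] by eventually_elim (simp add: D_mult D_power analytic_power)
  have Neq: "\<forall>\<^sub>F z in nhds 0.
     D1 ?v z * T z $ 1 $ 2 + D2 ?v z * T z $ 2 $ 2 = ?v z * D2 ?v z + D2 ?u z \<and>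
     D1 ?u z * T z $ 1 $ 1 + D2 ?u z * T z $ 2 $ 1 = ?u z * D1 ?v z \<and>
     D1 ?u z * T z $ 1 $ 2 + D2 ?u z * T z $ 2 $ 2 = ?u z * D2 ?v z"
    by (rule eventually_in_domain[OF \<psi>]) (use N in auto)
  show ?thesis
  proof (cases "d = 1")
    case True
    \<comment> \<open>For u = \<epsilon> y the equation du o L = u dv forces the lower right entry
      to vanish at the origin. Then dv o L = v dv + du gives b v_x = \<epsilon> there, so dv and du
      are independent.\<close>
    have D0: "D1 ?u 0 = 0" "D2 ?u 0 = \<epsilon>" using eventually_nhds_x_imp_x[OF Du] True by auto
    have "\<epsilon> * T 0 $ 2 $ 2 = 0" using eventually_nhds_x_imp_x[OF Neq] D0 u0 by simp
    then have "T 0 $ 2 $ 2 = 0" using \<epsilon>0 by simp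
    then have "D1 ?v 0 * T 0 $ 1 $ 2 = \<epsilon>" using eventually_nhds_x_imp_x[OF Neq] D0 v0 by simp
    then have "D1 ?v 0 \<noteq> 0" using \<epsilon>0 by auto
    then have "D1 ?v 0 * D2 ?u 0 - D2 ?v 0 * D1 ?u 0 \<noteq> 0" using D0 \<epsilon>0 by simp
    from normal_form_nondegenerate[OF atlas L \<psi> v0[unfolded T_def] u0[unfolded T_def] this[unfolded T_def]]
    show ?thesis .
  next
    case False
    then have d2: "2 \<le> d" using d by simp
    have c21: "\<forall>\<^sub>F z in nhds 0. real d * T z $ 2 $ 1 = z $ 2 * D1 ?v z"
    proof (rule cancel_power_y)
      show "\<forall>\<^sub>F z in nhds 0. (z $ 2) ^ (d - 1) * (real d * T z $ 2 $ 1) = (z $ 2) ^ (d - 1) * (z $ 2 * D1 ?v z)"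
        using Neq Du u
      proof eventually_elim
        case (elim z)
        have "(z $ 2) ^ d = (z $ 2) ^ (d - 1) * z $ 2" using d by (cases d) auto
        then have "\<epsilon> * ((z $ 2) ^ (d - 1) * (real d * T z $ 2 $ 1)) = \<epsilon> * ((z $ 2) ^ (d - 1) * (z $ 2 * D1 ?v z))"
          using elim by (simp add: mult_ac)
        then show ?case using \<epsilon>0 by simp
      qed
    qed (intro analytic_mult analytic_const analytic_y anT analytic_D1 anv)+
    have c22: "\<forall>\<^sub>F z in nhds 0. real d * T z $ 2 $ 2 = z $ 2 * D2 ?v z"
    proof (rule cancel_power_y)
      show "\<forall>\<^sub>F z in nhds 0. (z $ 2) ^ (d - 1) * (real d * T z $ 2 $ 2) = (z $ 2) ^ (d - 1) * (z $ 2 * D2 ?v z)"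
        using Neq Du u
      proof eventually_elim
        case (elim z)
        have "(z $ 2) ^ d = (z $ 2) ^ (d - 1) * z $ 2" using d by (cases d) auto
        then have "\<epsilon> * ((z $ 2) ^ (d - 1) * (real d * T z $ 2 $ 2)) = \<epsilon> * ((z $ 2) ^ (d - 1) * (z $ 2 * D2 ?v z))"
          using elim by (simp add: mult_ac)
        then show ?case using \<epsilon>0 by simp
      qed
    qed (intro analytic_mult analytic_const analytic_y anT analytic_D2 anv)+
    have eq: "\<forall>\<^sub>F z in nhds 0. T z $ 1 $ 2 * D1 ?v z
        = real d * \<epsilon> * (z $ 2) ^ (d - 1) + D2 ?v z * (?v z - z $ 2 * D2 ?v z / real d)"
      using Neq Du c22
    proof eventually_elim
      case (elim z)
      have "T z $ 2 $ 2 = z $ 2 * D2 ?v z / real d" using elim(3) d by (simp add: field_simps)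
      then show ?case using elim(1,2) by (simp add: algebra_simps)
    qed
    \<comment> \<open>The traces of the series O, P and S are instances of one shape;
      \<open>VV\<close> and \<open>UU\<close> stand for their named functions, so that one
      application of \<open>reduce_trace\<close> serves all of them.\<close>
    have rt: "\<exists>\<rho>. centred A W p \<rho> \<and> reconstructed_from (in_coords L \<rho>) VV UU (snd \<rho> ` fst \<rho>)"
      if "real_analytic_at X 0" "X 0 = 0" "D1 X 0 \<noteq> 0" "\<forall>\<^sub>F z in nhds 0. ?v z = VV (vec2 (X z) (z $ 2))"
        "\<And>z. VV z = \<alpha> * z $ 1 * (z $ 2) ^ s + (z $ 2) ^ q * cpoly k c (z $ 2) + \<beta> * (z $ 2) ^ l"
        "\<alpha> \<noteq> 0" "UU = (\<lambda>z. \<epsilon> * (z $ 2) ^ d)"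
      for X VV UU \<alpha> s q k c \<beta> l
      unfolding that(7)
      by (rule reduce_trace[OF atlas L \<psi> u[unfolded T_def] that(1-3) that(4)[unfolded T_def] that(5,6) \<epsilon>0 d]) blast
    consider
      (Nf) k \<sigma> where "k \<ge> 1" "\<sigma> \<in> {1, -1}" "d = 2 * k" "\<epsilon> = -1" "\<forall>\<^sub>F z in nhds 0. ?v z = 2 * \<sigma> * (z $ 2) ^ k"
    | (Of) X k c where "real_analytic_at X 0" "X 0 = 0" "D1 X 0 \<noteq> 0" "k \<ge> 1" "2 * k + 1 \<le> d" "O_alpha k d c \<noteq> 0"
        "\<forall>\<^sub>F z in nhds 0. ?v z = O_v k d c (vec2 (X z) (z $ 2))"
    | (Pf) X k s \<sigma> c where "real_analytic_at X 0" "X 0 = 0" "D1 X 0 \<noteq> 0" "k \<ge> 1" "s \<ge> 2 * k" "\<sigma> \<in> {1, -1}" "d = 2 * k" "\<epsilon> = -1"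
        "P_alpha k \<sigma> c \<noteq> 0" "\<forall>\<^sub>F z in nhds 0. ?v z = P_v k \<sigma> s c (vec2 (X z) (z $ 2))"
    | (S0) X k c where "real_analytic_at X 0" "X 0 = 0" "D1 X 0 \<noteq> 0" "k \<ge> 1" "d = 2 * k" "S_even_alpha k \<epsilon> c \<noteq> 0"
        "\<forall>\<^sub>F z in nhds 0. ?v z = S_even_v k \<epsilon> c (vec2 (X z) (z $ 2))"
    | (S1) X k c where "real_analytic_at X 0" "X 0 = 0" "D1 X 0 \<noteq> 0" "k \<ge> 1" "d = 2 * k + 1"
        "\<forall>\<^sub>F z in nhds 0. ?v z = S_odd_v k c (vec2 (X z) (z $ 2))"
      using trace_normal_form[OF anv anT b0 v0 d2 \<epsilon> eq]
      by (elim disjE exE bexE conjE)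
         ((rule that(1); assumption), (rule that(2); assumption), (rule that(3); assumption),
          (rule that(4); assumption), (rule that(5); assumption))
    then show ?thesis
    proof cases
      case Nf
      have "\<forall>\<^sub>F z in nhds 0. T z $ 1 $ 1 = \<sigma> * (z $ 2) ^ k \<and> T z $ 2 $ 1 = 0 \<and> T z $ 2 $ 2 = \<sigma> * (z $ 2) ^ k \<and> T z $ 1 $ 2 \<noteq> 0"
        using Nf(5) eventually_D_cong[OF Nf(5)] c21 c22 analytic_nonzero[OF anT b0]
      proof eventually_elim
        case (elim z)
        have D: "D1 ?v z = 0" "D2 ?v z = 2 * \<sigma> * (real k * (z $ 2) ^ (k - 1))"
          using elim(2) by (simp_all add: D_mult D_power analytic_power)
        have "(z $ 2) ^ k = z $ 2 * (z $ 2) ^ (k - 1)" using Nf(1) by (cases k) auto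
        then have "2 * real k * T z $ 2 $ 2 = 2 * real k * (\<sigma> * (z $ 2) ^ k)"
          using elim(4) unfolding D by (auto simp: Nf(3) mult_ac)
        \<comment> \<open>Here v_x = 0 kills the lower left entry, and y v_y / d = \<sigma> y^k
          because d = 2k; so each diagonal entry is half the trace.\<close>
        then have t22: "T z $ 2 $ 2 = \<sigma> * (z $ 2) ^ k" using Nf(1) by simp
        moreover have "T z $ 2 $ 1 = 0" using elim(3) d unfolding D by simp
        moreover have "T z $ 1 $ 1 = \<sigma> * (z $ 2) ^ k" using elim(1) t22 by (simp add: tr2_def)
        ultimately show ?case using elim(5) by simp
      qed
      from normal_form_double_eigenvalue[OF atlas L \<psi> Nf(2,1) this[unfolded T_def]] show ?thesis .
    next
      case Of
      have "O_v k d c z = O_alpha k d c * z $ 1 * (z $ 2) ^ (2 * k - 1) + (z $ 2) ^ k * cpoly k c (z $ 2) + 0 * (z $ 2) ^ 0" for z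
        by (simp add: O_v_def)
      moreover have "O_u d \<epsilon> = (\<lambda>z. \<epsilon> * (z $ 2) ^ d)" by (simp add: fun_eq_iff O_u_def)
      ultimately obtain \<rho> where \<rho>: "centred A W p \<rho>"
        "reconstructed_from (in_coords L \<rho>) (O_v k d c) (O_u d \<epsilon>) (snd \<rho> ` fst \<rho>)" using rt[OF Of(1-3,7) _ Of(6)] by blast
      have "normal_form (in_coords L \<rho>) (snd \<rho> ` fst \<rho>)"
        by (rule normal_form_O[OF Of(4,5) \<epsilon> Of(6) \<rho>(2)])
      then show ?thesis using \<rho>(1) by blast
    next
      case Pf
      have "P_v k \<sigma> s c z = P_alpha k \<sigma> c * z $ 1 * (z $ 2) ^ s + (z $ 2) ^ (s - k + 1) * cpoly k c (z $ 2) + (2 * \<sigma>) * (z $ 2) ^ k" for z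
        by (simp add: P_v_def)
      moreover have "P_u k = (\<lambda>z. \<epsilon> * (z $ 2) ^ d)" by (simp add: fun_eq_iff P_u_def Pf(7,8))
      ultimately obtain \<rho> where \<rho>: "centred A W p \<rho>"
        "reconstructed_from (in_coords L \<rho>) (P_v k \<sigma> s c) (P_u k) (snd \<rho> ` fst \<rho>)" using rt[OF Pf(1-3,10) _ Pf(9)] by blast
      have "normal_form (in_coords L \<rho>) (snd \<rho> ` fst \<rho>)"
        by (rule normal_form_P[OF Pf(4,5,6,9) \<rho>(2)])
      then show ?thesis using \<rho>(1) by blast
    next
      case S0
      have "S_even_v k \<epsilon> c z = S_even_alpha k \<epsilon> c * z $ 1 * (z $ 2) ^ (2 * k - 1) + (z $ 2) ^ k * cpoly k c (z $ 2) + 0 * (z $ 2) ^ 0" for z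
        by (simp add: S_even_v_def)
      moreover have "S_even_u k \<epsilon> = (\<lambda>z. \<epsilon> * (z $ 2) ^ d)" by (simp add: fun_eq_iff S_even_u_def S0(5))
      ultimately obtain \<rho> where \<rho>: "centred A W p \<rho>"
        "reconstructed_from (in_coords L \<rho>) (S_even_v k \<epsilon> c) (S_even_u k \<epsilon>) (snd \<rho> ` fst \<rho>)" using rt[OF S0(1-3,7) _ S0(6)] by blast
      have "normal_form (in_coords L \<rho>) (snd \<rho> ` fst \<rho>)"
        by (rule normal_form_S_even[OF S0(4) \<epsilon>(1) S0(6) \<rho>(2)])
      then show ?thesis using \<rho>(1) by blast
    next
      case S1
      have \<epsilon>1: "\<epsilon> = 1" using \<epsilon>(2) S1(5) by simp
      have nz: "real (2 * k + 1) \<noteq> 0" by simp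
      have "S_odd_v k c z = real (2 * k + 1) * z $ 1 * (z $ 2) ^ (2 * k) + (z $ 2) ^ (k + 1) * cpoly k c (z $ 2) + 0 * (z $ 2) ^ 0" for z
        by (simp add: S_odd_v_def)
      moreover have "S_odd_u k = (\<lambda>z. \<epsilon> * (z $ 2) ^ d)" by (simp add: fun_eq_iff S_odd_u_def S1(5) \<epsilon>1)
      ultimately obtain \<rho> where \<rho>: "centred A W p \<rho>"
        "reconstructed_from (in_coords L \<rho>) (S_odd_v k c) (S_odd_u k) (snd \<rho> ` fst \<rho>)" using rt[OF S1(1-3,6) _ nz] by blast
      have "normal_form (in_coords L \<rho>) (snd \<rho> ` fst \<rho>)"
        by (rule normal_form_S_odd[OF S1(4) \<rho>(2)])
      then show ?thesis using \<rho>(1) by blast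
    qed
  qed
qed

lemma normal_form_exists:
  assumes atlas: "analytic_atlas A" and L: "analytic_nijenhuis_operator A W L" and \<phi>: "centred A W p \<phi>"
    and T0: "in_coords L \<phi> 0 = mat2 0 1 0 0"
  shows "\<exists>\<rho>. centred A W p \<rho> \<and> normal_form (in_coords L \<rho>) (snd \<rho> ` fst \<rho>)"
proof -
  obtain \<psi> where \<psi>: "centred A W p \<psi>"
    and T: "\<And>z. z \<in> snd \<psi> ` fst \<psi> \<Longrightarrow> in_coords L \<psi> z $ 1 $ 2 \<noteq> 0 \<and> in_coords L \<psi> z $ 2 $ 2 = 0"
    and v0: "tr2 (in_coords L \<psi> 0) = 0" and u0: "neg_det (in_coords L \<psi> 0) = 0"
    by (rule flow_box_chart[OF atlas L \<phi> T0]) (rule that)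
  let ?T = "in_coords L \<psi>"
  let ?v = "\<lambda>z. tr2 (?T z)" and ?u = "\<lambda>z. neg_det (?T z)"
  show ?thesis
  proof (cases "\<forall>\<^sub>F z in nhds 0. ?u z = 0")
    case True
    from normal_form_det_zero[OF atlas L \<psi> T v0 True] show ?thesis .
  next
    case False
    note V0 = centred_domain(2)[OF \<psi>]
    note N = centred_equations[OF L \<psi>]
    have anu: "real_analytic_at ?u 0" and anv: "real_analytic_at ?v 0" using N(1,2)[OF V0] by auto
    have anT: "real_analytic_at (\<lambda>z. ?T z $ i $ j) 0" for i j using centred_nijenhuis(2)[OF L \<psi> V0] .
    have b0: "?T 0 $ 1 $ 2 \<noteq> 0" using T[OF V0] by simp
    have \<kappa>: "real_analytic_at (\<lambda>z. D2 ?v z / ?T z $ 1 $ 2) 0" by (rule analytic_divide[OF analytic_D2[OF anv] anT b0])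
    have ode: "\<forall>\<^sub>F z in nhds 0. D1 ?u z = (D2 ?v z / ?T z $ 1 $ 2) * ?u z"
    proof (rule eventually_in_domain[OF \<psi>])
      fix z assume z: "z \<in> snd \<psi> ` fst \<psi>"
      show "D1 ?u z = (D2 ?v z / ?T z $ 1 $ 2) * ?u z"
        using N(6)[OF z] T[OF z] by (simp add: field_simps)
    qed
    obtain d w where w: "real_analytic_at w 0" "w 0 \<noteq> 0" "\<forall>\<^sub>F z in nhds 0. ?u z = (z $ 2) ^ d * w z"
      by (rule order_of_unit_multiple[OF anu False \<kappa> ode]) (rule that)
    have d: "d \<ge> 1"
      using eventually_nhds_x_imp_x[OF w(3)] w(2) u0 by (cases d) auto
    obtain \<epsilon> g where g: "\<epsilon> \<in> {1, -1}" "odd d \<longrightarrow> \<epsilon> = 1" "real_analytic_at g 0" "g 0 \<noteq> 0"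
      "\<forall>\<^sub>F z in nhds 0. w z = \<epsilon> * g z ^ d"
      by (rule signed_root[OF w(1,2) d]) (rule that)
    define Y where "Y = (\<lambda>z. z $ 2 * g z)"
    have Y: "real_analytic_at Y 0" "Y 0 = 0" "D2 Y 0 \<noteq> 0" using g(3,4) by (simp_all add: Y_def analytic_mult D_mult)
    have P: "\<forall>\<^sub>F z in nhds 0. ?u z = \<epsilon> * Y z ^ d"
      using w(3) g(5) by eventually_elim (simp add: Y_def power_mult_distrib)
    have det: "D1 (\<lambda>z. z $ 1) 0 * D2 Y 0 - D2 (\<lambda>z. z $ 1) 0 * D1 Y 0 \<noteq> 0" using Y(3) by simp
    have x0: "(0::real^2) $ 1 = 0" by simp
    show ?thesis
    proof (rule coordinate_change[OF atlas L \<psi> analytic_x x0 Y(1,2) det P])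
      fix \<rho> H
      let ?V = "snd \<rho> ` fst \<rho>" and ?S = "in_coords L \<rho>"
      assume \<rho>: "centred A W p \<rho>" "H 0 = 0" "0 \<in> ?V"
        and HV: "\<And>z. z \<in> ?V \<Longrightarrow> H z \<in> snd \<psi> ` fst \<psi>"
        and PH: "\<And>z. z \<in> ?V \<Longrightarrow> ?u (H z) = \<epsilon> * Y (H z) ^ d"
        and YH: "\<And>z. z \<in> ?V \<Longrightarrow> Y (H z) = z $ 2"
        and e12: "\<And>z. z \<in> ?V \<Longrightarrow> ?S z $ 1 $ 1 * D2 (\<lambda>z. z $ 1) (H z) + ?S z $ 1 $ 2 * D2 Y (H z)
           = D1 (\<lambda>z. z $ 1) (H z) * ?T (H z) $ 1 $ 2 + D2 (\<lambda>z. z $ 1) (H z) * ?T (H z) $ 2 $ 2"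
        and tr: "\<And>z. z \<in> ?V \<Longrightarrow> tr2 (?S z) = tr2 (?T (H z))" "\<And>z. z \<in> ?V \<Longrightarrow> neg_det (?S z) = neg_det (?T (H z))"
      \<comment> \<open>Since x is kept, passing from y to Y only divides the upper right entry at
        the origin by Y_y, and it stays nonzero.\<close>
      have "?S 0 $ 1 $ 2 * D2 Y 0 = ?T 0 $ 1 $ 2" using e12[OF \<rho>(3)] \<rho>(2) by simp
      then have b: "?S 0 $ 1 $ 2 \<noteq> 0" using b0 by auto
      have v0': "tr2 (?S 0) = 0" using tr(1)[OF \<rho>(3)] \<rho>(2) v0 by simp
      have "\<forall>\<^sub>F z in nhds 0. neg_det (?S z) = \<epsilon> * (z $ 2) ^ d"
        by (rule eventually_in_domain[OF \<rho>(1)]) (use tr(2) PH YH in simp)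
      from normal_form_det_power[OF atlas L \<rho>(1) b v0' g(1,2) d this] show ?thesis .
    qed
  qed
qed

theorem theorem6p1:
  fixes A :: "'m::{t2_space, second_countable_topology} chart set"
    and W :: "'m set"
    and p :: 'm
    and L :: "'m chart \<Rightarrow> 'm \<Rightarrow> real^2^2"
    and c\<^sub>0 :: "'m chart"
  assumes "analytic_atlas A"
    and "open W" and "p \<in> W"
    and "analytic_nijenhuis_operator A W L"
    and "c\<^sub>0 \<in> charts A" and "p \<in> fst c\<^sub>0" and "L c\<^sub>0 p = mat2 0 1 0 0"
  shows "\<exists>\<phi>\<in>charts A. p \<in> fst \<phi> \<and> fst \<phi> \<subseteq> W \<and> snd \<phi> p = 0 \<and>
    (let V = snd \<phi> ` fst \<phi>; T = in_coords L \<phi> in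
       (\<forall>z\<in>V. T z = L_nil z) \<or>
       (\<forall>z\<in>V. T z = L_nd z) \<or>
       (\<exists>k\<ge>1. \<forall>z\<in>V. T z = M_odd k z) \<or>
       (\<exists>k\<ge>1. \<exists>\<epsilon>\<in>{1, -1}. \<forall>z\<in>V. T z = M_even k \<epsilon> z) \<or>
       (\<exists>k\<ge>1. \<forall>z\<in>V. T z = N_odd k z) \<or>
       (\<exists>k\<ge>1. \<exists>\<epsilon>\<in>{1, -1}. \<forall>z\<in>V. T z = N_even k \<epsilon> z) \<or>
       (\<exists>k\<ge>1. \<exists>d\<ge>2*k+1. \<exists>\<epsilon>\<in>{1, -1}. \<exists>c. (odd d \<longrightarrow> \<epsilon> = 1) \<and> O_alpha k d c \<noteq> 0 \<and>
          reconstructed_from T (O_v k d c) (O_u d \<epsilon>) V) \<or>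
       (\<exists>k\<ge>1. \<exists>s\<ge>2*k. \<exists>\<epsilon>\<in>{1, -1}. \<exists>c. P_alpha k \<epsilon> c \<noteq> 0 \<and>
          reconstructed_from T (P_v k \<epsilon> s c) (P_u k) V) \<or>
       (\<exists>k\<ge>1. \<exists>\<epsilon>\<in>{1, -1}. \<exists>c. S_even_alpha k \<epsilon> c \<noteq> 0 \<and>
          reconstructed_from T (S_even_v k \<epsilon> c) (S_even_u k \<epsilon>) V) \<or>
       (\<exists>k\<ge>1. \<exists>c. reconstructed_from T (S_odd_v k c) (S_odd_u k) V))"
proof -
  obtain \<phi>\<^sub>0 where \<phi>\<^sub>0: "centred A W p \<phi>\<^sub>0" "in_coords L \<phi>\<^sub>0 0 = L c\<^sub>0 p"
    by (rule centred_chart_exists[OF assms(1-6)]) (rule that)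
  have T0: "in_coords L \<phi>\<^sub>0 0 = mat2 0 1 0 0" using \<phi>\<^sub>0(2) assms(7) by simp
  obtain \<phi> where \<phi>: "centred A W p \<phi>" "normal_form (in_coords L \<phi>) (snd \<phi> ` fst \<phi>)"
    using normal_form_exists[OF assms(1,4) \<phi>\<^sub>0(1) T0] by blast
  show ?thesis
    unfolding Let_def by (rule bexI[of _ \<phi>]) (use \<phi> in \<open>simp_all only: centred_def normal_form_def simp_thms\<close>)
qed

end
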